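(* Let $d,k\ge 1$, let $\Omega\subseteq\mathbb{R}^d$ be a compact convex set, let $\mu_1,\dots,\mu_k$ be probability measures on $\Omega$, and let $p$ be a probability measure on $\Omega^k$. Let $L:\mathbb{R}^{kd}\to\mathbb{R}$ be a convex function which is $p$-translation-invariant, i.e. $$L(x-z)=L(x)\quad\text{for all } x\in\Omega^k \text{ and } p\text{-almost all } z\in\Omega^k .$$ Then $$\min_{\gamma\in\Pi(\mu_1,\dots,\mu_k)}\Gamma(\gamma)=\min_{(\pi,m)\in\mathcal{C}(p,\mu_1,\dots,\mu_k)}B(\pi,m),$$ and in particular the minima on both sides are attained. Further: (1) For any minimizer $\gamma_{\mathrm{opt}}\in\Pi(\mu_1,\dots,\mu_k)$ of the left-hand side there is a flow $(\pi_{\mathrm{opt}},m_{\mathrm{opt}})\in\mathcal{C}(p,\mu_1,\dots,\mu_k)$ (induced by $\gamma_{\mathrm{opt}}$) which is a minimizer of the right-hand side and satisfies $\pi_{\mathrm{opt}}(1,\cdot)=\gamma_{\mathrm{opt}}$. (2) For any minimizer $(\pi_{\mathrm{opt}},m_{\mathrm{opt}})\in\mathcal{C}(p,\mu_1,\dots,\mu_k)$ of the right-hand side, the measure $\pi_{\mathrm{opt}}(1,\cdot)$ is a minimizer of the left-hand side.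
   Context: Identify $(\mathbb{R}^d)^k\cong\mathbb{R}^{kd}$ and write $x=(x_1,\dots,x_k)$ with $x_l\in\mathbb{R}^d$; $[k]=\{1,\dots,k\}$. Static problem: $\Pi(\mu_1,\dots,\mu_k)$ is the set of probability measures on $\Omega^k$ whose respective marginals on the $k$ factors are $\mu_1,\dots,\mu_k$, and for a probability measure $\gamma$ on $\Omega^k$, $$\Gamma(\gamma)=\int_{\Omega^k}L(x_1,\dots,x_k)\,d\gamma(x_1,\dots,x_k).$$ Dynamical problem: $\mathcal{P}(\Omega^k)$ is the set of probability measures on $\Omega^k$ with the weak convergence topology, $C([0,1];\mathcal{P}(\Omega^k))$ is the set of continuous maps $[0,1]\to\mathcal{P}(\Omega^k)$, and $\mathcal{M}([0,1]\times\Omega^k;\mathbb{R}^{kd})$ is the set of $\mathbb{R}^{kd}$-valued measures on $[0,1]\times\Omega^k$. Such vector measures are understood to be of the form $dm(t,x)\,dt$, with $m(t,\cdot)$ an $\mathbb{R}^{kd}$-valued measure on $\Omega^k$. The set $\mathcal{C}(p,\mu_1,\dots,\mu_k)$ consists of all pairs $(\pi,m)\in C([0,1];\mathcal{P}(\Omega^k))\times\mathcal{M}([0,1]\times\Omega^k;\mathbb{R}^{kd})$ such that: - $m\ll\pi$, meaning that $m(t,\cdot)$ is absolutely continuous with respect to $\pi(t,\cdot)$ for all $t\in[0,1]$; - $\int_0^1\int_{\Omega^k}\left|\frac{dm(t,x)}{d\pi(t,x)}\right|^{r}d\pi(t,x)\,dt<+\infty$ for some exponent $r>1$; - $\partial_t\pi+\nabla\cdot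 m=0$ in the weak sense: for every continuously differentiable $\eta\in C^1([0,1]\times\Omega^k;\mathbb{R})$, $$\int_0^1\!\int_{\Omega^k}\partial_t\eta\,d\pi(t,x)\,dt+\int_0^1\!\int_{\Omega^k}\langle\nabla\eta(t,x),dm(t,x)\rangle\,dt=\int_{\Omega^k}\eta(1,x)\,d\pi(1,x)-\int_{\Omega^k}\eta(0,x)\,d\pi(0,x);$$ - $\pi(0,\cdot)=p$ and, for all $l\in[k]$, the $l$-th marginal $\pi_l(1,\cdot)$ of $\pi(1,\cdot)$ equals $\mu_l$. For $(\pi,m)\in\mathcal{C}(p,\mu_1,\dots,\mu_k)$ the dynamical cost is $$B(\pi,m)=\int_0^1\int_{\Omega^k}L\!\left(\frac{dm(t,x)}{d\pi(t,x)}\right)d\pi(t,x)\,dt .$$ *)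

theory Defs
  imports "HOL-Probability.Probability"
begin

section \<open>Probability measures and the weak topology\<close>

text \<open>
  \<open>(\<real>\<^sup>d)\<^sup>k\<close> is the type \<^typ>\<open>real^'d^'k\<close>, whose inner product and norm are those of
  \<open>\<real>\<^sup>k\<^sup>d\<close>; \<open>cpower \<Omega>\<close> is \<open>\<Omega>\<^sup>k\<close>.
\<close>

definition cpower :: "(real^'d) set \<Rightarrow> (real^'d^'k) set" where
  "cpower \<Omega> = {x. \<forall>l. x $ l \<in> \<Omega>}"

abbreviation borel_on :: "'a::topological_space set \<Rightarrow> 'a measure" where
  "borel_on X \<equiv> restrict_space borel X"

definition prob_measures :: "'a::topological_space set \<Rightarrow> 'a measure set" where
  "prob_measures X = {\<nu>. prob_space \<nu> \<and> sets \<nu> = sets (borel_on X)}"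

text \<open>The coarsest topology making \<open>\<nu> \<mapsto> \<integral>f d\<nu>\<close> continuous for all bounded continuous \<open>f\<close> on \<open>X\<close>.\<close>

definition weak_topology :: "'a::topological_space set \<Rightarrow> 'a measure topology" where
  "weak_topology X = topology_generated_by
     {{\<nu> \<in> prob_measures X. (\<integral>x. f x \<partial>\<nu>) \<in> U} | (f :: 'a \<Rightarrow> real) U.
        continuous_on X f \<and> bounded (f ` X) \<and> open U}"

definition marginal :: "(real^'d) set \<Rightarrow> 'k \<Rightarrow> (real^'d^'k) measure \<Rightarrow> (real^'d) measure" where
  "marginal \<Omega> l \<gamma> = distr \<gamma> (borel_on \<Omega>) (\<lambda>x. x $ l)"


section \<open>The static problem\<close>

definition couplings ::
  "(real^'d) set \<Rightarrow> ('k \<Rightarrow> (real^'d) measure) \<Rightarrow> (real^'d^'k) measure set" where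
  "couplings \<Omega> \<mu> = {\<gamma> \<in> prob_measures (cpower \<Omega>). \<forall>l. marginal \<Omega> l \<gamma> = \<mu> l}"

definition static_cost :: "('a \<Rightarrow> real) \<Rightarrow> 'a measure \<Rightarrow> real" where
  "static_cost L \<gamma> = (\<integral>x. L x \<partial>\<gamma>)"


section \<open>Vector-valued measures\<close>

text \<open>
  A vector measure is a set function, of which only the values on \<open>sets M\<close> matter; in
  \<open>vector_measure M\<close> the measure \<open>M\<close> serves only as a carrier of its \<open>\<sigma>\<close>-algebra.
\<close>

definition vector_measure :: "'a measure \<Rightarrow> ('a set \<Rightarrow> 'b::euclidean_space) \<Rightarrow> bool" where
  "vector_measure M m \<longleftrightarrow>
     m {} = 0 \<and>
     (\<forall>A. range A \<subseteq> sets M \<longrightarrow> disjoint_family A \<longrightarrow>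
        (\<lambda>i::nat. m (A i)) sums m (\<Union>i. A i))"

definition vector_abs_continuous :: "'a measure \<Rightarrow> ('a set \<Rightarrow> 'b::euclidean_space) \<Rightarrow> bool" where
  "vector_abs_continuous M m \<longleftrightarrow> (\<forall>A\<in>null_sets M. m A = 0)"

text \<open>The Radon-Nikodym density \<open>dm/dM\<close>, unique up to \<open>M\<close>-null sets.\<close>

definition vector_RN_deriv ::
  "'a measure \<Rightarrow> ('a set \<Rightarrow> 'b::euclidean_space) \<Rightarrow> 'a \<Rightarrow> 'b" where
  "vector_RN_deriv M m =
     (SOME v. integrable M v \<and> (\<forall>A\<in>sets M. m A = (\<integral>x\<in>A. v x \<partial>M)))"

text \<open>\<open>\<integral>\<langle>F, dm\<rangle>\<close> for \<open>m\<close> absolutely continuous with respect to \<open>M\<close>, where \<open>dm = (dm/dM) dM\<close>.\<close>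

definition vector_integral ::
  "'a measure \<Rightarrow> ('a set \<Rightarrow> 'b::euclidean_space) \<Rightarrow> ('a \<Rightarrow> 'b) \<Rightarrow> real" where
  "vector_integral M m F = (\<integral>x. F x \<bullet> vector_RN_deriv M m x \<partial>M)"

text \<open>
  A vector measure on \<open>[0,1] \<times> X\<close> of the form \<open>dm(t,x) dt\<close>, given by the family \<open>m t\<close>;
  \<open>Pair t -` A\<close> is the slice \<open>{x. (t,x) \<in> A}\<close>.
\<close>

definition spacetime_vector_measure ::
  "'a::euclidean_space set \<Rightarrow> (real \<Rightarrow> 'a set \<Rightarrow> 'a) \<Rightarrow> bool" where
  "spacetime_vector_measure X m \<longleftrightarrow>
     (\<forall>t\<in>{0..1}. vector_measure (borel_on X) (m t)) \<and>
     (\<forall>A\<in>sets (borel_on ({0..1} \<times> X)).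
        integrable (lebesgue_on {0..1}) (\<lambda>t. m t (Pair t -` A))) \<and>
     vector_measure (borel_on ({0..1} \<times> X))
       (\<lambda>A. \<integral>t. m t (Pair t -` A) \<partial>lebesgue_on {0..1})"


section \<open>The dynamical problem\<close>

text \<open>
  \<open>\<eta>\<close> is \<open>C\<^sup>1\<close> on \<open>[0,1] \<times> X\<close> with time derivative \<open>\<eta>t\<close> and spatial gradient \<open>G\<close>, one-sided at
  the boundary. If \<open>X\<close> has empty interior, \<open>G\<close> is not determined by the values of \<open>\<eta>\<close> on
  \<open>[0,1] \<times> X\<close>; every continuous choice is then admitted. For convex compact \<open>X\<close> these are (by
  Whitney's extension theorem) exactly the restrictions to \<open>[0,1] \<times> X\<close> of \<open>C\<^sup>1\<close> functions on
  the whole space together with their derivatives.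
\<close>

definition C1_test ::
  "'a::euclidean_space set \<Rightarrow> (real \<times> 'a \<Rightarrow> real) \<Rightarrow> (real \<times> 'a \<Rightarrow> real) \<Rightarrow> (real \<times> 'a \<Rightarrow> 'a) \<Rightarrow> bool"
where
  "C1_test X \<eta> \<eta>t G \<longleftrightarrow>
     continuous_on ({0..1} \<times> X) \<eta>t \<and> continuous_on ({0..1} \<times> X) G \<and>
     (\<forall>z\<in>{0..1} \<times> X.
        (\<eta> has_derivative (\<lambda>(s, h). s * \<eta>t z + G z \<bullet> h)) (at z within {0..1} \<times> X))"

definition continuity_equation ::
  "'a::euclidean_space set \<Rightarrow> (real \<Rightarrow> 'a measure) \<Rightarrow> (real \<Rightarrow> 'a set \<Rightarrow> 'a) \<Rightarrow> bool" where
  "continuity_equation X \<pi> m \<longleftrightarrow>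
     (\<forall>\<eta> \<eta>t G. C1_test X \<eta> \<eta>t G \<longrightarrow>
        (\<integral>t. (\<integral>x. \<eta>t (t, x) \<partial>\<pi> t) \<partial>lebesgue_on {0..1}) +
        (\<integral>t. vector_integral (\<pi> t) (m t) (\<lambda>x. G (t, x)) \<partial>lebesgue_on {0..1}) =
        (\<integral>x. \<eta> (1, x) \<partial>\<pi> 1) - (\<integral>x. \<eta> (0, x) \<partial>\<pi> 0))"

definition flows ::
  "(real^'d) set \<Rightarrow> (real^'d^'k) measure \<Rightarrow> ('k \<Rightarrow> (real^'d) measure) \<Rightarrow>
     ((real \<Rightarrow> (real^'d^'k) measure) \<times> (real \<Rightarrow> (real^'d^'k) set \<Rightarrow> real^'d^'k)) set" where
  "flows \<Omega> p \<mu> = {(\<pi>, m).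
     continuous_map (top_of_set {0..1}) (weak_topology (cpower \<Omega>)) \<pi> \<and>
     spacetime_vector_measure (cpower \<Omega>) m \<and>
     (\<forall>t\<in>{0..1}. vector_abs_continuous (\<pi> t) (m t)) \<and>
     (\<exists>r>1. (\<integral>\<^sup>+t. (\<integral>\<^sup>+x. ennreal (norm (vector_RN_deriv (\<pi> t) (m t) x) powr r) \<partial>\<pi> t)
               \<partial>lebesgue_on {0..1}) < \<infinity>) \<and>
     continuity_equation (cpower \<Omega>) \<pi> m \<and>
     \<pi> 0 = p \<and>
     (\<forall>l. marginal \<Omega> l (\<pi> 1) = \<mu> l)}"

text \<open>
  The Lebesgue integral with values in the extended reals. The dynamical cost needs it, since
  \<open>L(dm/d\<pi>)\<close> may have integral \<open>+\<infinity>\<close>. Its negative part has finite integral on \<open>flows\<close> (a convex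
  \<open>L\<close> has an affine minorant), so the case \<open>\<infinity> - \<infinity>\<close> does not arise.
\<close>

definition ereal_integral :: "'a measure \<Rightarrow> ('a \<Rightarrow> ereal) \<Rightarrow> ereal" where
  "ereal_integral M f =
     enn2ereal (\<integral>\<^sup>+x. e2ennreal (f x) \<partial>M) - enn2ereal (\<integral>\<^sup>+x. e2ennreal (- f x) \<partial>M)"

definition dynamic_cost ::
  "('a::euclidean_space \<Rightarrow> real) \<Rightarrow> (real \<Rightarrow> 'a measure) \<times> (real \<Rightarrow> 'a set \<Rightarrow> 'a) \<Rightarrow> ereal" where
  "dynamic_cost L = (\<lambda>(\<pi>, m).
     ereal_integral (lebesgue_on {0..1})
       (\<lambda>t. ereal_integral (\<pi> t) (\<lambda>x. ereal (L (vector_RN_deriv (\<pi> t) (m t) x)))))"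

end

theory Submission
  imports Defs
begin

text \<open>
  A coupling \<open>\<gamma>\<close> induces a flow: for independent \<open>Z \<sim> p\<close> and \<open>W \<sim> \<gamma>\<close> let \<open>\<pi> t\<close> be the law of
  \<open>(1 - t) Z + t W\<close>, with velocity the conditional expectation of \<open>W - Z\<close>. By Jensen and
  translation invariance its cost is at most \<open>E L(W - Z) = \<Gamma>(\<gamma>)\<close>.

  For the converse, let \<open>b\<close> be the barycentre of \<open>p\<close>. Invariance forces \<open>L(x - b) = L(x)\<close> on
  \<open>\<Omega>\<^sup>k\<close>, and forces every subgradient \<open>g\<close> of \<open>L\<close> at \<open>x - b\<close> to be orthogonal to \<open>z - b\<close> for
  \<open>p\<close>-almost all \<open>z\<close>. Hence a tangent \<open>u \<mapsto> a + g \<bullet> u\<close> of \<open>L\<close> at \<open>x - b\<close> yields a function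
  \<open>\<eta>(t, y) = a t + g \<bullet> (y - b)\<close> with \<open>\<partial>\<^sub>t \<eta> + \<langle>\<nabla>\<eta>, u\<rangle> \<le> L u\<close> that vanishes \<open>p\<close>-almost everywhere
  at \<open>t = 0\<close>. The soft maximum of finitely many of these is an admissible test function that is
  almost \<open>0\<close> at \<open>t = 0\<close> and almost at least \<open>L\<close> at \<open>t = 1\<close>, so the continuity equation gives
  \<open>\<Gamma>(\<pi> 1) \<le> B(\<pi>, m)\<close>.

  A static minimiser exists by weak compactness, reduced to Helly's theorem on the line.
\<close>

section \<open>The Radon-Nikodym theorem for vector measures\<close>

text \<open>A competitor \<open>(\<pi>, m)\<close> is only a weak solution: it carries no
  trajectories, and its velocity, chosen separately for each \<open>t\<close>, is not known to be
  jointly measurable. So the lower bound is obtained by duality with smooth subsolutions rather than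
  by following particles. Velocities range over the whole space, whereas invariance speaks of
  \<open>x\<close> in the power of \<open>\<Omega>\<close> only; tangents bridge this gap, since
  they lie below \<open>L\<close> everywhere. The base point of the tangents matters. A subgradient
  at \<open>x - z0\<close> with a typical \<open>z0\<close> only gives
  \<open>g \<bullet> (z - z0) \<ge> 0\<close> almost everywhere, the wrong sign at time 0. At the
  barycentre the same function also has mean zero, hence vanishes. Mean zero alone would not
  suffice, because the maximum of several functions of mean zero can have positive mean. The
  barycentre may lie in the exceptional null set, so invariance under it needs its own proof. The
  soft maximum replaces the maximum because test functions must be continuously
  differentiable.\<close>

lemma vector_measure_Un:
  assumes "vector_measure M m" "A \<in> sets M" "B \<in> sets M" "A \<inter> B = {}"
  shows "m (A \<union> B) = m A + m B"
proof -
  have "(\<lambda>i. m (binaryset A B i)) sums m (\<Union>i. binaryset A B i)"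
    using assms unfolding vector_measure_def
    by (intro assms(1)[unfolded vector_measure_def, THEN conjunct2, rule_format])
       (auto simp: range_binaryset_eq disjoint_family_on_def binaryset_def)
  moreover have "(\<lambda>i. m (binaryset A B i)) sums (m A + m B)"
    using assms(1) by (intro binaryset_sums) (simp add: vector_measure_def)
  ultimately show ?thesis
    by (simp add: UN_binaryset_eq sums_unique2)
qed

lemma vector_measure_Diff:
  assumes "vector_measure M m" "A \<in> sets M" "B \<in> sets M" "B \<subseteq> A"
  shows "m (A - B) = m A - m B"
proof -
  have "m (B \<union> (A - B)) = m B + m (A - B)"
    using assms by (intro vector_measure_Un[of M]) auto
  moreover have "B \<union> (A - B) = A" using assms by auto
  ultimately show ?thesis by (simp add: algebra_simps)
qed

text \<open>If \<open>m\<close> is unbounded on the subsets of a set, the set splits into two parts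
  of norm at least 1, one of which has the same defect. Iteration sheds disjoint pieces of norm at
  least 1, which contradicts convergence of their series.\<close>

lemma vector_measure_bounded:
  assumes m: "vector_measure M m"
  shows "\<exists>C. \<forall>A\<in>sets M. norm (m A) \<le> C"
proof (rule ccontr)
  assume nb: "\<not> ?thesis"
  define big where "big E \<longleftrightarrow> E \<in> sets M \<and> (\<forall>C. \<exists>B\<in>sets M. B \<subseteq> E \<and> norm (m B) > C)" for E
  have big0: "big (space M)"
  proof -
    have "\<exists>B\<in>sets M. B \<subseteq> space M \<and> norm (m B) > C" for C
      using nb sets.sets_into_space by (metis not_le)
    then show ?thesis by (simp add: big_def)
  qed
  have step: "\<exists>F. big F \<and> F \<subseteq> E \<and> norm (m (E - F)) \<ge> 1" if "big E" for E
  proof -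
    have E: "E \<in> sets M" using that by (simp add: big_def)
    \<comment> \<open>The surplus over \<open>norm (m E)\<close> gives both \<open>B\<close> and
      \<open>E - B\<close> norm at least 1, so either of them can be the piece that is shed.\<close>
    obtain B where B: "B \<in> sets M" "B \<subseteq> E" "norm (m B) > norm (m E) + 1"
      using \<open>big E\<close> unfolding big_def by blast
    have D: "m (E - B) = m E - m B"
      using vector_measure_Diff[OF m E B(1,2)] .
    have D1: "norm (m (E - B)) \<ge> 1"
      using B(3) norm_triangle_ineq2[of "m B" "m E"] D by (simp add: norm_minus_commute)
    show ?thesis
    proof (cases "big B")
      case True
      then show ?thesis using B D1 by auto
    next
      case False
      then obtain C where C: "\<And>A. A \<in> sets M \<Longrightarrow> A \<subseteq> B \<Longrightarrow> norm (m A) \<le> C"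
        using B(1) unfolding big_def by (metis not_le)
      have "\<exists>A\<in>sets M. A \<subseteq> E - B \<and> norm (m A) > K" for K
      proof -
        obtain A where A: "A \<in> sets M" "A \<subseteq> E" "norm (m A) > K + C"
          using \<open>big E\<close> unfolding big_def by blast
        have "m A = m (A \<inter> B) + m (A - B)"
          using vector_measure_Un[OF m, of "A \<inter> B" "A - B"] A B
          by (metis Diff_disjoint Int_Diff_Un Int_Diff_disjoint sets.Diff sets.Int)
        then have "norm (m A) \<le> C + norm (m (A - B))"
          using C[of "A \<inter> B"] A B norm_triangle_ineq[of "m (A \<inter> B)" "m (A - B)"] by auto
        then show ?thesis using A B by (intro bexI[of _ "A - B"]) auto
      qed
      then have "big (E - B)" using E B by (auto simp: big_def)
      moreover have "E - (E - B) = B" using B by auto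
      moreover have "norm (m B) \<ge> 1" using B(3) by (smt (verit) norm_ge_zero)
      ultimately show ?thesis by (intro exI[of _ "E - B"]) auto
    qed
  qed
  obtain F where F0: "\<And>n. big (F n)" and F1: "\<And>n. F (Suc n) \<subseteq> F n \<and> norm (m (F n - F (Suc n))) \<ge> 1"
    using dependent_nat_choice[of "\<lambda>_. big" "\<lambda>_ E F. F \<subseteq> E \<and> norm (m (E - F)) \<ge> 1"] big0 step
    by metis
  have dec: "decseq F" using F1 by (simp add: decseq_Suc_iff)
  have "disjoint_family (\<lambda>n. F n - F (Suc n))"
  proof -
    have "(F i - F (Suc i)) \<inter> (F j - F (Suc j)) = {}" if "i < j" for i j
      using decseqD[OF dec, of "Suc i" j] that by auto
    then show ?thesis unfolding disjoint_family_on_def by (metis Int_commute nat_neq_iff)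
  qed
  moreover have "range (\<lambda>n. F n - F (Suc n)) \<subseteq> sets M"
    using F0 by (auto simp: big_def)
  ultimately have "(\<lambda>n. m (F n - F (Suc n))) sums m (\<Union>n. F n - F (Suc n))"
    using m unfolding vector_measure_def by blast
  then have "(\<lambda>n. m (F n - F (Suc n))) \<longlonglongrightarrow> 0"
    using sums_summable summable_LIMSEQ_zero by blast
  then obtain n where "norm (m (F n - F (Suc n))) < 1"
    using LIMSEQ_D[of "\<lambda>n. m (F n - F (Suc n))" 0 1] by auto
  then show False using F1[of n] by simp
qed

lemma Radon_Nikodym_nonneg:
  fixes n :: "'a set \<Rightarrow> real"
  assumes "finite_measure M" and n: "vector_measure M n" and nn: "\<And>A. A \<in> sets M \<Longrightarrow> n A \<ge> 0"
    and ac: "vector_abs_continuous M n"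
  shows "\<exists>f. integrable M f \<and> (\<forall>A\<in>sets M. n A = (\<integral>x\<in>A. f x \<partial>M))"
proof -
  interpret finite_measure M by fact
  define N where "N = measure_of (space M) (sets M) (\<lambda>A. ennreal (n A))"
  have sN: "sets N = sets M" by (simp add: N_def)
  have eN: "emeasure N A = ennreal (n A)" if "A \<in> sets M" for A
    unfolding N_def
  proof (rule emeasure_measure_of_sigma)
    show "sigma_algebra (space M) (sets M)" by (rule sets.sigma_algebra_axioms)
    show "positive (sets M) (\<lambda>A. ennreal (n A))"
      using n by (simp add: positive_def vector_measure_def)
    show "countably_additive (sets M) (\<lambda>A. ennreal (n A))"
    proof (rule countably_additiveI)
      fix A :: "nat \<Rightarrow> 'a set"
      assume A: "range A \<subseteq> sets M" "disjoint_family A" "(\<Union>i. A i) \<in> sets M"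
      have "(\<lambda>i. n (A i)) sums n (\<Union>i. A i)"
        using n A unfolding vector_measure_def by blast
      then show "(\<Sum>i. ennreal (n (A i))) = ennreal (n (\<Union>i. A i))"
        using A nn by (metis range_subsetD suminf_ennreal2 sums_iff)
    qed
    show "A \<in> sets M" by fact
  qed
  have "absolutely_continuous M N"
    unfolding absolutely_continuous_def
  proof
    fix A assume A: "A \<in> null_sets M"
    then have "n A = 0" using ac by (simp add: vector_abs_continuous_def)
    then show "A \<in> null_sets N" using A eN[of A] sN by (simp add: null_sets_def)
  qed
  then obtain f where f: "f \<in> borel_measurable M" "density M f = N"
    using Radon_Nikodym_finite_measure_infinite[of N] sN by auto
  have I: "(\<integral>\<^sup>+x. f x * indicator A x \<partial>M) = ennreal (n A)" if "A \<in> sets M" for A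
    using that f eN emeasure_density[OF f(1), of A] by simp
  have "(\<integral>\<^sup>+x. f x \<partial>M) \<noteq> \<infinity>"
    using I[of "space M"] by (simp cong: nn_integral_cong)
  then have fin: "AE x in M. f x \<noteq> \<infinity>" and fi: "(\<integral>\<^sup>+x. f x \<partial>M) < \<infinity>"
    using f(1) nn_integral_PInf_AE[of f M] by (auto simp: less_top)
  define h where "h x = enn2real (f x)" for x
  have hm: "h \<in> borel_measurable M" using f(1) unfolding h_def by measurable
  have hf: "AE x in M. ennreal (h x) = f x"
    using fin by eventually_elim (simp add: h_def less_top)
  have hi: "integrable M h"
  proof (rule integrableI_nonneg[OF hm])
    show "AE x in M. 0 \<le> h x" by (simp add: h_def)
    show "(\<integral>\<^sup>+x. ennreal (h x) \<partial>M) < \<infinity>"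
      using nn_integral_cong_AE[OF hf] fi by simp
  qed
  have "n A = (\<integral>x\<in>A. h x \<partial>M)" if A: "A \<in> sets M" for A
  proof -
    have "(\<integral>\<^sup>+x. ennreal (h x * indicator A x) \<partial>M) = (\<integral>\<^sup>+x. f x * indicator A x \<partial>M)"
      by (rule nn_integral_cong_AE) (use hf in \<open>eventually_elim, auto simp: indicator_def\<close>)
    moreover have "0 \<le> h x * indicator A x" for x by (simp add: h_def)
    moreover have "(\<lambda>x. h x * indicator A x) \<in> borel_measurable M" using hm A by measurable
    ultimately have "(\<integral>x. h x * indicator A x \<partial>M) = n A"
      using I[OF A] nn[OF A] by (subst integral_eq_nn_integral) auto
    then show ?thesis by (simp add: set_lebesgue_integral_def mult.commute)
  qed
  with hi show ?thesis by blast
qed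

text \<open>
  \<open>n\<close> is split as \<open>V - (V - n)\<close> with the positive variation \<open>V A = sup {n B | B \<subseteq> A}\<close>.
\<close>

lemma Radon_Nikodym_signed:
  fixes n :: "'a set \<Rightarrow> real"
  assumes "finite_measure M" and n: "vector_measure M n" and ac: "vector_abs_continuous M n"
  shows "\<exists>f. integrable M f \<and> (\<forall>A\<in>sets M. n A = (\<integral>x\<in>A. f x \<partial>M))"
proof -
  obtain C where C: "\<And>A. A \<in> sets M \<Longrightarrow> \<bar>n A\<bar> \<le> C"
    using vector_measure_bounded[OF n] by auto
  define V where "V A = (SUP B\<in>{B\<in>sets M. B \<subseteq> A}. ennreal (n B))" for A
  have V_ub: "ennreal (n B) \<le> V A" if "B \<in> sets M" "B \<subseteq> A" for A B
    unfolding V_def using that by (intro SUP_upper) auto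
  \<comment> \<open>Boundedness of \<open>n\<close> keeps \<open>V\<close> finite, without which
    \<open>V - n\<close> would be meaningless.\<close>
  have V_fin: "V A \<le> ennreal C" for A
    unfolding V_def using C by (intro SUP_least ennreal_leI) (auto simp: abs_le_iff)
  have V0: "V {} = 0" using n by (auto simp: V_def vector_measure_def image_def cong: conj_cong)
  have V_sup: "V A + V B \<le> V (A \<union> B)" if AB: "A \<inter> B = {}" for A B
  proof -
    have ne: "{B\<in>sets M. B \<subseteq> A} \<noteq> {}" for A by auto
    have "ennreal (n A') + ennreal (n B') \<le> V (A \<union> B)"
      if "A' \<in> sets M" "A' \<subseteq> A" "B' \<in> sets M" "B' \<subseteq> B" for A' B'
    proof -
      have "n (A' \<union> B') = n A' + n B'"
        using that AB by (intro vector_measure_Un[OF n]) auto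
      moreover have "ennreal (n (A' \<union> B')) \<le> V (A \<union> B)"
        using that by (intro V_ub) auto
      moreover have "ennreal (n A') \<le> V (A \<union> B)" "ennreal (n B') \<le> V (A \<union> B)"
        using that by (auto intro!: V_ub)
      \<comment> \<open>If one of the two values is negative, its \<open>ennreal\<close> is 0 and
        the other part alone bounds the sum.\<close>
      ultimately show ?thesis
        by (cases "n A' \<ge> 0"; cases "n B' \<ge> 0") (auto simp: ennreal_plus[symmetric] ennreal_neg
           simp del: ennreal_plus)
    qed
    then have "ennreal (n A') + V B \<le> V (A \<union> B)" if "A' \<in> sets M" "A' \<subseteq> A" for A'
      unfolding V_def[of B] using that
      by (subst ennreal_SUP_add_right) (use ne in \<open>auto intro!: SUP_least\<close>)
    then show ?thesis
      unfolding V_def[of A] by (subst ennreal_SUP_add_left[symmetric]) (use ne in \<open>auto intro!: SUP_least\<close>)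
  qed
  have V_mono: "V A \<le> V B" if "A \<subseteq> B" for A B
    unfolding V_def using that by (intro SUP_subset_mono) auto
  have V_sums: "(\<Sum>i. V (A i)) = V (\<Union>i. A i)"
    if A: "range A \<subseteq> sets M" "disjoint_family A" for A :: "nat \<Rightarrow> 'a set"
  proof (rule antisym)
    have "(\<Sum>i<k. V (A i)) \<le> V (\<Union>i<k. A i)" for k
    proof (induction k)
      case 0 then show ?case by (simp)
    next
      case (Suc k)
      have "(\<Union>i<k. A i) \<inter> A k = {}"
        using A(2) unfolding disjoint_family_on_def by (metis (no_types, lifting) UNIV_I UN_E disjoint_iff lessThan_iff nat_less_le)
      then have "V (\<Union>i<k. A i) + V (A k) \<le> V (\<Union>i<Suc k. A i)"
        using V_sup[of "\<Union>i<k. A i" "A k"] by (simp add: lessThan_Suc Un_commute)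
      from order.trans[OF add_right_mono[OF Suc.IH] this] show ?case by (simp add: lessThan_Suc add.commute)
    qed
    also have "V (\<Union>i<k. A i) \<le> V (\<Union>i. A i)" for k by (intro V_mono) auto
    finally show "(\<Sum>i. V (A i)) \<le> V (\<Union>i. A i)"
      by (intro suminf_le_const) auto
  next
    \<comment> \<open>Every \<open>B\<close> inside the union is cut along the \<open>A i\<close>;
      the partial sums over its pieces are bounded by the series of variations.\<close>
    show "V (\<Union>i. A i) \<le> (\<Sum>i. V (A i))"
      unfolding V_def[of "\<Union>i. A i"]
    proof (rule SUP_least, clarsimp)
      fix B assume B: "B \<in> sets M" "B \<subseteq> (\<Union>i. A i)"
      have "range (\<lambda>i. B \<inter> A i) \<subseteq> sets M" "disjoint_family (\<lambda>i. B \<inter> A i)"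
        using A B by (auto simp: disjoint_family_on_def)
      then have "(\<lambda>i. n (B \<inter> A i)) sums n (\<Union>i. B \<inter> A i)"
        using n unfolding vector_measure_def by blast
      moreover have "(\<Union>i. B \<inter> A i) = B" using B by auto
      ultimately have "(\<lambda>k. ennreal (\<Sum>i<k. n (B \<inter> A i))) \<longlonglongrightarrow> ennreal (n B)"
        by (intro tendsto_ennrealI) (simp add: sums_def)
      moreover have "ennreal (\<Sum>i<k. n (B \<inter> A i)) \<le> (\<Sum>i. V (A i))" for k
      proof -
        have "ennreal (\<Sum>i<k. n (B \<inter> A i)) \<le> ennreal (\<Sum>i<k. max 0 (n (B \<inter> A i)))"
          by (intro ennreal_leI sum_mono) auto
        also have "\<dots> = (\<Sum>i<k. ennreal (max 0 (n (B \<inter> A i))))"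
          by (rule sum_ennreal[symmetric]) auto
        also have "\<dots> \<le> (\<Sum>i<k. V (A i))"
          using A B by (intro sum_mono) (auto simp: max_def intro!: V_ub)
        also have "\<dots> \<le> (\<Sum>i. V (A i))" by (intro sum_le_suminf) auto
        finally show ?thesis .
      qed
      ultimately show "ennreal (n B) \<le> (\<Sum>i. V (A i))"
        by (intro LIMSEQ_le_const2) auto
    qed
  qed
  define n1 where "n1 A = enn2real (V A)" for A
  have n1V: "ennreal (n1 A) = V A" for A
    unfolding n1_def using le_less_trans[OF V_fin[of A] ennreal_less_top] by (rule ennreal_enn2real)
  have n1: "vector_measure M n1"
    unfolding vector_measure_def
  proof (intro conjI allI impI)
    show "n1 {} = 0" by (simp add: n1_def V0)
    fix A :: "nat \<Rightarrow> 'a set" assume A: "range A \<subseteq> sets M" "disjoint_family A"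
    have "(\<lambda>i. ennreal (n1 (A i))) sums ennreal (n1 (\<Union>i. A i))"
      using V_sums[OF A] by (simp add: n1V sums_iff)
    then show "(\<lambda>i. n1 (A i)) sums n1 (\<Union>i. A i)"
      by (simp add: n1_def)
  qed
  have n1ac: "vector_abs_continuous M n1"
    unfolding vector_abs_continuous_def
  proof
    fix A assume A: "A \<in> null_sets M"
    have "n B = 0" if "B \<in> sets M" "B \<subseteq> A" for B
      using ac null_sets_subset[OF A that] by (auto simp: vector_abs_continuous_def)
    then have "V A \<le> 0" unfolding V_def by (intro SUP_least) simp
    then show "n1 A = 0" by (simp add: n1_def)
  qed
  have n2: "vector_measure M (\<lambda>A. n1 A - n A)"
    using n n1 by (auto simp: vector_measure_def intro!: sums_diff)
  have n2ac: "vector_abs_continuous M (\<lambda>A. n1 A - n A)"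
    using ac n1ac by (auto simp: vector_abs_continuous_def)
  have n2nn: "n1 A - n A \<ge> 0" if "A \<in> sets M" for A
  proof -
    have "ennreal (n A) \<le> ennreal (n1 A)" using V_ub[OF that] by (simp add: n1V)
    then show ?thesis by (simp add: ennreal_le_iff2 n1_def) 
        (metis enn2real_nonneg order_trans)
  qed
  obtain f where f: "integrable M f" "\<And>A. A \<in> sets M \<Longrightarrow> n1 A = (\<integral>x\<in>A. f x \<partial>M)"
    using Radon_Nikodym_nonneg[OF assms(1) n1 _ n1ac] by (auto simp: n1_def)
  obtain g where g: "integrable M g" "\<And>A. A \<in> sets M \<Longrightarrow> n1 A - n A = (\<integral>x\<in>A. g x \<partial>M)"
    using Radon_Nikodym_nonneg[OF assms(1) n2 _ n2ac] n2nn by auto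
  have "n A = (\<integral>x\<in>A. (f x - g x) \<partial>M)" if A: "A \<in> sets M" for A
  proof -
    have "(\<integral>x\<in>A. (f x - g x) \<partial>M) = (\<integral>x\<in>A. f x \<partial>M) - (\<integral>x\<in>A. g x \<partial>M)"
      using A f(1) g(1) by (intro set_integral_diff)
        (simp_all only: set_integrable_def integrable_mult_indicator)
    then show ?thesis using f(2) g(2) A by force
  qed
  then show ?thesis using f g by (intro exI[of _ "\<lambda>x. f x - g x"]) auto
qed

text \<open>Coordinates reduce this to the signed case. Reassembling them along \<open>Basis\<close>
  gives one density, whose existence turns the \<open>SOME\<close> in \<open>vector_RN_deriv\<close>
  into a genuine choice.\<close>

lemma vector_RN_deriv:
  fixes m :: "'a set \<Rightarrow> 'b::euclidean_space"
  assumes M: "finite_measure M" and m: "vector_measure M m" and ac: "vector_abs_continuous M m"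
  shows vector_RN_deriv_integrable: "integrable M (vector_RN_deriv M m)"
    and vector_RN_deriv_eq: "A \<in> sets M \<Longrightarrow> m A = (\<integral>x\<in>A. vector_RN_deriv M m x \<partial>M)"
proof -
  have "\<exists>f. integrable M f \<and> (\<forall>A\<in>sets M. m A \<bullet> b = (\<integral>x\<in>A. f x \<partial>M))" for b
    using m ac by (intro Radon_Nikodym_signed M)
      (auto simp: vector_measure_def vector_abs_continuous_def intro!: bounded_linear.sums[OF bounded_linear_inner_left])
  then obtain f where f: "\<And>b. integrable M (f b)" "\<And>b A. A \<in> sets M \<Longrightarrow> m A \<bullet> b = (\<integral>x\<in>A. f b x \<partial>M)"
    by metis
  define v where "v x = (\<Sum>b\<in>Basis. f b x *\<^sub>R b)" for x
  have v: "integrable M v" unfolding v_def using f(1) by auto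
  have "m A = (\<integral>x\<in>A. v x \<partial>M)" if A: "A \<in> sets M" for A
  proof -
    have i: "integrable M (\<lambda>x. indicator A x *\<^sub>R f b x *\<^sub>R b)" for b
      using integrable_mult_indicator[OF A integrable_scaleR_left[OF f(1), of b]] by simp
    have "(\<integral>x\<in>A. v x \<partial>M) = (\<Sum>b\<in>Basis. \<integral>x. indicator A x *\<^sub>R f b x *\<^sub>R b \<partial>M)"
      unfolding set_lebesgue_integral_def v_def scaleR_right.sum
      by (rule Bochner_Integration.integral_sum) (rule i)
    also have "\<dots> = (\<Sum>b\<in>Basis. (\<integral>x\<in>A. f b x \<partial>M) *\<^sub>R b)"
    proof (rule sum.cong)
      fix b :: 'b
      have "(\<integral>x. (indicator A x *\<^sub>R f b x) *\<^sub>R b \<partial>M) = (\<integral>x\<in>A. f b x \<partial>M) *\<^sub>R b"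
        unfolding set_lebesgue_integral_def
        by (rule integral_scaleR_left) (use integrable_mult_indicator[OF A f(1)] in auto)
      then show "(\<integral>x. indicator A x *\<^sub>R f b x *\<^sub>R b \<partial>M) = (\<integral>x\<in>A. f b x \<partial>M) *\<^sub>R b"
        by simp
    qed simp
    also have "\<dots> = m A" using f(2)[OF A] by (simp add: euclidean_representation flip: f(2)[OF A])
    finally show ?thesis by simp
  qed
  with v have "integrable M v \<and> (\<forall>A\<in>sets M. m A = (\<integral>x\<in>A. v x \<partial>M))" by blast
  then have "integrable M (vector_RN_deriv M m) \<and> (\<forall>A\<in>sets M. m A = (\<integral>x\<in>A. vector_RN_deriv M m x \<partial>M))"
    unfolding vector_RN_deriv_def
    by (rule someI[of "\<lambda>v. integrable M v \<and> (\<forall>A\<in>sets M. m A = (\<integral>x\<in>A. v x \<partial>M))"])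
  then show "integrable M (vector_RN_deriv M m)"
    "A \<in> sets M \<Longrightarrow> m A = (\<integral>x\<in>A. vector_RN_deriv M m x \<partial>M)" by auto
qed

section \<open>Convex functions and integrals\<close>

text \<open>The nonnegative integral of an arbitrary function is a supremum over simple functions
  below it, hence monotone without measurability. This matters because the integrand in time of the
  dynamical cost is not known to be measurable.\<close>

lemma ereal_integral_mono:
  assumes "\<And>x. x \<in> space M \<Longrightarrow> f x \<le> g x"
  shows "ereal_integral M f \<le> ereal_integral M g"
  unfolding ereal_integral_def using assms
  by (intro ereal_minus_mono iffD2[OF less_eq_ennreal.rep_eq[symmetric]] nn_integral_mono)
     (auto intro!: e2ennreal_mono)

lemma ereal_integral_eq_integral:
  assumes "integrable M f"
  shows "ereal_integral M (\<lambda>x. ereal (f x)) = ereal (\<integral>x. f x \<partial>M)"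
proof -
  have "(\<integral>\<^sup>+x. ennreal (f x) \<partial>M) < \<infinity>" "(\<integral>\<^sup>+x. ennreal (- f x) \<partial>M) < \<infinity>"
    using assms by (auto simp: real_integrable_def less_top)
  then show ?thesis
    unfolding ereal_integral_def real_lebesgue_integral_def[OF assms]
    by (cases "\<integral>\<^sup>+x. ennreal (f x) \<partial>M"; cases "\<integral>\<^sup>+x. ennreal (- f x) \<partial>M")
       (auto simp: e2ennreal_ereal)
qed

text \<open>A hyperplane separates \<open>(x, L x)\<close> from the strict epigraph. It cannot be
  vertical because \<open>L\<close> is finite everywhere: moving from \<open>x\<close> against the
  normal would violate the separation.\<close>

lemma convex_on_subgradient:
  fixes L :: "'a::euclidean_space \<Rightarrow> real"
  assumes "convex_on UNIV L"
  shows "\<exists>g. \<forall>y. L x + g \<bullet> (y - x) \<le> L y"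
proof -
  define T where "T = {(y, r). L y < r}"
  have "convex T"
    unfolding convex_def
  proof (clarsimp simp: T_def)
    fix y r y' r' and u v :: real
    assume *: "L y < r" "L y' < r'" "0 \<le> u" "0 \<le> v" "u + v = 1"
    have "L (u *\<^sub>R y + v *\<^sub>R y') \<le> u * L y + v * L y'"
      using assms * unfolding convex_on_def by auto
    also have "\<dots> < u * r + v * r'"
      using * by (smt (verit, best) mult_left_mono mult_strict_left_mono)
    finally show "L (u *\<^sub>R y + v *\<^sub>R y') < u * r + v * r'" .
  qed
  moreover have "{(x, L x)} \<inter> T = {}" "T \<noteq> {}"
    by (auto simp: T_def intro!: exI[of _ x] exI[of _ "L x + 1"])
  ultimately obtain a b where ab: "a \<noteq> 0" "a \<bullet> (x, L x) \<le> b" "\<And>z. z \<in> T \<Longrightarrow> b \<le> a \<bullet> z"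
    using separating_hyperplane_sets[of "{(x, L x)}" T] by (metis convex_singleton insert_not_empty insertI1)
  obtain u c where a: "a = (u, c)" by fastforce
  have ineq: "u \<bullet> x + c * L x \<le> u \<bullet> y + c * r" if "L y < r" for y r
    using ab(2) ab(3)[of "(y, r)"] that by (simp add: a T_def)
  have "c \<ge> 0" using ineq[of x "L x + 1"] by (simp add: algebra_simps)
  moreover have "c \<noteq> 0"
  proof
    assume "c = 0"
    then have "u \<bullet> x \<le> u \<bullet> (x - u)" using ineq[of "x - u" "L (x - u) + 1"] by simp
    then have "u \<bullet> u \<le> 0" by (simp add: inner_diff_right)
    then have "u = 0" by (metis antisym inner_ge_zero inner_eq_zero_iff)
    with ab(1) a \<open>c = 0\<close> show False by (simp add: zero_prod_def)
  qed
  ultimately have c: "c > 0" by simp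
  have "L x + (- (1 / c) *\<^sub>R u) \<bullet> (y - x) \<le> L y" for y
  proof (rule field_le_epsilon)
    fix e :: real assume "e > 0"
    then have "u \<bullet> x + c * L x \<le> u \<bullet> y + c * (L y + e)" using ineq[of y "L y + e"] by simp
    then have "c * (L x - (1 / c) * (u \<bullet> (y - x))) \<le> c * (L y + e)"
      using c by (simp add: algebra_simps inner_diff_right)
    then show "L x + (- (1 / c) *\<^sub>R u) \<bullet> (y - x) \<le> L y + e"
      using c by simp
  qed
  then show ?thesis by blast
qed

lemma convex_on_UNIV_continuous:
  fixes L :: "'a::euclidean_space \<Rightarrow> real"
  assumes "convex_on UNIV L"
  shows "continuous_on A L"
  using convex_on_continuous[OF open_UNIV assms] continuous_on_subset by blast

text \<open>A unit step from \<open>x\<close> along \<open>g x\<close> raises \<open>L\<close> by at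
  least \<open>norm (g x)\<close>, while \<open>L\<close> is bounded on the ball of radius
  \<open>R + 1\<close>.\<close>

lemma subgradient_bounded:
  fixes L :: "'a::euclidean_space \<Rightarrow> real"
  assumes L: "convex_on UNIV L" and g: "\<And>x y. L x + g x \<bullet> (y - x) \<le> L y"
  shows "\<exists>C. \<forall>x\<in>cball 0 R. norm (g x) \<le> C"
proof -
  have "compact (L ` cball 0 (R + 1))"
    by (intro compact_continuous_image convex_on_UNIV_continuous[OF L] compact_cball)
  then obtain K where "\<forall>x\<in>cball 0 (R + 1). \<bar>L x\<bar> \<le> K"
    using compact_imp_bounded[of "L ` cball 0 (R + 1)"] by (auto simp: bounded_iff)
  then have K: "\<bar>L x\<bar> \<le> K" if "norm x \<le> R + 1" for x using that by simp
  have "norm (g x) \<le> 2 * K" if "norm x \<le> R" for x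
  proof (cases "g x = 0")
    case True
    then show ?thesis using K[of x] that by simp
  next
    case False
    have "norm (x + sgn (g x)) \<le> R + 1"
      using norm_triangle_ineq[of x "sgn (g x)"] that False by (simp add: norm_sgn)
    moreover have "L x + norm (g x) \<le> L (x + sgn (g x))"
      using g[of x "x + sgn (g x)"] False
      by (simp add: sgn_div_norm dot_square_norm power2_eq_square field_simps)
    ultimately show ?thesis using K[of x] K[of "x + sgn (g x)"] that by simp
  qed
  then show ?thesis by (intro exI[of _ "2 * K"]) simp
qed

lemma (in prob_space) convex_integral_ge:
  fixes V :: "'a \<Rightarrow> 'b::euclidean_space"
  assumes L: "convex_on UNIV L" and V: "integrable M V" and LV: "integrable M (\<lambda>x. L (V x))"
  shows "L (\<integral>x. V x \<partial>M) \<le> (\<integral>x. L (V x) \<partial>M)"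
proof -
  define c where "c = (\<integral>x. V x \<partial>M)"
  obtain g where g: "\<And>y. L c + g \<bullet> (y - c) \<le> L y" using convex_on_subgradient[OF L] by blast
  have "(\<integral>x. L c + g \<bullet> (V x - c) \<partial>M) \<le> (\<integral>x. L (V x) \<partial>M)"
    using V LV g by (intro integral_mono) auto
  also have "(\<integral>x. L c + g \<bullet> (V x - c) \<partial>M) = L c"
    using V by (simp add: c_def prob_space)
  finally show ?thesis by (simp add: c_def)
qed

lemma (in prob_space) integral_in_closed_convex:
  fixes V :: "'a \<Rightarrow> 'b::euclidean_space"
  assumes "closed X" "convex X" and V: "integrable M V" and X: "AE x in M. V x \<in> X"
  shows "(\<integral>x. V x \<partial>M) \<in> X"
proof (rule ccontr)
  assume "\<not> ?thesis"
  then obtain a b where ab: "a \<bullet> (\<integral>x. V x \<partial>M) < b" "\<And>x. x \<in> X \<Longrightarrow> a \<bullet> x > b"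
    using separating_hyperplane_closed_point[OF assms(2,1)] by blast
  have "b \<le> (\<integral>x. a \<bullet> V x \<partial>M)"
    using V X ab(2) by (intro integral_ge_const) (auto intro: less_imp_le)
  then show False using ab(1) V by simp
qed

section \<open>Integration against probability measures on a compact set\<close>

lemma prob_measuresD:
  assumes "\<nu> \<in> prob_measures X"
  shows "prob_space \<nu>" "sets \<nu> = sets (borel_on X)" "space \<nu> = X"
  using assms sets_eq_imp_space_eq[of \<nu> "borel_on X"] by (auto simp: prob_measures_def space_restrict_space)

lemma prob_measures_measurable:
  assumes "\<nu> \<in> prob_measures X" "continuous_on X f"
  shows "f \<in> borel_measurable \<nu>"
  using borel_measurable_continuous_on_restrict[OF assms(2)] prob_measuresD(2)[OF assms(1)]
  by (simp cong: measurable_cong_sets)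

lemma prob_measures_integrable:
  fixes f :: "'a::topological_space \<Rightarrow> 'b::euclidean_space"
  assumes \<nu>: "\<nu> \<in> prob_measures X" and X: "compact X" and f: "continuous_on X f"
  shows "integrable \<nu> f"
proof -
  interpret prob_space \<nu> by (rule prob_measuresD[OF \<nu>])
  obtain B where "\<And>x. x \<in> X \<Longrightarrow> norm (f x) \<le> B"
    using compact_imp_bounded[OF compact_continuous_image[OF f X]] by (auto simp: bounded_iff)
  then show ?thesis
    using prob_measuresD(3)[OF \<nu>] by (intro integrable_const_bound[of _ B] prob_measures_measurable[OF \<nu> f]) auto
qed

section \<open>The barycentre of a measure leaving the cost invariant\<close>

locale invariant_cost =
  fixes X :: "'a::euclidean_space set" and p :: "'a measure" and L :: "'a \<Rightarrow> real"
  assumes X: "compact X" "convex X"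
    and p: "p \<in> prob_measures X"
    and L: "convex_on UNIV L"
    and inv: "\<And>x. x \<in> X \<Longrightarrow> AE z in p. L (x - z) = L x"
begin

sublocale prob_space p
  by (rule prob_measuresD[OF p])

lemma AE_p_X: "AE z in p. z \<in> X"
  using prob_measuresD(3)[OF p] by (intro AE_I2) simp

lemma L_cont: "continuous_on A L"
  by (rule convex_on_UNIV_continuous[OF L])

lemma integrable_p:
  fixes f :: "'a \<Rightarrow> 'b::euclidean_space"
  assumes "continuous_on X f"
  shows "integrable p f"
  by (rule prob_measures_integrable[OF p X(1) assms])

text \<open>The exceptional null set in \<open>inv\<close> depends on \<open>x\<close>. A countable
  dense subset of \<open>X\<close> involves only countably many of them, and continuity of
  \<open>L\<close> extends the identity to all of \<open>X\<close>.\<close>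

lemma uniform_inv: "AE z in p. \<forall>x\<in>X. L (x - z) = L x"
proof -
  obtain T where T: "countable T" "T \<subseteq> X" "X \<subseteq> closure T" using separable by metis
  have "AE z in p. \<forall>x\<in>T. L (x - z) = L x"
    using T inv by (simp add: AE_ball_countable subset_iff)
  then show ?thesis
  proof eventually_elim
    case (elim z)
    have "closed {x. L (x - z) = L x}"
      by (intro closed_Collect_eq continuous_intros continuous_on_compose2[OF L_cont[of UNIV]]) auto
    then have "closure T \<subseteq> {x. L (x - z) = L x}" using elim by (intro closure_minimal) auto
    then show ?case using T by auto
  qed
qed

definition bary :: 'a where "bary = (\<integral>z. z \<partial>p)"

lemma bary_in: "bary \<in> X"
  unfolding bary_def using X AE_p_X compact_imp_closed
  by (intro integral_in_closed_convex integrable_p continuous_intros) auto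

lemma L_diff_integral: "integrable p (\<lambda>z. L (x - z))" "L (x - bary) \<le> (\<integral>z. L (x - z) \<partial>p)"
proof -
  show i: "integrable p (\<lambda>z. L (x - z))"
    by (intro integrable_p continuous_on_compose2[OF L_cont[of UNIV]] continuous_intros) auto
  have "(\<integral>z. x - z \<partial>p) = x - bary"
    using integrable_p[of "\<lambda>z. z"] by (simp add: bary_def prob_space)
  then show "L (x - bary) \<le> (\<integral>z. L (x - z) \<partial>p)"
    using convex_integral_ge[OF L integrable_p[of "\<lambda>z. x - z"] i] by (simp add: continuous_intros)
qed

text \<open>
  With \<open>x\<^sub>s = (1 - s) x + s b\<close>, \<open>b\<close> the barycentre: for almost all \<open>w\<close>, \<open>z\<close> invariance gives
  \<open>L ((1-s) x + s z - w) = L ((1-s) (x - z))\<close>. Averaging over \<open>z\<close> bounds \<open>L (x\<^sub>s - w) = L x\<^sub>s\<close>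
  from above, and convexity between \<open>x\<^sub>s - z\<close> and \<open>x\<^sub>s - b\<close> bounds the right-hand side.
\<close>

lemma L_segment_le:
  assumes x: "x \<in> X" and s: "0 < s" "s < 1"
  shows "L ((1 - s) *\<^sub>R x + s *\<^sub>R bary) \<le> L ((1 - s) *\<^sub>R x + s *\<^sub>R bary - bary)"
proof -
  define y where "y = (1 - s) *\<^sub>R x + s *\<^sub>R bary"
  have y: "y \<in> X" unfolding y_def using X(2) x bary_in s by (auto simp: convex_alt)
  have ae: "AE w in p. w \<in> X \<and> (\<forall>x\<in>X. L (x - w) = L x)"
    using uniform_inv AE_p_X by eventually_elim auto
  \<comment> \<open>One fixed \<open>w\<close>, good for all points of \<open>X\<close> at once,
    keeps the left-hand side constant while \<open>z\<close> is averaged.\<close>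
  then obtain w where w: "\<And>x. x \<in> X \<Longrightarrow> L (x - w) = L x"
    using eventually_happens[OF ae] by (auto simp: trivial_limit_def ae_filter_eq_bot_iff emeasure_space_1)
  let ?q = "\<lambda>z. (1 - s) *\<^sub>R x + s *\<^sub>R z"
  have "(\<integral>z. ?q z - w \<partial>p) = y - w"
    using integrable_p[of "\<lambda>z. z"] by (simp add: y_def bary_def prob_space)
  moreover have i: "integrable p (\<lambda>z. L (?q z - w))"
    by (intro integrable_p continuous_on_compose2[OF L_cont[of UNIV]] continuous_intros) auto
  ultimately have "L (y - w) \<le> (\<integral>z. L (?q z - w) \<partial>p)"
    using convex_integral_ge[OF L integrable_p[of "\<lambda>z. ?q z - w"] i] by (simp add: continuous_intros)
  also have "\<dots> \<le> (\<integral>z. (1 - s) * L y + s * L (y - bary) \<partial>p)"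
  proof (rule integral_mono_AE[OF i])
    show "AE z in p. L (?q z - w) \<le> (1 - s) * L y + s * L (y - bary)"
      using ae
    proof eventually_elim
      case (elim z)
      have q: "?q z \<in> X" using X(2) x elim s by (auto simp: convex_alt)
      have "?q z - z = (1 - s) *\<^sub>R (y - z) + s *\<^sub>R (y - bary)"
        by (simp add: y_def algebra_simps)
      then have "L (?q z - z) \<le> (1 - s) * L (y - z) + s * L (y - bary)"
        using convex_onD[OF L, of s "y - z" "y - bary"] s by simp
      \<comment> \<open>\<open>?q z\<close> lies in \<open>X\<close>, so subtracting
        \<open>z\<close> and subtracting \<open>w\<close> give the same value
        \<open>L (?q z)\<close>.\<close>
      moreover have "L (?q z - z) = L (?q z - w)" "L (y - z) = L y" using elim w q y by auto
      ultimately show ?case by simp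
    qed
  qed simp
  also have "\<dots> = (1 - s) * L y + s * L (y - bary)" by (simp add: prob_space)
  \<comment> \<open>As \<open>L (y - w) = L y\<close>, the share \<open>(1 - s) * L y\<close>
    cancels and a multiple of \<open>s\<close> remains, which is why \<open>s\<close> must be
    positive.\<close>
  finally have "s * L y \<le> s * L (y - bary)" using w[OF y] by (simp add: algebra_simps)
  then show ?thesis using s by (simp add: y_def)
qed

text \<open>Jensen gives one inequality. Almost-everywhere invariance says nothing directly about
  the single point \<open>bary\<close>, so the other one is the limit of \<open>L_segment_le\<close>
  as \<open>s\<close> tends to 0 from the right.\<close>

lemma L_bary: 
  assumes x: "x \<in> X"
  shows "L (x - bary) = L x"
proof (rule antisym)
  have "(\<integral>z. L (x - z) \<partial>p) = (\<integral>z. L x \<partial>p)"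
    using inv[OF x] L_diff_integral(1) by (intro integral_cong_AE) auto
  then show "L (x - bary) \<le> L x" using L_diff_integral(2)[of x] by (simp add: prob_space)
  have "\<forall>\<^sub>F s in at_right (0::real). L ((1 - s) *\<^sub>R x + s *\<^sub>R bary) \<le> L ((1 - s) *\<^sub>R x + s *\<^sub>R bary - bary)"
    using L_segment_le[OF x] eventually_at_right_real[of 0 1] by (auto elim: eventually_mono)
  moreover have LC: "isCont L y" for y using L_cont[of UNIV] by (simp add: continuous_on_eq_continuous_at)
  have "((\<lambda>s. L ((1 - s) *\<^sub>R x + s *\<^sub>R bary)) \<longlongrightarrow> L ((1 - 0) *\<^sub>R x + 0 *\<^sub>R bary)) (at_right 0)"
    by (intro isCont_tendsto_compose[OF LC] tendsto_intros)
  moreover have "((\<lambda>s. L ((1 - s) *\<^sub>R x + s *\<^sub>R bary - bary)) \<longlongrightarrow> L ((1 - 0) *\<^sub>R x + 0 *\<^sub>R bary - bary)) (at_right 0)"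
    by (intro isCont_tendsto_compose[OF LC] tendsto_intros)
  ultimately have "L ((1 - 0) *\<^sub>R x + 0 *\<^sub>R bary) \<le> L ((1 - 0) *\<^sub>R x + 0 *\<^sub>R bary - bary)"
    by (intro tendsto_le) auto
  then show "L x \<le> L (x - bary)" by simp
qed

text \<open>The function \<open>z \<mapsto> g \<bullet> (z - b)\<close> is nonnegative almost everywhere and has mean zero.\<close>

lemma subgradient_orthogonal:
  assumes x: "x \<in> X" and g: "\<And>y. L (x - bary) + g \<bullet> (y - (x - bary)) \<le> L y"
  shows "AE z in p. g \<bullet> (z - bary) = 0"
proof -
  have i: "integrable p (\<lambda>z. g \<bullet> (z - bary))" by (intro integrable_p continuous_intros)
  have nn: "AE z in p. 0 \<le> g \<bullet> (z - bary)"
    using inv[OF x]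
  proof eventually_elim
    case (elim z)
    \<comment> \<open>The tangent is tested at \<open>x - z\<close>, where \<open>L\<close> takes
      the same value as at \<open>x - bary\<close>.\<close>
    show ?case using g[of "x - z"] elim L_bary[OF x] by (simp add: inner_diff_right)
  qed
  have "(\<integral>z. g \<bullet> (z - bary) \<partial>p) = 0"
    using integrable_p[of "\<lambda>z. z"] by (simp add: bary_def prob_space)
  then show ?thesis using integral_nonneg_eq_0_iff_AE[OF i nn] by simp
qed

end

section \<open>The dynamical cost and test functions\<close>

text \<open>Against a step function the pairing sees \<open>v\<close> only through its integrals
  over sets, that is, through values of a vector measure. The later extensions from sets to
  functions start here.\<close>

lemma integral_inner_step:
  fixes v :: "'a \<Rightarrow> 'b::euclidean_space"
  assumes "finite I" "\<And>i. i \<in> I \<Longrightarrow> A i \<in> sets N" and v: "integrable N v"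
  shows "(\<integral>x. (\<Sum>i\<in>I. indicator (A i) x *\<^sub>R c i) \<bullet> v x \<partial>N) = (\<Sum>i\<in>I. c i \<bullet> (\<integral>x\<in>A i. v x \<partial>N))"
proof -
  have i: "integrable N (\<lambda>x. indicator (A i) x *\<^sub>R v x)" if "i \<in> I" for i
    using assms that by (intro integrable_mult_indicator) auto
  have "(\<integral>x. (\<Sum>i\<in>I. indicator (A i) x *\<^sub>R c i) \<bullet> v x \<partial>N)
      = (\<integral>x. (\<Sum>i\<in>I. c i \<bullet> (indicator (A i) x *\<^sub>R v x)) \<partial>N)"
    by (simp add: inner_sum_left)
  also have "\<dots> = (\<Sum>i\<in>I. \<integral>x. c i \<bullet> (indicator (A i) x *\<^sub>R v x) \<partial>N)"
    using i by (intro Bochner_Integration.integral_sum integrable_inner_right) auto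
  also have "\<dots> = (\<Sum>i\<in>I. c i \<bullet> (\<integral>x\<in>A i. v x \<partial>N))"
    unfolding set_lebesgue_integral_def using i by (intro sum.cong integral_inner_right) auto
  finally show ?thesis .
qed

section \<open>Continuity of curves in the weak topology\<close>

lemma weak_topology_topspace: "topspace (weak_topology X) = prob_measures X"
proof -
  let ?S = "{{\<nu> \<in> prob_measures X. (\<integral>x. f x \<partial>\<nu>) \<in> U} | (f :: 'a \<Rightarrow> real) U.
        continuous_on X f \<and> bounded (f ` X) \<and> open U}"
  \<comment> \<open>The zero function together with \<open>UNIV\<close> imposes no
    condition.\<close>
  have "prob_measures X \<in> ?S"
    by (rule CollectI, rule exI[of _ "\<lambda>_. 0"], rule exI[of _ UNIV]) (auto simp: image_constant_conv)
  moreover have "\<Union>?S \<subseteq> prob_measures X" by blast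
  ultimately show ?thesis unfolding weak_topology_def topology_generated_by_topspace by blast
qed

lemma weak_path_prob_measures:
  assumes "continuous_map (top_of_set {0..1::real}) (weak_topology X) \<pi>" "t \<in> {0..1}"
  shows "\<pi> t \<in> prob_measures X"
  using assms continuous_map_image_subset_topspace[OF assms(1)] by (auto simp: weak_topology_topspace)

lemma weak_path_continuous_iff:
  "continuous_map (top_of_set {0..1::real}) (weak_topology X) \<pi> \<longleftrightarrow>
     (\<forall>t\<in>{0..1}. \<pi> t \<in> prob_measures X) \<and>
     (\<forall>f::'a::topological_space \<Rightarrow> real. continuous_on X f \<longrightarrow> bounded (f ` X) \<longrightarrow>
        continuous_on {0..1} (\<lambda>t. \<integral>x. f x \<partial>\<pi> t))"
    (is "?L \<longleftrightarrow> ?P \<and> ?C")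
proof (intro iffI conjI)
  assume L: ?L
  show P: ?P using weak_path_prob_measures[OF L] by blast
  show ?C
  proof (intro allI impI)
    fix f :: "'a \<Rightarrow> real" assume f: "continuous_on X f" "bounded (f ` X)"
    show "continuous_on {0..1} (\<lambda>t. \<integral>x. f x \<partial>\<pi> t)"
      unfolding continuous_on_open_invariant
    proof (intro allI impI)
      fix U :: "real set" assume U: "open U"
      have "openin (weak_topology X) {\<nu> \<in> prob_measures X. (\<integral>x. f x \<partial>\<nu>) \<in> U}"
        unfolding weak_topology_def using f U by (intro topology_generated_by_Basis) blast
      then have "openin (top_of_set {0..1})
         {t \<in> topspace (top_of_set {0..1}). \<pi> t \<in> {\<nu> \<in> prob_measures X. (\<integral>x. f x \<partial>\<nu>) \<in> U}}"
        using L unfolding continuous_map_def by blast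
      moreover have "{t \<in> topspace (top_of_set {0..1}). \<pi> t \<in> {\<nu> \<in> prob_measures X. (\<integral>x. f x \<partial>\<nu>) \<in> U}}
         = (\<lambda>t. \<integral>x. f x \<partial>\<pi> t) -` U \<inter> {0..1}"
        using P by auto
      ultimately show "\<exists>A. open A \<and> A \<inter> {0..1} = (\<lambda>t. \<integral>x. f x \<partial>\<pi> t) -` U \<inter> {0..1}"
        by (auto simp: openin_open)
    qed
  qed
next
  assume PC: "?P \<and> ?C"
  show ?L
    unfolding weak_topology_def
  proof (rule continuous_on_generated_topo, goal_cases)
    case (1 W)
    then obtain f :: "'a \<Rightarrow> real" and U where
      W: "W = {\<nu> \<in> prob_measures X. (\<integral>x. f x \<partial>\<nu>) \<in> U}" "continuous_on X f" "bounded (f ` X)" "open U"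
      by blast
    then have "continuous_on {0..1} (\<lambda>t. \<integral>x. f x \<partial>\<pi> t)" using PC by blast
    then obtain A where A: "open A" "A \<inter> {0..1} = (\<lambda>t. \<integral>x. f x \<partial>\<pi> t) -` U \<inter> {0..1}"
      using W(4) unfolding continuous_on_open_invariant by blast
    have "\<pi> -` W \<inter> topspace (top_of_set {0..1}) = {0..1} \<inter> A"
      using A(2) W(1) PC by auto
    then show ?case using A(1) by (auto simp: openin_open)
  next
    case 2
    show ?case
      using PC weak_topology_topspace[of X]
      unfolding weak_topology_def topology_generated_by_topspace by auto
  qed
qed

section \<open>Pairing of a flow with test functions\<close>

lemma uniformly_continuous_slice:
  fixes h :: "real \<times> 'a::metric_space \<Rightarrow> real"
  assumes "compact X" "continuous_on ({0..1} \<times> X) h" "e > 0"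
  obtains d where "d > 0"
    "\<And>s t x. s \<in> {0..1} \<Longrightarrow> t \<in> {0..1} \<Longrightarrow> dist s t < d \<Longrightarrow> x \<in> X \<Longrightarrow> dist (h (s, x)) (h (t, x)) < e"
proof -
  have "uniformly_continuous_on ({0..1} \<times> X) h"
    using assms by (intro compact_uniformly_continuous compact_Times) auto
  then obtain d where "d > 0" "\<And>z z'. z \<in> {0..1} \<times> X \<Longrightarrow> z' \<in> {0..1} \<times> X \<Longrightarrow> dist z' z < d \<Longrightarrow> dist (h z') (h z) < e"
    unfolding uniformly_continuous_on_def using assms(3) by metis
  then show thesis by (intro that[of d]) (auto simp: dist_Pair_Pair)
qed

lemma continuous_on_slice:
  assumes "continuous_on (T \<times> X) h" "t \<in> T"
  shows "continuous_on X (\<lambda>x. h (t, x))"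
  by (rule continuous_on_compose2[OF assms(1)]) (use assms(2) in \<open>auto intro!: continuous_intros\<close>)

text \<open>The locale collects the regularity of a flow; the continuity equation and the initial
  condition are added as hypotheses of the single lemmas that use them.\<close>

locale flow =
  fixes X :: "'a::euclidean_space set" and \<pi> :: "real \<Rightarrow> 'a measure" and m :: "real \<Rightarrow> 'a set \<Rightarrow> 'a"
    and r :: real
  assumes X: "compact X"
    and path: "continuous_map (top_of_set {0..1}) (weak_topology X) \<pi>"
    and st: "spacetime_vector_measure X m"
    and ac: "\<And>t. t \<in> {0..1} \<Longrightarrow> vector_abs_continuous (\<pi> t) (m t)"
    and r: "r > 1"
    and fin: "(\<integral>\<^sup>+t. (\<integral>\<^sup>+x. ennreal (norm (vector_RN_deriv (\<pi> t) (m t) x) powr r) \<partial>\<pi> t)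
               \<partial>lebesgue_on {0..1}) < \<infinity>"
begin

abbreviation v :: "real \<Rightarrow> 'a \<Rightarrow> 'a" where "v t \<equiv> vector_RN_deriv (\<pi> t) (m t)"

lemma pi: "t \<in> {0..1} \<Longrightarrow> \<pi> t \<in> prob_measures X"
  using weak_path_prob_measures[OF path] .

lemma
  assumes t: "t \<in> {0..1}"
  shows v_integrable: "integrable (\<pi> t) (v t)"
    and v_eq: "A \<in> sets (borel_on X) \<Longrightarrow> m t A = (\<integral>x\<in>A. v t x \<partial>\<pi> t)"
proof -
  interpret prob_space "\<pi> t" using prob_measuresD[OF pi[OF t]] by simp
  have s: "sets (\<pi> t) = sets (borel_on X)" using prob_measuresD[OF pi[OF t]] by simp
  have m: "vector_measure (\<pi> t) (m t)"
    using st t unfolding spacetime_vector_measure_def vector_measure_def s by blast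
  show "integrable (\<pi> t) (v t)"
    by (rule vector_RN_deriv_integrable[OF _ m ac[OF t]]) (rule finite_measure_axioms)
  show "A \<in> sets (borel_on X) \<Longrightarrow> m t A = (\<integral>x\<in>A. v t x \<partial>\<pi> t)"
    using vector_RN_deriv_eq[OF finite_measure_axioms m ac[OF t]] s by simp
qed

text \<open>Integrand and measure both move with time. Uniform continuity of \<open>h\<close>
  controls the first change by \<open>e / 2\<close>, weak continuity of \<open>\<pi>\<close> with
  \<open>h\<close> frozen at \<open>t\<close> controls the second.\<close>

lemma integral_path_continuous:
  fixes h :: "real \<times> 'a \<Rightarrow> real"
  assumes h: "continuous_on ({0..1} \<times> X) h"
  shows "continuous_on {0..1} (\<lambda>t. \<integral>x. h (t, x) \<partial>\<pi> t)"
  unfolding continuous_on_iff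
proof (intro ballI allI impI)
  fix t e :: real assume t: "t \<in> {0..1}" and e: "e > 0"
  obtain d where d: "d > 0"
    "\<And>s t x. s \<in> {0..1} \<Longrightarrow> t \<in> {0..1} \<Longrightarrow> dist s t < d \<Longrightarrow> x \<in> X \<Longrightarrow> dist (h (s, x)) (h (t, x)) < e / 2"
    using uniformly_continuous_slice[OF X h, of "e / 2"] e by auto
  have ht: "continuous_on X (\<lambda>x. h (t, x))" using continuous_on_slice[OF h t] .
  then have "continuous_on {0..1} (\<lambda>s. \<integral>x. h (t, x) \<partial>\<pi> s)"
    using path compact_imp_bounded[OF compact_continuous_image[OF ht X]]
    unfolding weak_path_continuous_iff by blast
  then obtain d' where d': "d' > 0"
    "\<And>s. s \<in> {0..1} \<Longrightarrow> dist s t < d' \<Longrightarrow> dist (\<integral>x. h (t, x) \<partial>\<pi> s) (\<integral>x. h (t, x) \<partial>\<pi> t) < e / 2"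
    unfolding continuous_on_iff using t e by (metis half_gt_zero)
  show "\<exists>d>0. \<forall>s\<in>{0..1}. dist s t < d \<longrightarrow> dist (\<integral>x. h (s, x) \<partial>\<pi> s) (\<integral>x. h (t, x) \<partial>\<pi> t) < e"
  proof (intro exI[of _ "min d d'"] conjI ballI impI)
    fix s :: real assume s: "s \<in> {0..1}" "dist s t < min d d'"
    interpret prob_space "\<pi> s" using prob_measuresD[OF pi[OF s(1)]] by simp
    have i: "integrable (\<pi> s) (\<lambda>x. h (s, x))" "integrable (\<pi> s) (\<lambda>x. h (t, x))"
      using continuous_on_slice[OF h] s t by (auto intro!: prob_measures_integrable[OF pi X])
    have "\<bar>(\<integral>x. h (s, x) \<partial>\<pi> s) - (\<integral>x. h (t, x) \<partial>\<pi> s)\<bar> = \<bar>\<integral>x. h (s, x) - h (t, x) \<partial>\<pi> s\<bar>"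
      using i by simp
    also have "\<dots> \<le> (\<integral>x. \<bar>h (s, x) - h (t, x)\<bar> \<partial>\<pi> s)"
      by (rule integral_abs_bound)
    also have "\<dots> \<le> e / 2"
      using i d(2)[OF s(1) t] s(2) prob_measuresD(3)[OF pi[OF s(1)]]
      by (intro integral_le_const integrable_abs AE_I2) (auto simp: dist_real_def intro: less_imp_le)
    finally show "dist (\<integral>x. h (s, x) \<partial>\<pi> s) (\<integral>x. h (t, x) \<partial>\<pi> t) < e"
      using d'(2)[OF s(1)] s(2) unfolding dist_real_def by linarith
  qed (use d d' in auto)
qed

lemma vector_integral_measurable:
  assumes G: "continuous_on ({0..1} \<times> X) G"
  shows "(\<lambda>t. vector_integral (\<pi> t) (m t) (\<lambda>x. G (t, x))) \<in> borel_measurable (lebesgue_on {0..1})"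
proof -
  let ?N = "borel_on ({0..1} \<times> X)"
  have sp: "space ?N = {0..1} \<times> X" by (simp add: space_restrict_space)
  have Gm: "G \<in> borel_measurable ?N" using borel_measurable_continuous_on_restrict[OF G] .
  obtain F where F0: "\<forall>i. simple_function ?N (F i)" "\<forall>z\<in>{0..1} \<times> X. (\<lambda>i. F i z) \<longlonglongrightarrow> G z"
    "\<forall>i. \<forall>z\<in>{0..1} \<times> X. dist (F i z) 0 \<le> 2 * dist (G z) 0"
    using borel_measurable_implies_sequence_metric[OF Gm, of 0] unfolding sp by blast
  then have F: "\<And>i. simple_function ?N (F i)"
    "\<And>z. z \<in> {0..1} \<times> X \<Longrightarrow> (\<lambda>i. F i z) \<longlonglongrightarrow> G z"
    "\<And>i z. z \<in> {0..1} \<times> X \<Longrightarrow> norm (F i z) \<le> 2 * norm (G z)"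
    unfolding norm_conv_dist by blast+
  define I where "I i = F i ` ({0..1} \<times> X)" for i
  define A where "A i y = F i -` {y} \<inter> ({0..1} \<times> X)" for i y
  have I: "finite (I i)" for i using simple_functionD(1)[OF F(1)] by (simp add: I_def sp)
  have A: "A i y \<in> sets ?N" for i y using simple_functionD(2)[OF F(1), of i "{y}"] by (simp add: A_def sp)
  define S where "S i t = (\<Sum>y\<in>I i. y \<bullet> m t (Pair t -` A i y))" for i t
  have Sm: "S i \<in> borel_measurable (lebesgue_on {0..1})" for i
  proof -
    have "integrable (lebesgue_on {0..1}) (\<lambda>t. m t (Pair t -` A i y))" for y
      using st A unfolding spacetime_vector_measure_def by blast
    then have "integrable (lebesgue_on {0..1}) (S i)"
      unfolding S_def by (intro Bochner_Integration.integrable_sum integrable_inner_right)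
    then show ?thesis by simp
  qed
  have "(\<lambda>i. S i t) \<longlonglongrightarrow> vector_integral (\<pi> t) (m t) (\<lambda>x. G (t, x))" if t: "t \<in> {0..1}" for t
  proof -
    have sl: "Pair t -` A i y \<in> sets (borel_on X)" for i y
    proof -
      have "(\<lambda>x. (t, x)) \<in> measurable (borel_on X) ?N"
        using t by (intro measurable_restrict_space3) auto
      from measurable_sets[OF this A[of i y]] show ?thesis
        using t by (simp add: space_restrict_space A_def Int_absorb2 subset_iff)
    qed
    have sp\<pi>: "space (\<pi> t) = X" "sets (\<pi> t) = sets (borel_on X)" using prob_measuresD[OF pi[OF t]] by auto
    have "S i t = (\<integral>x. (\<Sum>y\<in>I i. indicator (Pair t -` A i y) x *\<^sub>R y) \<bullet> v t x \<partial>\<pi> t)" for i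
      unfolding S_def using sl sp\<pi> v_eq[OF t] I
      by (subst integral_inner_step) (auto intro!: v_integrable[OF t])
    also have "\<dots> i = (\<integral>x. F i (t, x) \<bullet> v t x \<partial>\<pi> t)" for i
    proof (intro Bochner_Integration.integral_cong refl arg_cong2[where f="(\<bullet>)"])
      fix x assume "x \<in> space (\<pi> t)"
      then have x: "(t, x) \<in> {0..1} \<times> X" using t sp\<pi> by simp
      show "(\<Sum>y\<in>I i. indicator (Pair t -` A i y) x *\<^sub>R y) = F i (t, x)"
        using simple_function_indicator_representation_banach[OF F(1)[of i], of "(t, x)"] x
        unfolding sp by (simp add: I_def A_def indicator_def)
    qed
    finally have S: "S i t = (\<integral>x. F i (t, x) \<bullet> v t x \<partial>\<pi> t)" for i .
    have slm: "(\<lambda>x. F i (t, x)) \<in> borel_measurable (\<pi> t)" for i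
    proof -
      have "F i \<in> borel_measurable ?N" using F(1) by (rule borel_measurable_simple_function)
      then have "(\<lambda>x. F i (t, x)) \<in> borel_measurable (borel_on X)"
        using t by (intro measurable_compose[OF measurable_restrict_space3[of "\<lambda>x. (t, x)" borel borel X "{0..1} \<times> X"]]) auto
      then show ?thesis using sp\<pi>(2) by (simp cong: measurable_cong_sets)
    qed
    obtain C where C: "\<And>x. x \<in> X \<Longrightarrow> norm (G (t, x)) \<le> C"
      using compact_imp_bounded[OF compact_continuous_image[OF continuous_on_slice[OF G t] X]]
      by (auto simp: bounded_iff)
    show ?thesis
      unfolding vector_integral_def S
    proof (rule integral_dominated_convergence[where w="\<lambda>x. 2 * C * norm (v t x)"])
      show "(\<lambda>x. G (t, x) \<bullet> v t x) \<in> borel_measurable (\<pi> t)"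
        using prob_measures_measurable[OF pi[OF t] continuous_on_slice[OF G t]] v_integrable[OF t] by auto
      show "(\<lambda>x. F i (t, x) \<bullet> v t x) \<in> borel_measurable (\<pi> t)" for i
        using slm v_integrable[OF t] by auto
      show "integrable (\<pi> t) (\<lambda>x. 2 * C * norm (v t x))"
        using v_integrable[OF t] by auto
      show "AE x in \<pi> t. (\<lambda>i. F i (t, x) \<bullet> v t x) \<longlonglongrightarrow> G (t, x) \<bullet> v t x"
        using t sp\<pi> by (intro AE_I2 tendsto_intros F) auto
      show "AE x in \<pi> t. norm (F i (t, x) \<bullet> v t x) \<le> 2 * C * norm (v t x)" for i
      proof (rule AE_I2)
        fix x assume "x \<in> space (\<pi> t)"
        then have x: "x \<in> X" using sp\<pi> by simp
        have "norm (F i (t, x) \<bullet> v t x) \<le> norm (F i (t, x)) * norm (v t x)"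
          using Cauchy_Schwarz_ineq2 by simp
        also have "\<dots> \<le> 2 * C * norm (v t x)"
          using F(3)[of "(t, x)" i] C[OF x] x t by (intro mult_right_mono) auto
        finally show "norm (F i (t, x) \<bullet> v t x) \<le> 2 * C * norm (v t x)" .
      qed
    qed
  qed
  then show ?thesis
    by (intro borel_measurable_LIMSEQ_metric[where f=S, OF Sm]) (auto simp: space_restrict_space)
qed

text \<open>
  The inner integral in \<open>fin\<close> is not known to be measurable in \<open>t\<close>; for a function that is not
  measurable the nonnegative integral is a lower integral, of which only monotonicity is used.
\<close>

lemma vector_integral_integrable:
  assumes G: "continuous_on ({0..1} \<times> X) G"
  shows "integrable (lebesgue_on {0..1}) (\<lambda>t. vector_integral (\<pi> t) (m t) (\<lambda>x. G (t, x)))"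
proof -
  interpret T: finite_measure "lebesgue_on {0..1::real}" by (intro finite_measure_lebesgue_on) auto
  let ?f = "\<lambda>t. vector_integral (\<pi> t) (m t) (\<lambda>x. G (t, x))"
  note fm[measurable] = vector_integral_measurable[OF G]
  obtain C0 where C0: "\<And>z. z \<in> {0..1} \<times> X \<Longrightarrow> norm (G z) \<le> C0"
    using compact_imp_bounded[OF compact_continuous_image[OF G]] X by (auto simp: bounded_iff compact_Times)
  define C where "C = \<bar>C0\<bar> + 1"
  have C: "C > 0" "\<And>t x. t \<in> {0..1} \<Longrightarrow> x \<in> X \<Longrightarrow> norm (G (t, x)) \<le> C"
    using C0 by (force simp: C_def)+
  let ?N = "\<lambda>t. \<integral>\<^sup>+x. ennreal (norm (v t x) powr r) \<partial>\<pi> t"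
  \<comment> \<open>\<open>q\<close> is a measurable function below the inner integral
    \<open>?N\<close>: it rearranges the bound of \<open>?f t\<close> by \<open>C\<close> times one
    plus the moment of order \<open>r\<close>. Its integral inherits finiteness from
    \<open>fin\<close>. The summand 1 in \<open>C\<close> permits the division.\<close>
  define q where "q t = max 0 (\<bar>?f t\<bar> / C - 1)" for t
  have qN: "ennreal (q t) \<le> ?N t" if t: "t \<in> {0..1}" for t
  proof (cases "?N t = \<infinity>")
    case False
    interpret prob_space "\<pi> t" using prob_measuresD[OF pi[OF t]] by simp
    have vm: "(\<lambda>x. norm (v t x) powr r) \<in> borel_measurable (\<pi> t)"
      using v_integrable[OF t] by measurable
    have i: "integrable (\<pi> t) (\<lambda>x. norm (v t x) powr r)"
      using False vm by (intro integrableI_nonneg) (auto simp: less_top)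
    have "\<bar>?f t\<bar> \<le> (\<integral>x. \<bar>G (t, x) \<bullet> v t x\<bar> \<partial>\<pi> t)"
      unfolding vector_integral_def by (rule integral_abs_bound)
    also have "\<dots> \<le> (\<integral>x. C * (1 + norm (v t x) powr r) \<partial>\<pi> t)"
    proof (rule integral_mono')
      show "integrable (\<pi> t) (\<lambda>x. C * (1 + norm (v t x) powr r))" using i by simp
      fix x assume "x \<in> space (\<pi> t)"
      then have x: "x \<in> X" using prob_measuresD[OF pi[OF t]] by simp
      \<comment> \<open>Up to norm 1 the constant dominates, beyond it the power does, since
        \<open>r > 1\<close>.\<close>
      have "norm (v t x) \<le> 1 + norm (v t x) powr r"
        using r powr_mono[of 1 r "norm (v t x)"] powr_ge_zero[of "norm (v t x)" r]
        by (cases "norm (v t x) \<le> 1") (simp_all del: powr_ge_zero)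
      moreover have "\<bar>G (t, x) \<bullet> v t x\<bar> \<le> C * norm (v t x)"
        using Cauchy_Schwarz_ineq2[of "G (t, x)" "v t x"] C(2)[OF t x]
        by (meson mult_right_mono norm_ge_zero order_trans)
      ultimately show "\<bar>G (t, x) \<bullet> v t x\<bar> \<le> C * (1 + norm (v t x) powr r)"
        using C(1) by (meson less_imp_le mult_left_mono order_trans)
      show "0 \<le> C * (1 + norm (v t x) powr r)" using C(1) by (simp add: add_nonneg_nonneg)
    qed
    also have "\<dots> = C * (1 + (\<integral>x. norm (v t x) powr r \<partial>\<pi> t))"
      using i by (simp add: prob_space)
    finally have "q t \<le> (\<integral>x. norm (v t x) powr r \<partial>\<pi> t)"
      using C(1) by (auto simp: q_def field_simps integral_nonneg)
    also have "ennreal (\<integral>x. norm (v t x) powr r \<partial>\<pi> t) = ?N t"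
      using i by (intro nn_integral_eq_integral[symmetric]) auto
    finally show ?thesis by (simp add: ennreal_leI)
  qed simp
  have "(\<integral>\<^sup>+t. ennreal (q t) \<partial>lebesgue_on {0..1}) \<le> (\<integral>\<^sup>+t. ?N t \<partial>lebesgue_on {0..1})"
    using qN by (intro nn_integral_mono) (auto simp: space_restrict_space)
  then have q: "integrable (lebesgue_on {0..1}) q"
    using fin unfolding q_def by (intro integrableI_nonneg) auto
  show ?thesis
  proof (rule Bochner_Integration.integrable_bound)
    show "integrable (lebesgue_on {0..1}) (\<lambda>t. C * (q t + 1))" using q by simp
    show "AE t in lebesgue_on {0..1}. norm (?f t) \<le> norm (C * (q t + 1))"
      using C(1) by (intro AE_I2) (auto simp: q_def field_simps max_def)
  qed measurable
qed

text \<open>Weak duality: the continuity equation writes the difference of the boundary integrals as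
  the time integral of \<open>\<eta>t + G \<bullet> v\<close>, and \<open>sub\<close> at
  \<open>u = v t x\<close> compares this with \<open>L\<close> pointwise. The cost is touched only
  through \<open>ereal_integral_mono\<close>.\<close>

lemma dynamic_cost_ge_test:
  assumes ce: "continuity_equation X \<pi> m" and L: "convex_on UNIV L"
    and \<eta>: "C1_test X \<eta> \<eta>t G"
    and sub: "\<And>z u. z \<in> {0..1} \<times> X \<Longrightarrow> \<eta>t z + G z \<bullet> u \<le> L u"
  shows "ereal ((\<integral>x. \<eta> (1, x) \<partial>\<pi> 1) - (\<integral>x. \<eta> (0, x) \<partial>\<pi> 0)) \<le> dynamic_cost L (\<pi>, m)"
proof -
  have \<eta>t: "continuous_on ({0..1} \<times> X) \<eta>t" and G: "continuous_on ({0..1} \<times> X) G"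
    using \<eta> by (auto simp: C1_test_def)
  let ?a = "\<lambda>t. \<integral>x. \<eta>t (t, x) \<partial>\<pi> t" and ?b = "\<lambda>t. vector_integral (\<pi> t) (m t) (\<lambda>x. G (t, x))"
  have i: "integrable (lebesgue_on {0..1}) ?a" "integrable (lebesgue_on {0..1}) ?b"
    using continuous_imp_integrable_real[OF integral_path_continuous[OF \<eta>t]] vector_integral_integrable[OF G] by auto
  have "(\<integral>x. \<eta> (1, x) \<partial>\<pi> 1) - (\<integral>x. \<eta> (0, x) \<partial>\<pi> 0) = (\<integral>t. ?a t + ?b t \<partial>lebesgue_on {0..1})"
    using ce \<eta> i unfolding continuity_equation_def by simp
  also have "ereal \<dots> = ereal_integral (lebesgue_on {0..1}) (\<lambda>t. ereal (?a t + ?b t))"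
    using i by (intro ereal_integral_eq_integral[symmetric]) auto
  also have "\<dots> \<le> ereal_integral (lebesgue_on {0..1}) (\<lambda>t. ereal_integral (\<pi> t) (\<lambda>x. ereal (L (v t x))))"
  proof (rule ereal_integral_mono)
    fix t assume "t \<in> space (lebesgue_on {0..1::real})"
    then have t: "t \<in> {0..1}" by (simp add: space_restrict_space)
    have i1: "integrable (\<pi> t) (\<lambda>x. \<eta>t (t, x))"
      by (intro prob_measures_integrable[OF pi[OF t] X] continuous_on_slice[OF \<eta>t] t)
    have Gm: "(\<lambda>x. G (t, x)) \<in> borel_measurable (\<pi> t)"
      by (intro prob_measures_measurable[OF pi[OF t]] continuous_on_slice[OF G] t)
    obtain C where C: "\<And>x. x \<in> X \<Longrightarrow> norm (G (t, x)) \<le> C"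
      using compact_imp_bounded[OF compact_continuous_image[OF continuous_on_slice[OF G t] X]]
      by (auto simp: bounded_iff)
    have i2: "integrable (\<pi> t) (\<lambda>x. G (t, x) \<bullet> v t x)"
    proof (rule Bochner_Integration.integrable_bound)
      show "integrable (\<pi> t) (\<lambda>x. C * norm (v t x))" using v_integrable[OF t] by simp
      show "(\<lambda>x. G (t, x) \<bullet> v t x) \<in> borel_measurable (\<pi> t)" using Gm v_integrable[OF t] by auto
      show "AE x in \<pi> t. norm (G (t, x) \<bullet> v t x) \<le> norm (C * norm (v t x))"
      proof (rule AE_I2)
        fix x assume "x \<in> space (\<pi> t)"
        then have "norm (G (t, x)) \<le> C" using C prob_measuresD[OF pi[OF t]] by simp
        then have "norm (G (t, x)) * norm (v t x) \<le> C * norm (v t x)" by (intro mult_right_mono) auto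
        then show "norm (G (t, x) \<bullet> v t x) \<le> norm (C * norm (v t x))"
          using Cauchy_Schwarz_ineq2[of "G (t, x)" "v t x"] by simp
      qed
    qed
    have "ereal (?a t + ?b t) = ereal (\<integral>x. \<eta>t (t, x) + G (t, x) \<bullet> v t x \<partial>\<pi> t)"
      using i1 i2 by (simp add: vector_integral_def)
    also have "\<dots> = ereal_integral (\<pi> t) (\<lambda>x. ereal (\<eta>t (t, x) + G (t, x) \<bullet> v t x))"
      using i1 i2 by (intro ereal_integral_eq_integral[symmetric]) auto
    also have "\<dots> \<le> ereal_integral (\<pi> t) (\<lambda>x. ereal (L (v t x)))"
      using sub t prob_measuresD[OF pi[OF t]] by (intro ereal_integral_mono) auto
    finally show "ereal (?a t + ?b t) \<le> ereal_integral (\<pi> t) (\<lambda>x. ereal (L (v t x)))" .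
  qed
  finally show ?thesis by (simp add: dynamic_cost_def)
qed

end

text \<open>The witness is the soft maximum \<open>ln (\<Sum>i. exp (\<beta> * l i)) / \<beta>\<close> of the affine functions \<open>l i\<close>: its
  gradient is a convex combination of theirs, and it exceeds their maximum by at most \<open>ln (card I) / \<beta>\<close>.\<close>

lemma softmax_test:
  fixes a b :: "'i \<Rightarrow> real" and g :: "'i \<Rightarrow> 'a::euclidean_space"
  assumes I: "finite I" "I \<noteq> {}" and e: "e > 0"
  obtains \<eta> \<eta>t G where "C1_test X \<eta> \<eta>t G"
    "\<And>z u c. (\<And>i. i \<in> I \<Longrightarrow> a i + g i \<bullet> u \<le> c) \<Longrightarrow> \<eta>t z + G z \<bullet> u \<le> c"
    "\<And>i t x. i \<in> I \<Longrightarrow> a i * t + g i \<bullet> x + b i \<le> \<eta> (t, x)"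
    "\<And>t x c. (\<And>i. i \<in> I \<Longrightarrow> a i * t + g i \<bullet> x + b i \<le> c) \<Longrightarrow> \<eta> (t, x) \<le> c + e"
proof -
  \<comment> \<open>Chosen so that \<open>ln (card I) \<le> \<beta> * e\<close>; the added 1 keeps
    \<open>\<beta>\<close> positive when \<open>I\<close> has a single element.\<close>
  define \<beta> where "\<beta> = (ln (real (card I)) + 1) / e"
  have card: "real (card I) \<ge> 1" using I by (simp add: Suc_leI card_gt_0_iff)
  then have \<beta>: "\<beta> > 0" using e by (simp add: \<beta>_def add_nonneg_pos)
  have \<beta>e: "ln (real (card I)) \<le> \<beta> * e" using e by (simp add: \<beta>_def)
  define l where "l i z = a i * fst z + g i \<bullet> snd z + b i" for i and z :: "real \<times> 'a"
  define S where "S z = (\<Sum>i\<in>I. exp (\<beta> * l i z))" for z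
  define w where "w i z = exp (\<beta> * l i z) / S z" for i z
  have S: "S z > 0" for z unfolding S_def using I by (intro sum_pos) auto
  have w0: "w i z \<ge> 0" for i z unfolding w_def using S[of z] by simp
  have w1: "(\<Sum>i\<in>I. w i z) = 1" for z
    unfolding w_def using S[of z] by (simp add: S_def flip: sum_divide_distrib)
  define \<eta> where "\<eta> z = ln (S z) / \<beta>" for z
  define \<eta>t where "\<eta>t z = (\<Sum>i\<in>I. w i z * a i)" for z
  define G where "G z = (\<Sum>i\<in>I. w i z *\<^sub>R g i)" for z
  have lc: "continuous_on A (l i)" for i A unfolding l_def by (intro continuous_intros)
  have Sc: "continuous_on A S" for A unfolding S_def by (intro continuous_intros lc)
  have wc: "continuous_on A (w i)" for A i
    unfolding w_def by (intro continuous_intros lc Sc) (use S in \<open>simp add: less_imp_neq[symmetric]\<close>)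
  have der: "(\<eta> has_derivative (\<lambda>(s, h). s * \<eta>t z + G z \<bullet> h)) (at z within A)" for z A
  proof -
    have l': "(l i has_derivative (\<lambda>y. a i * fst y + g i \<bullet> snd y)) (at z within A)" for i
      unfolding l_def by (auto intro!: derivative_eq_intros)
    have "(S has_derivative (\<lambda>y. \<Sum>i\<in>I. exp (\<beta> * l i z) * (\<beta> * (a i * fst y + g i \<bullet> snd y)))) (at z within A)"
      unfolding S_def by (rule derivative_eq_intros l' refl | simp add: mult.commute)+
    then have "((\<lambda>z. ln (S z)) has_derivative
       (\<lambda>y. (\<Sum>i\<in>I. exp (\<beta> * l i z) * (\<beta> * (a i * fst y + g i \<bullet> snd y))) * inverse (S z))) (at z within A)"
      by (intro has_derivative_ln S)
    from has_derivative_mult_right[OF this, of "1 / \<beta>"]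
    have *: "(\<eta> has_derivative (\<lambda>y. 1 / \<beta> *
        ((\<Sum>i\<in>I. exp (\<beta> * l i z) * (\<beta> * (a i * fst y + g i \<bullet> snd y))) * inverse (S z)))) (at z within A)"
      by (simp add: \<eta>_def[abs_def])
    have "1 / \<beta> * ((\<Sum>i\<in>I. exp (\<beta> * l i z) * (\<beta> * (a i * fst y + g i \<bullet> snd y))) * inverse (S z))
        = fst y * \<eta>t z + G z \<bullet> snd y" for y
    proof -
      have "1 / \<beta> * ((\<Sum>i\<in>I. exp (\<beta> * l i z) * (\<beta> * (a i * fst y + g i \<bullet> snd y))) * inverse (S z))
          = (\<Sum>i\<in>I. w i z * (a i * fst y + g i \<bullet> snd y))"
        unfolding w_def sum_distrib_right sum_distrib_left
      proof (intro sum.cong refl)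
        have "1 / \<beta> * (E * (\<beta> * q) * inverse s) = E / s * q" for E q s :: real
          using \<beta> by (simp add: field_simps)
        then show "1 / \<beta> * (exp (\<beta> * l i z) * (\<beta> * (a i * fst y + g i \<bullet> snd y)) * inverse (S z)) =
          exp (\<beta> * l i z) / S z * (a i * fst y + g i \<bullet> snd y)" for i .
      qed
      also have "\<dots> = fst y * \<eta>t z + G z \<bullet> snd y"
        by (simp add: \<eta>t_def G_def sum_distrib_left inner_sum_left sum.distrib algebra_simps)
      finally show ?thesis .
    qed
    with * show ?thesis by (simp add: case_prod_beta')
  qed
  show thesis
  proof
    show "C1_test X \<eta> \<eta>t G"
      unfolding C1_test_def \<eta>t_def[abs_def] G_def[abs_def]
      using der unfolding \<eta>t_def G_def by (auto intro!: continuous_intros wc)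
  next
    fix z u c assume *: "\<And>i. i \<in> I \<Longrightarrow> a i + g i \<bullet> u \<le> c"
    have "\<eta>t z + G z \<bullet> u = (\<Sum>i\<in>I. w i z * (a i + g i \<bullet> u))"
      by (simp add: \<eta>t_def G_def inner_sum_left sum.distrib algebra_simps)
    also have "\<dots> \<le> (\<Sum>i\<in>I. w i z * c)"
      using * w0 by (intro sum_mono mult_left_mono) auto
    also have "\<dots> = c" using w1[of z] by (simp flip: sum_distrib_right)
    finally show "\<eta>t z + G z \<bullet> u \<le> c" .
  next
    fix i t x assume i: "i \<in> I"
    have "exp (\<beta> * l i (t, x)) \<le> S (t, x)"
      unfolding S_def using I i by (intro member_le_sum) auto
    then have "\<beta> * l i (t, x) \<le> ln (S (t, x))" using S[of "(t, x)"] by (simp add: ln_ge_iff)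
    then show "a i * t + g i \<bullet> x + b i \<le> \<eta> (t, x)"
      using \<beta> by (simp add: \<eta>_def l_def field_simps)
  next
    fix t x c assume *: "\<And>i. i \<in> I \<Longrightarrow> a i * t + g i \<bullet> x + b i \<le> c"
    \<comment> \<open>All exponents are at most \<open>\<beta> * c\<close>, so the sum costs a
      factor \<open>card I\<close>, which the logarithm and the division by \<open>\<beta>\<close>
      turn into the error \<open>e\<close>.\<close>
    have "S (t, x) \<le> (\<Sum>i\<in>I. exp (\<beta> * c))"
      unfolding S_def l_def using * \<beta> by (intro sum_mono) simp
    then have "ln (S (t, x)) \<le> ln (real (card I) * exp (\<beta> * c))" using S[of "(t, x)"] by (subst ln_le_cancel_iff) (auto intro: less_le_trans)
    also have "\<dots> = ln (real (card I)) + \<beta> * c" using card by (simp add: ln_mult)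
    also have "\<dots> \<le> \<beta> * (c + e)" using \<beta>e by (simp add: algebra_simps)
    finally show "\<eta> (t, x) \<le> c + e" using \<beta> by (simp add: \<eta>_def field_simps)
  qed
qed

context invariant_cost
begin

text \<open>
  The tangents of \<open>L\<close> at \<open>i - bary\<close>, \<open>i \<in> X\<close>, yield the affine solutions
  \<open>(L (i - bary) - g \<bullet> (i - bary)) t + g \<bullet> (x - bary)\<close> of \<open>\<partial>\<^sub>t \<eta> + \<langle>\<nabla>\<eta>, u\<rangle> \<le> L u\<close>. They vanish
  at \<open>t = 0\<close> almost everywhere, and finitely many of them recover \<open>L\<close> on \<open>X\<close> at \<open>t = 1\<close> up to \<open>e\<close>.
\<close>

lemma static_cost_le_dynamic_cost:
  assumes flow: "flow X \<pi> m r" and ce: "continuity_equation X \<pi> m" and \<pi>0: "\<pi> 0 = p"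
  shows "ereal (static_cost L (\<pi> 1)) \<le> dynamic_cost L (\<pi>, m)"
proof (rule ereal_le_epsilon2)
  fix e :: real assume e: "0 < e"
  note cX = X(1)
  interpret flow X \<pi> m r by fact
  obtain g where g: "\<And>x y. L x + g x \<bullet> (y - x) \<le> L y" using convex_on_subgradient[OF L] by metis
  \<comment> \<open>\<open>U i\<close> consists of the points where the tangent at
    \<open>i - bary\<close>, read at \<open>x - bary\<close>, falls short of \<open>L x\<close> by
    less than \<open>e / 2\<close>. The other \<open>e / 2\<close> is spent on the soft
    maximum.\<close>
  define U where "U i = {x. L x - e / 2 < L i + g (i - bary) \<bullet> (x - i)}" for i
  have "open (U i)" for i
    unfolding U_def by (intro open_Collect_less continuous_intros L_cont)
  moreover have "X \<subseteq> (\<Union>i\<in>X. U i)" using e by (auto simp: U_def)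
  ultimately obtain I where I: "I \<subseteq> X" "finite I" "X \<subseteq> (\<Union>i\<in>I. U i)"
    using compactE_image[OF cX, of X U] by metis
  have "I \<noteq> {}" using I(3) bary_in by auto
  then obtain \<eta> \<eta>t G where \<eta>: "C1_test X \<eta> \<eta>t G"
    and sub: "\<And>z u c. (\<And>i. i \<in> I \<Longrightarrow> (L (i - bary) - g (i - bary) \<bullet> (i - bary)) + g (i - bary) \<bullet> u \<le> c) \<Longrightarrow> \<eta>t z + G z \<bullet> u \<le> c"
    and lo: "\<And>i t x. i \<in> I \<Longrightarrow> (L (i - bary) - g (i - bary) \<bullet> (i - bary)) * t + g (i - bary) \<bullet> x + - (g (i - bary) \<bullet> bary) \<le> \<eta> (t, x)"
    and up: "\<And>t x c. (\<And>i. i \<in> I \<Longrightarrow> (L (i - bary) - g (i - bary) \<bullet> (i - bary)) * t + g (i - bary) \<bullet> x + - (g (i - bary) \<bullet> bary) \<le> c) \<Longrightarrow> \<eta> (t, x) \<le> c + e / 2"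
    using softmax_test[OF I(2), of "e / 2" X "\<lambda>i. L (i - bary) - g (i - bary) \<bullet> (i - bary)" "\<lambda>i. g (i - bary)"
        "\<lambda>i. - (g (i - bary) \<bullet> bary)"] e by (metis half_gt_zero)
  have "(\<eta> has_derivative (\<lambda>(s, h). s * \<eta>t z + G z \<bullet> h)) (at z within {0..1} \<times> X)"
    if "z \<in> {0..1} \<times> X" for z
    using \<eta> that unfolding C1_test_def by fast
  then have "continuous_on ({0..1} \<times> X) \<eta>" by (rule has_derivative_continuous_on)
  then have \<eta>i: "integrable (\<pi> t) (\<lambda>x. \<eta> (t, x))" if "t \<in> {0..1}" for t
    using that by (intro prob_measures_integrable[OF pi[OF that] cX] continuous_on_slice) auto
  interpret \<pi>1: prob_space "\<pi> 1" using prob_measuresD[OF pi] by simp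
  have L1: "integrable (\<pi> 1) L"
    by (intro prob_measures_integrable[OF pi cX] L_cont) auto
  have "(\<integral>x. L x - e / 2 \<partial>\<pi> 1) \<le> (\<integral>x. \<eta> (1, x) \<partial>\<pi> 1)"
  proof (rule integral_mono)
    fix x assume "x \<in> space (\<pi> 1)"
    then have "x \<in> X" using prob_measuresD[OF pi[of 1]] by simp
    then obtain i where i: "i \<in> I" "x \<in> U i" using I(3) by auto
    \<comment> \<open>At \<open>t = 1\<close> the affine function with index \<open>i\<close> equals
      \<open>L (i - bary) + g (i - bary) \<bullet> (x - i)\<close>, and \<open>L_bary\<close>
      replaces the first term by \<open>L i\<close>.\<close>
    then show "L x - e / 2 \<le> \<eta> (1, x)"
      using lo[OF i(1), of 1 x] L_bary[of i] I(1) by (auto simp: U_def inner_diff_right)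
  qed (use L1 \<eta>i in auto)
  moreover have "(\<integral>x. \<eta> (0, x) \<partial>\<pi> 0) \<le> e / 2"
  proof -
    \<comment> \<open>Finitely many indices share one null set. Off it all the affine functions are
      0 at \<open>t = 0\<close>, so the soft maximum is at most its excess
      \<open>e / 2\<close>.\<close>
    have "AE z in p. \<forall>i\<in>I. g (i - bary) \<bullet> (z - bary) = 0"
      using I(1,2) g by (intro AE_finite_allI subgradient_orthogonal) auto
    then have "AE z in p. \<eta> (0, z) \<le> e / 2"
    proof eventually_elim
      case (elim z)
      then show ?case using up[of 0 z 0] by (simp add: inner_diff_right)
    qed
    then show ?thesis using \<eta>i[of 0] unfolding \<pi>0 by (intro integral_le_const) auto
  qed
  moreover have "ereal ((\<integral>x. \<eta> (1, x) \<partial>\<pi> 1) - (\<integral>x. \<eta> (0, x) \<partial>\<pi> 0)) \<le> dynamic_cost L (\<pi>, m)"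
  proof (rule dynamic_cost_ge_test[OF ce L \<eta>])
    show "\<eta>t z + G z \<bullet> u \<le> L u" for z u
    proof (rule sub)
      show "(L (i - bary) - g (i - bary) \<bullet> (i - bary)) + g (i - bary) \<bullet> u \<le> L u" for i
        using g[of "i - bary" u] by (simp add: inner_diff_right)
    qed
  qed
  ultimately have "ereal (static_cost L (\<pi> 1) - e) \<le> dynamic_cost L (\<pi>, m)"
    using L1 by (intro order.trans[OF _ \<open>ereal (_ - _) \<le> _\<close>]) (simp add: static_cost_def \<pi>1.prob_space)
  then show "ereal (static_cost L (\<pi> 1)) \<le> dynamic_cost L (\<pi>, m) + ereal e"
    by (cases "dynamic_cost L (\<pi>, m)") auto
qed

end

section \<open>Jensen's inequality for conditional expectations\<close>

text \<open>This is the pushforward under \<open>f\<close> of the vector measure with density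
  \<open>V\<close>. Partial sums over disjoint sets collapse to one indicator and are thus dominated
  by \<open>norm (V x)\<close>.\<close>

lemma vector_measure_integral:
  fixes V :: "'a \<Rightarrow> 'b::euclidean_space"
  assumes V: "integrable M V" and f: "f \<in> measurable M N"
  shows "vector_measure N (\<lambda>A. \<integral>x. indicator A (f x) *\<^sub>R V x \<partial>M)"
  unfolding vector_measure_def
proof (intro conjI allI impI)
  show "(\<integral>x. indicator {} (f x) *\<^sub>R V x \<partial>M) = 0" by simp
  fix A :: "nat \<Rightarrow> _" assume A: "range A \<subseteq> sets N" "disjoint_family A"
  have m: "(\<lambda>x. indicator B (f x) *\<^sub>R V x) \<in> borel_measurable M" if "B \<in> sets N" for B
    using that V f by (intro borel_measurable_scaleR measurable_compose[OF f borel_measurable_indicator]) auto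
  have i: "integrable M (\<lambda>x. indicator B (f x) *\<^sub>R V x)" if "B \<in> sets N" for B
    by (rule Bochner_Integration.integrable_bound[OF V m[OF that]]) (simp add: indicator_def)
  have U: "(\<Union>i. A i) \<in> sets N" using A by auto
  have "(\<lambda>n. \<integral>x. (\<Sum>i<n. indicator (A i) (f x) *\<^sub>R V x) \<partial>M) \<longlonglongrightarrow> (\<integral>x. indicator (\<Union>i. A i) (f x) *\<^sub>R V x \<partial>M)"
  proof (rule integral_dominated_convergence[where w="\<lambda>x. norm (V x)"])
    have eq: "(\<Sum>i<n. indicator (A i) y *\<^sub>R u) = indicator (\<Union>i<n. A i) y *\<^sub>R u" for n y and u :: 'b
    proof -
      have "indicator (\<Union>i<n. A i) y = (\<Sum>i<n. indicator (A i) y :: real)"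
        by (rule indicator_UN_disjoint) (use A(2) in \<open>auto simp: disjoint_family_on_def\<close>)
      then show ?thesis by (simp add: scaleR_sum_left)
    qed
    show "(\<lambda>x. \<Sum>i<n. indicator (A i) (f x) *\<^sub>R V x) \<in> borel_measurable M" for n
      using A by (intro borel_measurable_sum m) auto
    show "AE x in M. (\<lambda>n. \<Sum>i<n. indicator (A i) (f x) *\<^sub>R V x) \<longlonglongrightarrow> indicator (\<Union>i. A i) (f x) *\<^sub>R V x"
      unfolding eq by (intro AE_I2 tendsto_scaleR LIMSEQ_indicator_UN tendsto_const)
    show "AE x in M. norm (\<Sum>i<n. indicator (A i) (f x) *\<^sub>R V x) \<le> norm (V x)" for n
      unfolding eq by (simp add: indicator_def)
  qed (use V m[OF U] in auto)
  moreover have "(\<integral>x. (\<Sum>i<n. indicator (A i) (f x) *\<^sub>R V x) \<partial>M) = (\<Sum>i<n. \<integral>x. indicator (A i) (f x) *\<^sub>R V x \<partial>M)" for n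
    using A by (intro Bochner_Integration.integral_sum i) auto
  ultimately show "(\<lambda>i. \<integral>x. indicator (A i) (f x) *\<^sub>R V x \<partial>M) sums (\<integral>x. indicator (\<Union>i. A i) (f x) *\<^sub>R V x \<partial>M)"
    by (simp add: sums_def)
qed

text \<open>\<open>v\<close> is the conditional expectation of \<open>V\<close> given \<open>Y\<close>, as a function on the target space of \<open>Y\<close>.\<close>

locale conditional_velocity = prob_space M for M :: "'w measure" +
  fixes N :: "'a measure" and Y :: "'w \<Rightarrow> 'a" and V :: "'w \<Rightarrow> 'b::euclidean_space" and v :: "'a \<Rightarrow> 'b"
    and R :: real
  assumes Y[measurable]: "Y \<in> measurable M N"
    and V[measurable]: "V \<in> borel_measurable M" and VR: "\<And>x. x \<in> space M \<Longrightarrow> norm (V x) \<le> R"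
    and v: "integrable (distr M N Y) v"
    and cond: "\<And>A. A \<in> sets N \<Longrightarrow> (\<integral>y\<in>A. v y \<partial>distr M N Y) = (\<integral>x. indicator A (Y x) *\<^sub>R V x \<partial>M)"
begin

abbreviation D :: "'a measure" where "D \<equiv> distr M N Y"

sublocale D: prob_space D by (rule prob_space_distr[OF Y])

lemma V_integrable: "integrable M V"
  using VR by (intro integrable_const_bound[of _ R]) auto

lemma v_measurable [measurable]: "v \<in> borel_measurable N"
  using borel_measurable_integrable[OF v] by simp

text \<open>Indicators are covered by \<open>cond\<close>; linearity does the rest.\<close>

lemma integral_inner_simple:
  assumes S: "simple_function N S"
  shows "(\<integral>y. S y \<bullet> v y \<partial>D) = (\<integral>x. S (Y x) \<bullet> V x \<partial>M)"
proof -
  let ?I = "S ` space N" and ?A = "\<lambda>y. S -` {y} \<inter> space N"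
  have I: "finite ?I" and A: "?A y \<in> sets N" for y using simple_functionD[OF S] by auto
  have rep: "S y = (\<Sum>c\<in>?I. indicator (?A c) y *\<^sub>R c)" if "y \<in> space N" for y
    using simple_function_indicator_representation_banach[OF S that] .
  have Ysp: "Y x \<in> space N" if "x \<in> space M" for x using measurable_space[OF Y that] .
  have "(\<integral>y. S y \<bullet> v y \<partial>D) = (\<integral>y. (\<Sum>c\<in>?I. indicator (?A c) y *\<^sub>R c) \<bullet> v y \<partial>D)"
    by (intro Bochner_Integration.integral_cong refl arg_cong2[where f="(\<bullet>)"] rep) simp
  also have "\<dots> = (\<Sum>c\<in>?I. c \<bullet> (\<integral>x. indicator (?A c) (Y x) *\<^sub>R V x \<partial>M))"
    unfolding cond[OF A, symmetric] by (rule integral_inner_step) (use I A v in simp_all)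
  also have "\<dots> = (\<Sum>c\<in>?I. c \<bullet> (\<integral>x\<in>Y -` ?A c \<inter> space M. V x \<partial>M))"
    unfolding set_lebesgue_integral_def
    by (intro sum.cong refl arg_cong2[where f="(\<bullet>)"] Bochner_Integration.integral_cong) (auto simp: indicator_def)
  also have "\<dots> = (\<integral>x. (\<Sum>c\<in>?I. indicator (Y -` ?A c \<inter> space M) x *\<^sub>R c) \<bullet> V x \<partial>M)"
    using I A V_integrable by (intro integral_inner_step[symmetric] measurable_sets[OF Y]) auto
  also have "\<dots> = (\<integral>x. S (Y x) \<bullet> V x \<partial>M)"
  proof (intro Bochner_Integration.integral_cong refl arg_cong2[where f="(\<bullet>)"])
    fix x assume x: "x \<in> space M"
    have "(\<Sum>c\<in>?I. indicator (Y -` ?A c \<inter> space M) x *\<^sub>R c) = (\<Sum>c\<in>?I. indicator (?A c) (Y x) *\<^sub>R c)"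
      using x by (intro sum.cong) (auto simp: indicator_def)
    then show "(\<Sum>c\<in>?I. indicator (Y -` ?A c \<inter> space M) x *\<^sub>R c) = S (Y x)"
      by (rule trans[OF _ rep[OF Ysp[OF x], symmetric]])
  qed
  finally show ?thesis .
qed

text \<open>Simple functions of norm at most twice that of \<open>H\<close> converge to
  \<open>H\<close>; boundedness of \<open>H\<close> and integrability of \<open>v\<close> and
  \<open>V\<close> give dominated convergence on both sides.\<close>

lemma integral_inner_bounded:
  assumes H[measurable]: "H \<in> borel_measurable N" and C: "\<And>y. y \<in> space N \<Longrightarrow> norm (H y) \<le> C"
  shows "(\<integral>y. H y \<bullet> v y \<partial>D) = (\<integral>x. H (Y x) \<bullet> V x \<partial>M)"
proof -
  obtain S where S0: "\<forall>i. simple_function N (S i)" "\<forall>y\<in>space N. (\<lambda>i. S i y) \<longlonglongrightarrow> H y"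
    "\<forall>i. \<forall>y\<in>space N. norm (S i y) \<le> 2 * norm (H y)"
    using borel_measurable_implies_sequence_metric[OF H, of 0] unfolding norm_conv_dist by blast
  have Sm[measurable]: "S i \<in> borel_measurable N" for i
    using S0(1) by (auto intro: borel_measurable_simple_function)
  have S: "norm (S i y \<bullet> u) \<le> 2 * C * norm u" if "y \<in> space N" for i y u
  proof -
    have "norm (S i y) \<le> 2 * norm (H y)" using S0(3) that by blast
    then have "norm (S i y) \<le> 2 * C" using C[OF that] by linarith
    then show ?thesis
      using Cauchy_Schwarz_ineq2[of "S i y" u] mult_right_mono[of "norm (S i y)" "2 * C" "norm u"] by simp
  qed
  have Ysp: "Y x \<in> space N" if "x \<in> space M" for x using measurable_space[OF Y that] .
  have "(\<lambda>i. \<integral>y. S i y \<bullet> v y \<partial>D) \<longlonglongrightarrow> (\<integral>y. H y \<bullet> v y \<partial>D)"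
    by (rule integral_dominated_convergence[where w="\<lambda>y. 2 * C * norm (v y)"])
       (use S S0(2) v in \<open>auto intro!: AE_I2 tendsto_intros\<close>)
  moreover have "(\<lambda>i. \<integral>x. S i (Y x) \<bullet> V x \<partial>M) \<longlonglongrightarrow> (\<integral>x. H (Y x) \<bullet> V x \<partial>M)"
    by (rule integral_dominated_convergence[where w="\<lambda>x. 2 * C * norm (V x)"])
       (use S S0(2) V_integrable Ysp in \<open>auto intro!: AE_I2 tendsto_intros\<close>)
  ultimately show ?thesis
    using integral_inner_simple S0(1) by (auto intro: LIMSEQ_unique)
qed

text \<open>On the set \<open>B\<close> where the bound fails, pairing with the direction of
  \<open>v\<close> yields the integral of \<open>norm (v y)\<close>, which on the side of
  \<open>V\<close> is at most \<open>R\<close> times the mass of \<open>B\<close>. So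
  \<open>norm (v y) - R\<close>, positive on \<open>B\<close>, has integral at most 0 there.\<close>

lemma v_bounded: "AE y in D. norm (v y) \<le> R"
proof -
  define B where "B = {y\<in>space N. R < norm (v y)}"
  define H where "H y = indicator B y *\<^sub>R sgn (v y)" for y
  have B[measurable]: "B \<in> sets N" unfolding B_def by measurable
  have "H \<in> borel_measurable N" unfolding H_def sgn_div_norm by measurable
  moreover have H: "norm (H y) \<le> indicator B y" for y by (simp add: H_def norm_sgn indicator_def)
  then have "norm (H y) \<le> 1" for y by (rule order.trans) (simp add: indicator_def)
  ultimately have eq: "(\<integral>y. H y \<bullet> v y \<partial>D) = (\<integral>x. H (Y x) \<bullet> V x \<partial>M)"
    by (intro integral_inner_bounded) auto
  have HV: "H y \<bullet> v y = indicator B y * norm (v y)" for y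
    by (cases "v y = 0") (simp_all add: H_def sgn_div_norm dot_square_norm power2_eq_square field_simps)
  have R0: "R \<ge> 0" using VR not_empty norm_ge_zero order_trans by blast
  have "(\<integral>x. H (Y x) \<bullet> V x \<partial>M) \<le> (\<integral>x. R * indicator B (Y x) \<partial>M)"
  proof (rule integral_mono')
    show "integrable M (\<lambda>x. R * indicator B (Y x))"
      by (intro integrable_mult_right integrable_const_bound[of _ 1]) auto
    fix x assume x: "x \<in> space M"
    have "H (Y x) \<bullet> V x \<le> norm (H (Y x)) * norm (V x)" by (rule norm_cauchy_schwarz)
    also have "\<dots> \<le> indicator B (Y x) * R" by (intro mult_mono H VR x) auto
    finally show "H (Y x) \<bullet> V x \<le> R * indicator B (Y x)" by (simp add: mult.commute)
    show "0 \<le> R * indicator B (Y x)" using R0 by simp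
  qed
  also have "\<dots> = (\<integral>y. R * indicator B y \<partial>D)" by (subst integral_distr) auto
  finally have "(\<integral>y. indicator B y * norm (v y) \<partial>D) \<le> (\<integral>y. R * indicator B y \<partial>D)"
    unfolding eq[symmetric] HV .
  moreover have i1: "integrable D (\<lambda>y. indicator B y * norm (v y))"
    using integrable_mult_indicator[of B D "\<lambda>y. norm (v y)"] v B by simp
  moreover have i2: "integrable D (\<lambda>y. R * indicator B y)"
    by (intro integrable_mult_right D.integrable_const_bound[of _ 1]) auto
  ultimately have le: "(\<integral>y. indicator B y * (norm (v y) - R) \<partial>D) \<le> 0"
    by (simp add: right_diff_distrib mult.commute)
  have i: "integrable D (\<lambda>y. indicator B y * (norm (v y) - R))"
    using Bochner_Integration.integrable_diff[OF i1 i2] by (simp add: right_diff_distrib mult.commute)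
  have nn: "AE y in D. 0 \<le> indicator B y * (norm (v y) - R)"
    by (intro AE_I2) (auto simp: B_def indicator_def)
  have "AE y in D. indicator B y * (norm (v y) - R) = 0"
    using integral_nonneg_eq_0_iff_AE[OF i nn] integral_nonneg_AE[OF nn] le by auto
  then show ?thesis
    using AE_space by eventually_elim (auto simp: B_def indicator_def split: if_splits)
qed

text \<open>
  Tangents of \<open>L\<close> at values of simple functions \<open>S i\<close> converging to \<open>v\<close> avoid a measurable
  selection of subgradients.
\<close>

lemma
  assumes L: "convex_on UNIV L"
  shows L_v_integrable: "integrable D (\<lambda>y. L (v y))"
    and integral_L_v_le: "(\<integral>y. L (v y) \<partial>D) \<le> (\<integral>x. L (V x) \<partial>M)"
proof -
  have Lm[measurable]: "L \<in> borel_measurable borel"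
    using convex_on_UNIV_continuous[OF L] by (rule borel_measurable_continuous_onI)
  \<comment> \<open>The approximants of \<open>v\<close> have norm at most twice that of
    \<open>v\<close>, so values and subgradients of \<open>L\<close> are controlled on the ball of
    radius \<open>2 * R\<close>.\<close>
  have "compact (L ` cball 0 (2 * R))"
    by (intro compact_continuous_image convex_on_UNIV_continuous[OF L] compact_cball)
  then obtain K where "\<forall>x\<in>cball 0 (2 * R). \<bar>L x\<bar> \<le> K"
    using compact_imp_bounded[of "L ` cball 0 (2 * R)"] by (auto simp: bounded_iff)
  then have K: "\<bar>L x\<bar> \<le> K" if "norm x \<le> 2 * R" for x using that by simp
  have R0: "R \<ge> 0" using VR not_empty norm_ge_zero order_trans by blast
  have LV: "integrable M (\<lambda>x. L (V x))"
  proof (rule integrable_const_bound[of _ K])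
    show "AE x in M. norm (L (V x)) \<le> K"
      using K R0 VR by (intro AE_I2) (metis mult_2 add_increasing2 order_trans real_norm_def)
  qed measurable
  show "integrable D (\<lambda>y. L (v y))"
  proof (rule D.integrable_const_bound[of _ K])
    show "AE y in D. norm (L (v y)) \<le> K"
      using v_bounded by eventually_elim (use K R0 in auto)
  qed measurable
  obtain g where g: "\<And>x y. L x + g x \<bullet> (y - x) \<le> L y" using convex_on_subgradient[OF L] by metis
  obtain C where "\<forall>x\<in>cball 0 (2 * R). norm (g x) \<le> C"
    using subgradient_bounded[OF L g, of "2 * R"] by blast
  then have C: "norm (g x) \<le> C" if "norm x \<le> 2 * R" for x using that by simp
  obtain S where S0: "\<forall>i. simple_function N (S i)" "\<forall>y\<in>space N. (\<lambda>i. S i y) \<longlonglongrightarrow> v y"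
    "\<forall>i. \<forall>y\<in>space N. norm (S i y) \<le> 2 * norm (v y)"
    using borel_measurable_implies_sequence_metric[OF v_measurable, of 0] unfolding norm_conv_dist by blast
  have Sm[measurable]: "S i \<in> borel_measurable N" for i
    using S0(1) by (auto intro: borel_measurable_simple_function)
  \<comment> \<open>\<open>g\<close> is an arbitrary choice of subgradients, but \<open>S i\<close>
    takes finitely many values, so the composition is simple and hence measurable.\<close>
  have gS: "simple_function N (\<lambda>y. g (S i y))" for i
    using S0(1) by (auto intro: simple_function_compose2 simple_function_compose1)
  have gSm[measurable]: "(\<lambda>y. g (S i y)) \<in> borel_measurable N" for i
    using gS by (rule borel_measurable_simple_function)
  have Sfin: "finite (S i ` space N)" for i using S0(1) simple_functionD(1) by blast
  have fin_bound: "\<exists>B. \<forall>y\<in>space N. norm (f (S i y)) \<le> B" for f :: "'b \<Rightarrow> 'c::real_normed_vector" and i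
    using finite_imp_bounded[OF finite_imageI[OF Sfin, of f i]] by (auto simp: bounded_iff)
  have le: "(\<integral>y. L (S i y) + g (S i y) \<bullet> (v y - S i y) \<partial>D) \<le> (\<integral>x. L (V x) \<partial>M)" for i
  proof -
    define f where "f u = L u - g u \<bullet> u" for u
    have fm[measurable]: "(\<lambda>y. f (S i y)) \<in> borel_measurable N" unfolding f_def by measurable
    obtain Bf where Bf: "\<And>y. y \<in> space N \<Longrightarrow> norm (f (S i y)) \<le> Bf" using fin_bound by metis
    obtain Bg where Bg: "\<And>y. y \<in> space N \<Longrightarrow> norm (g (S i y)) \<le> Bg" using fin_bound by metis
    have Ysp: "Y x \<in> space N" if "x \<in> space M" for x using measurable_space[OF Y that] .
    have cs: "norm (g (S i y) \<bullet> u) \<le> norm (Bg * norm u)" if "y \<in> space N" for y u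
      using Cauchy_Schwarz_ineq2[of "g (S i y)" u] mult_right_mono[OF Bg[OF that], of "norm u"] by simp
    have f1: "integrable D (\<lambda>y. f (S i y))" by (rule D.integrable_const_bound[of _ Bf]) (use Bf in auto)
    have f2: "integrable M (\<lambda>x. f (S i (Y x)))" by (rule integrable_const_bound[of _ Bf]) (use Bf Ysp in auto)
    have g1: "integrable D (\<lambda>y. g (S i y) \<bullet> v y)"
      by (rule Bochner_Integration.integrable_bound[of _ "\<lambda>y. Bg * norm (v y)"]) (use v cs in auto)
    have g2: "integrable M (\<lambda>x. g (S i (Y x)) \<bullet> V x)"
      by (rule Bochner_Integration.integrable_bound[of _ "\<lambda>x. Bg * norm (V x)"]) (use V_integrable cs Ysp in auto)
    have "(\<integral>y. L (S i y) + g (S i y) \<bullet> (v y - S i y) \<partial>D) = (\<integral>y. f (S i y) + g (S i y) \<bullet> v y \<partial>D)"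
      by (simp add: f_def inner_diff_right algebra_simps)
    also have "\<dots> = (\<integral>y. f (S i y) \<partial>D) + (\<integral>y. g (S i y) \<bullet> v y \<partial>D)" using f1 g1 by simp
    \<comment> \<open>The part in \<open>f\<close> is a mere change of variables; the conditional
      expectation acts on the linear part.\<close>
    also have "\<dots> = (\<integral>x. f (S i (Y x)) \<partial>M) + (\<integral>x. g (S i (Y x)) \<bullet> V x \<partial>M)"
      using integral_inner_simple[OF gS] by (simp add: integral_distr)
    also have "\<dots> = (\<integral>x. f (S i (Y x)) + g (S i (Y x)) \<bullet> V x \<partial>M)" using f2 g2 by simp
    also have "\<dots> \<le> (\<integral>x. L (V x) \<partial>M)"
    proof (rule integral_mono)
      fix x
      show "f (S i (Y x)) + g (S i (Y x)) \<bullet> V x \<le> L (V x)"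
        using g[of "S i (Y x)" "V x"] by (simp add: f_def inner_diff_right)
    qed (use f2 g2 LV in auto)
    finally show ?thesis .
  qed
  have "(\<lambda>i. \<integral>y. L (S i y) + g (S i y) \<bullet> (v y - S i y) \<partial>D) \<longlonglongrightarrow> (\<integral>y. L (v y) \<partial>D)"
  \<comment> \<open>\<open>3 * R\<close> bounds \<open>norm (v y - S i y)\<close> as the sum of
    \<open>R\<close> and \<open>2 * R\<close>.\<close>
  proof (rule integral_dominated_convergence[where w="\<lambda>y. K + C * (3 * R)"])
    have S2: "AE y in D. \<forall>i. norm (S i y) \<le> 2 * R"
      using v_bounded AE_space
    proof eventually_elim
      case (elim y)
      then have "norm (S i y) \<le> 2 * norm (v y)" for i using S0(3) by simp
      from order_trans[OF this] show ?case using elim(1) by simp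
    qed
    show "AE y in D. (\<lambda>i. L (S i y) + g (S i y) \<bullet> (v y - S i y)) \<longlonglongrightarrow> L (v y)"
      using S2 AE_space
    proof eventually_elim
      case (elim y)
      then have lim: "(\<lambda>i. S i y) \<longlonglongrightarrow> v y" using S0(2) by simp
      have "(\<lambda>i. C * norm (v y - S i y)) \<longlonglongrightarrow> C * norm (v y - v y)"
        by (intro tendsto_intros lim)
      then have c: "(\<lambda>i. C * norm (v y - S i y)) \<longlonglongrightarrow> 0" by simp
      have b: "norm (g (S i y) \<bullet> (v y - S i y)) \<le> C * norm (v y - S i y)" for i
        using Cauchy_Schwarz_ineq2[of "g (S i y)" "v y - S i y"]
          mult_right_mono[OF C[of "S i y"], of "norm (v y - S i y)"] elim by simp
      have "(\<lambda>i. g (S i y) \<bullet> (v y - S i y)) \<longlonglongrightarrow> 0"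
        by (rule Lim_null_comparison[OF always_eventually[OF allI[OF b]] c])
      moreover have "(\<lambda>i. L (S i y)) \<longlonglongrightarrow> L (v y)"
        by (rule isCont_tendsto_compose[OF _ lim])
           (use convex_on_UNIV_continuous[OF L, of UNIV] in \<open>simp add: continuous_on_eq_continuous_at\<close>)
      ultimately show ?case using tendsto_add[of "\<lambda>i. L (S i y)" "L (v y)" sequentially "\<lambda>i. g (S i y) \<bullet> (v y - S i y)" 0] by simp
    qed
    show "AE y in D. norm (L (S i y) + g (S i y) \<bullet> (v y - S i y)) \<le> K + C * (3 * R)" for i
      using S2 v_bounded
    proof eventually_elim
      case (elim y)
      have "norm (g (S i y) \<bullet> (v y - S i y)) \<le> norm (g (S i y)) * norm (v y - S i y)"
        using Cauchy_Schwarz_ineq2 by simp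
      also have "\<dots> \<le> C * (3 * R)"
      proof (rule mult_mono)
        show g: "norm (g (S i y)) \<le> C" using C elim by blast
        show "0 \<le> C" using g norm_ge_zero order_trans by blast
        have "norm (S i y) \<le> 2 * R" using elim by blast
        then show "norm (v y - S i y) \<le> 3 * R"
          using elim(2) norm_triangle_ineq4[of "v y" "S i y"] by linarith
      qed simp
      finally have "\<bar>g (S i y) \<bullet> (v y - S i y)\<bar> \<le> C * (3 * R)" by simp
      moreover have "\<bar>L (S i y)\<bar> \<le> K" using K elim by blast
      ultimately show ?case unfolding real_norm_def by linarith
    qed
  qed auto
  then show "(\<integral>y. L (v y) \<partial>D) \<le> (\<integral>x. L (V x) \<partial>M)"
    by (rule LIMSEQ_le_const2) (use le in auto)
qed

end

section \<open>The interpolating flow\<close>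

locale interpolation =
  fixes X :: "'a::euclidean_space set" and p \<gamma> :: "'a measure"
  assumes X: "compact X" "convex X"
    and p: "p \<in> prob_measures X" and \<gamma>: "\<gamma> \<in> prob_measures X"
begin

sublocale p: prob_space p by (rule prob_measuresD[OF p])
sublocale \<gamma>: prob_space \<gamma> by (rule prob_measuresD[OF \<gamma>])
sublocale pair_prob_space p \<gamma> by unfold_locales

abbreviation M :: "('a \<times> 'a) measure" where "M \<equiv> p \<Otimes>\<^sub>M \<gamma>"
abbreviation T :: "real measure" where "T \<equiv> lebesgue_on {0..1}"

sublocale T: finite_measure T by (rule finite_measure_lebesgue_on) auto
sublocale TM: pair_sigma_finite T M by unfold_locales

definition Y :: "real \<Rightarrow> 'a \<times> 'a \<Rightarrow> 'a" where "Y t \<omega> = (1 - t) *\<^sub>R fst \<omega> + t *\<^sub>R snd \<omega>"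
definition V :: "'a \<times> 'a \<Rightarrow> 'a" where "V \<omega> = snd \<omega> - fst \<omega>"
definition path :: "real \<Rightarrow> 'a measure" where "path t = distr M (borel_on X) (Y t)"
text \<open>The expectation of \<open>V\<close> on the event that \<open>Y t\<close> lies in
  \<open>A\<close>; its density with respect to \<open>path t\<close> is thus the conditional
  expectation of \<open>V\<close> given \<open>Y t\<close>.\<close>

definition momentum :: "real \<Rightarrow> 'a set \<Rightarrow> 'a" where
  "momentum t A = (\<integral>\<omega>. indicator A (Y t \<omega>) *\<^sub>R V \<omega> \<partial>M)"
definition R :: real where "R = (SOME R. \<forall>x\<in>X. \<forall>z\<in>X. norm (x - z) \<le> R)"

lemma R: "x \<in> X \<Longrightarrow> z \<in> X \<Longrightarrow> norm (x - z) \<le> R"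
proof -
  obtain B where B: "\<And>x. x \<in> X \<Longrightarrow> norm x \<le> B"
    using compact_imp_bounded[OF X(1)] by (auto simp: bounded_iff)
  have "\<forall>x\<in>X. \<forall>z\<in>X. norm (x - z) \<le> B + B"
    using B by (meson add_mono norm_triangle_ineq4 order_trans)
  then have "\<forall>x\<in>X. \<forall>z\<in>X. norm (x - z) \<le> R" unfolding R_def by (rule someI)
  then show "x \<in> X \<Longrightarrow> z \<in> X \<Longrightarrow> norm (x - z) \<le> R" by blast
qed

lemma space_M: "space M = X \<times> X"
  using prob_measuresD(3)[OF p] prob_measuresD(3)[OF \<gamma>] by (simp add: space_pair_measure)

lemma measurable_id [measurable]: "(\<lambda>x. x) \<in> measurable p borel" "(\<lambda>x. x) \<in> measurable \<gamma> borel"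
    "(\<lambda>t. t) \<in> measurable T borel"
proof -
  show "(\<lambda>x. x) \<in> measurable p borel" "(\<lambda>x. x) \<in> measurable \<gamma> borel"
    using prob_measures_measurable[OF p] prob_measures_measurable[OF \<gamma>] by (auto intro: continuous_on_id)
  show "(\<lambda>t. t) \<in> measurable T borel"
    by (intro measurable_restrict_space1 measurable_completion) simp
qed

lemma Y_in: "t \<in> {0..1} \<Longrightarrow> \<omega> \<in> X \<times> X \<Longrightarrow> Y t \<omega> \<in> X"
  using X(2) by (auto simp: Y_def convex_alt)

lemma measurable_proj [measurable]:
  "fst \<in> borel_measurable M" "snd \<in> borel_measurable M"
  using measurable_compose[OF measurable_fst measurable_id(1)] measurable_compose[OF measurable_snd measurable_id(2)]
  by (auto simp: comp_def)

lemma V_measurable [measurable]: "V \<in> borel_measurable M"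
  unfolding V_def by measurable

lemma V_bound: "\<omega> \<in> space M \<Longrightarrow> norm (V \<omega>) \<le> R"
  using R unfolding space_M by (auto simp: V_def)

lemma V_int: "integrable M V"
  by (rule P.integrable_const_bound[of _ R]) (use V_bound in auto)

lemma Y_measurable: "t \<in> {0..1} \<Longrightarrow> Y t \<in> measurable M (borel_on X)"
  using Y_in unfolding Y_def[abs_def] by (intro measurable_restrict_space2) (auto simp: space_M)

lemma joint_measurable: "(\<lambda>(t, \<omega>). (t, Y t \<omega>)) \<in> measurable (T \<Otimes>\<^sub>M M) (borel_on ({0..1} \<times> X))"
proof (rule measurable_restrict_space2)
  show "(\<lambda>(t, \<omega>). (t, Y t \<omega>)) \<in> space (T \<Otimes>\<^sub>M M) \<rightarrow> {0..1} \<times> X"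
    using Y_in by (auto simp: space_pair_measure space_M space_restrict_space prob_measuresD(3)[OF p] prob_measuresD(3)[OF \<gamma>])
  have "(\<lambda>z. fst z) \<in> borel_measurable (T \<Otimes>\<^sub>M M)"
    using measurable_compose[OF measurable_fst measurable_id(3)] .
  moreover have "(\<lambda>z. Y (fst z) (snd z)) \<in> borel_measurable (T \<Otimes>\<^sub>M M)"
    unfolding Y_def
    by (intro borel_measurable_add borel_measurable_scaleR borel_measurable_diff borel_measurable_const calculation
        measurable_compose[OF measurable_snd measurable_proj(1)] measurable_compose[OF measurable_snd measurable_proj(2)])
  ultimately show "(\<lambda>(t, \<omega>). (t, Y t \<omega>)) \<in> borel_measurable (T \<Otimes>\<^sub>M M)"
    unfolding case_prod_beta' by (rule borel_measurable_Pair)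
qed

lemma path_prob: "t \<in> {0..1} \<Longrightarrow> path t \<in> prob_measures X"
  using P.prob_space_distr[OF Y_measurable] by (simp add: path_def prob_measures_def)

lemma integral_path:
  fixes f :: "'a \<Rightarrow> real"
  assumes "t \<in> {0..1}" "continuous_on X f"
  shows "(\<integral>x. f x \<partial>path t) = (\<integral>\<omega>. f (Y t \<omega>) \<partial>M)"
  unfolding path_def
  by (rule integral_distr[OF Y_measurable[OF assms(1)] borel_measurable_continuous_on_restrict[OF assms(2)]])

text \<open>Each segment \<open>t \<mapsto> Y t \<omega>\<close> is continuous and stays in
  \<open>X\<close>; dominated convergence along sequences carries this over to expectations.\<close>

lemma path_continuous: "continuous_map (top_of_set {0..1}) (weak_topology X) path"
  unfolding weak_path_continuous_iff
proof (intro conjI ballI allI impI)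
  show "t \<in> {0..1} \<Longrightarrow> path t \<in> prob_measures X" for t by (rule path_prob)
  fix f :: "'a \<Rightarrow> real" assume f: "continuous_on X f" "bounded (f ` X)"
  then obtain B where B: "\<And>x. x \<in> X \<Longrightarrow> \<bar>f x\<bar> \<le> B" by (auto simp: bounded_iff)
  have fm: "(\<lambda>\<omega>. f (Y t \<omega>)) \<in> borel_measurable M" if "t \<in> {0..1}" for t
    by (rule measurable_compose[OF Y_measurable[OF that] borel_measurable_continuous_on_restrict[OF f(1)]])
  show "continuous_on {0..1} (\<lambda>t. \<integral>x. f x \<partial>path t)"
    unfolding continuous_on_sequentially
  proof (intro ballI allI impI, elim conjE)
    fix s :: "nat \<Rightarrow> real" and t assume t: "t \<in> {0..1}" "\<forall>n. s n \<in> {0..1}" "s \<longlonglongrightarrow> t"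
    have "(\<lambda>n. \<integral>\<omega>. f (Y (s n) \<omega>) \<partial>M) \<longlonglongrightarrow> (\<integral>\<omega>. f (Y t \<omega>) \<partial>M)"
    proof (rule integral_dominated_convergence[where w="\<lambda>_. B"])
      show "AE \<omega> in M. (\<lambda>n. f (Y (s n) \<omega>)) \<longlonglongrightarrow> f (Y t \<omega>)"
      proof (rule AE_I2)
        fix \<omega> assume "\<omega> \<in> space M"
        then have w: "\<omega> \<in> X \<times> X" by (simp add: space_M)
        have "(\<lambda>n. Y (s n) \<omega>) \<longlonglongrightarrow> Y t \<omega>" unfolding Y_def by (intro tendsto_intros t)
        then show "(\<lambda>n. f (Y (s n) \<omega>)) \<longlonglongrightarrow> f (Y t \<omega>)"
          using t Y_in[OF _ w] by (intro continuous_on_tendsto_compose[OF f(1)]) auto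
      qed
      show "AE \<omega> in M. norm (f (Y (s n) \<omega>)) \<le> B" for n
        using B Y_in t(2) by (intro AE_I2) (simp add: space_M del: atLeastAtMost_iff)
    qed (use fm t in auto)
    then show "((\<lambda>t. \<integral>x. f x \<partial>path t) \<circ> s) \<longlonglongrightarrow> (\<integral>x. f x \<partial>path t)"
      using t integral_path[OF _ f(1)] by (simp add: comp_def)
  qed
qed

lemma momentum_vector_measure: "t \<in> {0..1} \<Longrightarrow> vector_measure (borel_on X) (momentum t)"
  unfolding momentum_def[abs_def] by (rule vector_measure_integral[OF V_int Y_measurable])

lemma momentum_abs_continuous:
  assumes t: "t \<in> {0..1}"
  shows "vector_abs_continuous (path t) (momentum t)"
  unfolding vector_abs_continuous_def
proof
  fix A assume "A \<in> null_sets (path t)"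
  then have "AE x in path t. x \<notin> A" by (rule AE_not_in)
  then have "AE \<omega> in M. Y t \<omega> \<notin> A"
    unfolding path_def by (rule AE_distrD[OF Y_measurable[OF t]])
  then have "AE \<omega> in M. indicator A (Y t \<omega>) *\<^sub>R V \<omega> = 0" by eventually_elim simp
  then show "momentum t A = 0" unfolding momentum_def by (rule integral_eq_zero_AE)
qed

text \<open>By Fubini the time integral of the slices is an integral over
  \<open>T \<Otimes>\<^sub>M M\<close>, again the pushforward of a vector measure with density, now
  under \<open>(t, \<omega>) \<mapsto> (t, Y t \<omega>)\<close>.\<close>

lemma spacetime_momentum: "spacetime_vector_measure X momentum"
proof -
  let ?N = "borel_on ({0..1} \<times> X)"
  let ?h = "\<lambda>A z. indicator A (case z of (t, \<omega>) \<Rightarrow> (t, Y t \<omega>)) *\<^sub>R V (snd z)"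
  have Vi: "integrable (T \<Otimes>\<^sub>M M) (\<lambda>z. V (snd z))"
  proof (rule Bochner_Integration.integrable_bound)
    interpret TM': finite_measure "T \<Otimes>\<^sub>M M"
      by (rule finite_measure_pair_measure) unfold_locales
    show "integrable (T \<Otimes>\<^sub>M M) (\<lambda>z. R)" by simp
    show "(\<lambda>z. V (snd z)) \<in> borel_measurable (T \<Otimes>\<^sub>M M)" by (rule measurable_compose[OF measurable_snd V_measurable])
    show "AE z in T \<Otimes>\<^sub>M M. norm (V (snd z)) \<le> norm R"
      using V_bound by (intro AE_I2) (fastforce simp: space_pair_measure)
  qed
  have hi: "integrable (T \<Otimes>\<^sub>M M) (?h A)" if A: "A \<in> sets ?N" for A
  proof (rule Bochner_Integration.integrable_bound[OF Vi])
    show "?h A \<in> borel_measurable (T \<Otimes>\<^sub>M M)"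
      using borel_measurable_integrable[OF Vi]
      by (intro borel_measurable_scaleR measurable_compose[OF joint_measurable borel_measurable_indicator] A)
    show "AE z in T \<Otimes>\<^sub>M M. norm (?h A z) \<le> norm (V (snd z))" by (simp add: indicator_def)
  qed
  have m: "momentum t (Pair t -` A) = (\<integral>\<omega>. ?h A (t, \<omega>) \<partial>M)" for t A
    unfolding momentum_def by (intro Bochner_Integration.integral_cong) (auto simp: indicator_def)
  have i: "integrable T (\<lambda>t. momentum t (Pair t -` A))" if "A \<in> sets ?N" for A
    unfolding m by (rule TM.integrable_fst'[OF hi[OF that]])
  have e: "(\<integral>t. momentum t (Pair t -` A) \<partial>T) = (\<integral>z. ?h A z \<partial>(T \<Otimes>\<^sub>M M))" if "A \<in> sets ?N" for A
    unfolding m by (rule TM.integral_fst'[OF hi[OF that]])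
  have "vector_measure ?N (\<lambda>A. \<integral>z. ?h A z \<partial>(T \<Otimes>\<^sub>M M))"
    by (rule vector_measure_integral[OF Vi joint_measurable])
  then have "vector_measure ?N (\<lambda>A. \<integral>t. momentum t (Pair t -` A) \<partial>T)"
    unfolding vector_measure_def
  proof (elim conjE, intro conjI allI impI)
    fix A :: "nat \<Rightarrow> (real \<times> 'a) set" assume A: "range A \<subseteq> sets ?N" "disjoint_family A"
      and *: "\<forall>A. range A \<subseteq> sets ?N \<longrightarrow> disjoint_family A \<longrightarrow>
        (\<lambda>i. \<integral>z. ?h (A i) z \<partial>(T \<Otimes>\<^sub>M M)) sums (\<integral>z. ?h (\<Union>i. A i) z \<partial>(T \<Otimes>\<^sub>M M))"
    have "(\<Union>i. A i) \<in> sets ?N" and Ai: "\<And>i. A i \<in> sets ?N" using A by auto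
    then show "(\<lambda>i. \<integral>t. momentum t (Pair t -` A i) \<partial>T) sums (\<integral>t. momentum t (Pair t -` (\<Union>i. A i)) \<partial>T)"
      using *[rule_format, OF A] by (simp only: e)
  qed (simp add: momentum_def)
  then show ?thesis
    unfolding spacetime_vector_measure_def using momentum_vector_measure i by blast
qed

text \<open>The equation defining the density of \<open>momentum t\<close> with respect to
  \<open>path t\<close>, the law of \<open>Y t\<close>, is the one that defines the conditional
  expectation.\<close>

lemma conditional_velocity:
  assumes t: "t \<in> {0..1}"
  shows "conditional_velocity M (borel_on X) (Y t) V (vector_RN_deriv (path t) (momentum t)) R"
proof -
  interpret path: prob_space "path t" using prob_measuresD[OF path_prob[OF t]] by simp
  have s: "sets (path t) = sets (borel_on X)" by (simp add: path_def)
  have m: "vector_measure (path t) (momentum t)"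
    using momentum_vector_measure[OF t] unfolding vector_measure_def s .
  note RN = vector_RN_deriv[OF path.finite_measure_axioms m momentum_abs_continuous[OF t]]
  show ?thesis
  proof
    show "integrable (distr M (borel_on X) (Y t)) (vector_RN_deriv (path t) (momentum t))"
      using RN(1) by (simp add: path_def)
    fix A assume A: "A \<in> sets (borel_on X)"
    show "(\<integral>y\<in>A. vector_RN_deriv (path t) (momentum t) y \<partial>distr M (borel_on X) (Y t)) =
         (\<integral>\<omega>. indicator A (Y t \<omega>) *\<^sub>R V \<omega> \<partial>M)"
      using RN(2)[of A] A s by (simp add: path_def momentum_def)
  qed (use t V_bound Y_measurable in auto)
qed

lemma velocity_bounded:
  assumes t: "t \<in> {0..1}"
  shows "AE x in path t. norm (vector_RN_deriv (path t) (momentum t) x) \<le> R"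
  using conditional_velocity.v_bounded[OF conditional_velocity[OF t]] unfolding path_def .

text \<open>The velocity is bounded by \<open>R\<close>, so all moments are finite; the exponent 2
  serves as the witness in \<open>flows\<close>.\<close>

lemma velocity_moment:
  "(\<integral>\<^sup>+t. (\<integral>\<^sup>+x. ennreal (norm (vector_RN_deriv (path t) (momentum t) x) powr 2) \<partial>path t) \<partial>T) < \<infinity>"
proof -
  have "(\<integral>\<^sup>+x. ennreal (norm (vector_RN_deriv (path t) (momentum t) x) powr 2) \<partial>path t) \<le> ennreal (R powr 2)"
    if t: "t \<in> {0..1}" for t
  proof -
    interpret path: prob_space "path t" using prob_measuresD[OF path_prob[OF t]] by simp
    have "(\<integral>\<^sup>+x. ennreal (norm (vector_RN_deriv (path t) (momentum t) x) powr 2) \<partial>path t) \<le> (\<integral>\<^sup>+x. ennreal (R powr 2) \<partial>path t)"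
      by (rule nn_integral_mono_AE, use velocity_bounded[OF t] in eventually_elim)
         (intro ennreal_leI powr_mono2, auto)
    then show ?thesis by (simp add: path.emeasure_space_1)
  qed
  then have "(\<integral>\<^sup>+t. (\<integral>\<^sup>+x. ennreal (norm (vector_RN_deriv (path t) (momentum t) x) powr 2) \<partial>path t) \<partial>T)
      \<le> (\<integral>\<^sup>+t. ennreal (R powr 2) \<partial>T)"
    by (intro nn_integral_mono) (auto simp: space_restrict_space)
  also have "\<dots> < \<infinity>"
    using T.emeasure_finite[of "{0..1}"] by (simp add: ennreal_mult_eq_top_iff less_top[symmetric])
  finally show ?thesis .
qed

lemma path_0: "path 0 = p"
proof -
  have "path 0 = distr M p fst"
    unfolding path_def Y_def using prob_measuresD(2)[OF p] by (intro distr_cong) auto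
  also have "\<dots> = p"
  proof (rule measure_eqI)
    fix A assume "A \<in> sets (distr M p fst)"
    then have A: "A \<in> sets p" by simp
    have "fst -` A \<inter> space M = A \<times> space \<gamma>"
      using sets.sets_into_space[OF A] by (auto simp: space_pair_measure)
    then show "emeasure (distr M p fst) A = emeasure p A"
      using A by (simp add: emeasure_distr \<gamma>.emeasure_pair_measure_Times \<gamma>.emeasure_space_1)
  qed simp
  finally show ?thesis .
qed

lemma path_1: "path 1 = \<gamma>"
proof -
  have "path 1 = distr M \<gamma> snd"
    unfolding path_def Y_def using prob_measuresD(2)[OF \<gamma>] by (intro distr_cong) auto
  also have "\<dots> = \<gamma>"
  proof (rule measure_eqI)
    fix A assume "A \<in> sets (distr M \<gamma> snd)"
    then have A: "A \<in> sets \<gamma>" by simp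
    have "snd -` A \<inter> space M = space p \<times> A"
      using sets.sets_into_space[OF A] by (auto simp: space_pair_measure)
    then show "emeasure (distr M \<gamma> snd) A = emeasure \<gamma> A"
      using A by (simp add: emeasure_distr \<gamma>.emeasure_pair_measure_Times p.emeasure_space_1)
  qed simp
  finally show ?thesis .
qed

text \<open>Along each segment, with constant velocity \<open>V \<omega>\<close>, the equation is
  the fundamental theorem of calculus. Averaging over \<open>\<omega>\<close> and exchanging
  integrals gives it for the laws, because pairing with \<open>G\<close> cannot tell
  \<open>V\<close> from its conditional expectation.\<close>

lemma continuity_equation: "continuity_equation X path momentum"
  unfolding continuity_equation_def
proof (intro allI impI)
  fix \<eta> \<eta>t G assume "C1_test X \<eta> \<eta>t G"
  then have \<eta>t: "continuous_on ({0..1} \<times> X) \<eta>t" and G: "continuous_on ({0..1} \<times> X) G"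
    and der: "\<And>z. z \<in> {0..1} \<times> X \<Longrightarrow> (\<eta> has_derivative (\<lambda>(s, h). s * \<eta>t z + G z \<bullet> h)) (at z within {0..1} \<times> X)"
    unfolding C1_test_def by blast+
  have \<eta>: "continuous_on ({0..1} \<times> X) \<eta>" using der by (rule has_derivative_continuous_on)
  interpret TM': finite_measure "T \<Otimes>\<^sub>M M" by (rule finite_measure_pair_measure) unfold_locales
  define J where "J z = (fst z, Y (fst z) (snd z))" for z
  have J: "J \<in> measurable (T \<Otimes>\<^sub>M M) (borel_on ({0..1} \<times> X))"
    using joint_measurable by (simp add: J_def[abs_def] case_prod_beta')
  have Jin: "J z \<in> {0..1} \<times> X" if "z \<in> space (T \<Otimes>\<^sub>M M)" for z
    using measurable_space[OF J that] by (simp add: space_restrict_space)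
  note bJ = measurable_compose[OF J borel_measurable_continuous_on_restrict]
  have cpt: "compact ({0..1::real} \<times> X)" using X by (intro compact_Times) auto
  obtain B where B: "\<And>z. z \<in> {0..1} \<times> X \<Longrightarrow> \<bar>\<eta>t z\<bar> \<le> B"
    using compact_imp_bounded[OF compact_continuous_image[OF \<eta>t cpt]] unfolding bounded_iff by auto
  obtain C where C: "\<And>z. z \<in> {0..1} \<times> X \<Longrightarrow> norm (G z) \<le> C"
    using compact_imp_bounded[OF compact_continuous_image[OF G cpt]] unfolding bounded_iff by blast
  have i1: "integrable (T \<Otimes>\<^sub>M M) (\<lambda>z. \<eta>t (J z))"
    by (rule TM'.integrable_const_bound[of _ B]) (use B Jin bJ[OF \<eta>t] in \<open>auto simp del: mem_Times_iff\<close>)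
  have i2: "integrable (T \<Otimes>\<^sub>M M) (\<lambda>z. G (J z) \<bullet> V (snd z))"
  proof (rule TM'.integrable_const_bound[of _ "C * R"])
    show "(\<lambda>z. G (J z) \<bullet> V (snd z)) \<in> borel_measurable (T \<Otimes>\<^sub>M M)"
      using bJ[OF G] measurable_compose[OF measurable_snd V_measurable] by (rule borel_measurable_inner)
    show "AE z in T \<Otimes>\<^sub>M M. norm (G (J z) \<bullet> V (snd z)) \<le> C * R"
    proof (rule AE_I2)
      fix z assume z: "z \<in> space (T \<Otimes>\<^sub>M M)"
      have "norm (G (J z) \<bullet> V (snd z)) \<le> norm (G (J z)) * norm (V (snd z))"
        using Cauchy_Schwarz_ineq2 by simp
      also have "\<dots> \<le> C * R"
      proof (rule mult_mono)
        show *: "norm (G (J z)) \<le> C" using C[OF Jin[OF z]] .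
        show "0 \<le> C" using * norm_ge_zero order_trans by blast
        show "norm (V (snd z)) \<le> R" using z V_bound by (auto simp: space_pair_measure)
      qed simp
      finally show "norm (G (J z) \<bullet> V (snd z)) \<le> C * R" .
    qed
  qed
  have "(\<integral>t. (\<integral>x. \<eta>t (t, x) \<partial>path t) \<partial>T) = (\<integral>t. (\<integral>\<omega>. \<eta>t (J (t, \<omega>)) \<partial>M) \<partial>T)"
    using continuous_on_slice[OF \<eta>t]
    by (intro Bochner_Integration.integral_cong) (auto simp: space_restrict_space integral_path J_def)
  also have "\<dots> = (\<integral>z. \<eta>t (J z) \<partial>(T \<Otimes>\<^sub>M M))" by (rule TM.integral_fst'[OF i1])
  finally have e1: "(\<integral>t. (\<integral>x. \<eta>t (t, x) \<partial>path t) \<partial>T) = (\<integral>z. \<eta>t (J z) \<partial>(T \<Otimes>\<^sub>M M))" .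
  have "(\<integral>t. vector_integral (path t) (momentum t) (\<lambda>x. G (t, x)) \<partial>T)
      = (\<integral>t. (\<integral>\<omega>. G (J (t, \<omega>)) \<bullet> V \<omega> \<partial>M) \<partial>T)"
  proof (rule Bochner_Integration.integral_cong[OF refl])
    fix t assume "t \<in> space T"
    then have t: "t \<in> {0..1}" by (simp add: space_restrict_space)
    interpret conditional_velocity M "borel_on X" "Y t" V "vector_RN_deriv (path t) (momentum t)" R
      by (rule conditional_velocity[OF t])
    show "vector_integral (path t) (momentum t) (\<lambda>x. G (t, x)) = (\<integral>\<omega>. G (J (t, \<omega>)) \<bullet> V \<omega> \<partial>M)"
      using integral_inner_bounded[OF borel_measurable_continuous_on_restrict[OF continuous_on_slice[OF G t]], of C] C t
      by (simp add: vector_integral_def J_def path_def space_restrict_space)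
  qed
  also have "\<dots> = (\<integral>z. G (J z) \<bullet> V (snd z) \<partial>(T \<Otimes>\<^sub>M M))" using TM.integral_fst'[OF i2] by simp
  finally have e2: "(\<integral>t. vector_integral (path t) (momentum t) (\<lambda>x. G (t, x)) \<partial>T)
     = (\<integral>z. G (J z) \<bullet> V (snd z) \<partial>(T \<Otimes>\<^sub>M M))" .
  have FTC: "(\<integral>t. \<eta>t (J (t, \<omega>)) + G (J (t, \<omega>)) \<bullet> V \<omega> \<partial>T) = \<eta> (1, Y 1 \<omega>) - \<eta> (0, Y 0 \<omega>)"
    if w: "\<omega> \<in> X \<times> X" for \<omega>
  proof -
    \<comment> \<open>The curve stays inside \<open>{0..1} \<times> X\<close>, so the chain rule
      uses the derivative of \<open>\<eta>\<close> only within that set.\<close>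
    have Jw: "(\<lambda>t. J (t, \<omega>)) ` {0..1} \<subseteq> {0..1} \<times> X" using Y_in[OF _ w] by (auto simp: J_def)
    have Jc: "continuous_on {0..1} (\<lambda>t. J (t, \<omega>))" unfolding J_def Y_def by (auto intro!: continuous_intros)
    have "((\<lambda>t. \<eta> (J (t, \<omega>))) has_vector_derivative (\<eta>t (J (t, \<omega>)) + G (J (t, \<omega>)) \<bullet> V \<omega>)) (at t within {0..1})"
      if t: "t \<in> {0..1}" for t
    proof -
      have "((\<lambda>t. J (t, \<omega>)) has_derivative (\<lambda>s. (s, s *\<^sub>R V \<omega>))) (at t within {0..1})"
        unfolding J_def Y_def V_def by (auto intro!: derivative_eq_intros simp: algebra_simps)
      from has_derivative_in_compose2[OF der Jw t this] show ?thesis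
        unfolding has_vector_derivative_def by (simp add: distrib_left)
    qed
    then have "((\<lambda>t. \<eta>t (J (t, \<omega>)) + G (J (t, \<omega>)) \<bullet> V \<omega>) has_integral (\<eta> (J (1, \<omega>)) - \<eta> (J (0, \<omega>)))) {0..1}"
      by (intro fundamental_theorem_of_calculus) auto
    moreover have "integrable T (\<lambda>t. \<eta>t (J (t, \<omega>)) + G (J (t, \<omega>)) \<bullet> V \<omega>)"
      by (intro continuous_imp_integrable_real continuous_intros continuous_on_compose2[OF \<eta>t Jc Jw] continuous_on_compose2[OF G Jc Jw])
    ultimately show ?thesis
      by (simp add: lebesgue_integral_eq_integral integral_unique J_def)
  qed
  have \<eta>i: "integrable M (\<lambda>\<omega>. \<eta> (t, Y t \<omega>))" if t: "t \<in> {0..1}" for t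
  proof -
    have "integrable (path t) (\<lambda>x. \<eta> (t, x))"
      by (rule prob_measures_integrable[OF path_prob[OF t] X(1) continuous_on_slice[OF \<eta> t]])
    then show ?thesis unfolding path_def by (rule integrable_distr[OF Y_measurable[OF t]])
  qed
  have "(\<integral>z. \<eta>t (J z) \<partial>(T \<Otimes>\<^sub>M M)) + (\<integral>z. G (J z) \<bullet> V (snd z) \<partial>(T \<Otimes>\<^sub>M M))
      = (\<integral>z. \<eta>t (J z) + G (J z) \<bullet> V (snd z) \<partial>(T \<Otimes>\<^sub>M M))"
    using i1 i2 by simp
  also have "\<dots> = (\<integral>\<omega>. (\<integral>t. \<eta>t (J (t, \<omega>)) + G (J (t, \<omega>)) \<bullet> V \<omega> \<partial>T) \<partial>M)"
    using TM.integral_snd[of "\<lambda>t \<omega>. \<eta>t (J (t, \<omega>)) + G (J (t, \<omega>)) \<bullet> V \<omega>"] i1 i2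
    by (simp add: case_prod_beta')
  also have "\<dots> = (\<integral>\<omega>. \<eta> (1, Y 1 \<omega>) - \<eta> (0, Y 0 \<omega>) \<partial>M)"
    using FTC by (intro Bochner_Integration.integral_cong) (auto simp: space_M)
  also have "\<dots> = (\<integral>x. \<eta> (1, x) \<partial>path 1) - (\<integral>x. \<eta> (0, x) \<partial>path 0)"
    using \<eta>i continuous_on_slice[OF \<eta>] by (simp add: integral_path)
  finally show "(\<integral>t. (\<integral>x. \<eta>t (t, x) \<partial>path t) \<partial>T) +
      (\<integral>t. vector_integral (path t) (momentum t) (\<lambda>x. G (t, x)) \<partial>T) =
      (\<integral>x. \<eta> (1, x) \<partial>path 1) - (\<integral>x. \<eta> (0, x) \<partial>path 0)"
    by (simp add: e1 e2)
qed

text \<open>Jensen bounds the cost at every time by the same constant, and the time interval has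
  length 1.\<close>

lemma dynamic_cost_le:
  assumes L: "convex_on UNIV L"
  shows "dynamic_cost L (path, momentum) \<le> ereal (\<integral>\<omega>. L (V \<omega>) \<partial>M)"
proof -
  let ?c = "\<integral>\<omega>. L (V \<omega>) \<partial>M"
  have "ereal_integral T (\<lambda>t. ereal_integral (path t) (\<lambda>x. ereal (L (vector_RN_deriv (path t) (momentum t) x))))
      \<le> ereal_integral T (\<lambda>t. ereal ?c)"
  proof (rule ereal_integral_mono)
    fix t assume "t \<in> space T"
    then have t: "t \<in> {0..1}" by (simp add: space_restrict_space)
    interpret conditional_velocity M "borel_on X" "Y t" V "vector_RN_deriv (path t) (momentum t)" R
      by (rule conditional_velocity[OF t])
    show "ereal_integral (path t) (\<lambda>x. ereal (L (vector_RN_deriv (path t) (momentum t) x))) \<le> ereal ?c"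
      using ereal_integral_eq_integral[OF L_v_integrable[OF L]] integral_L_v_le[OF L] by (simp add: path_def)
  qed
  also have "\<dots> = ereal ?c"
    by (subst ereal_integral_eq_integral) (auto simp: measure_restrict_space)
  finally show ?thesis by (simp add: dynamic_cost_def)
qed

end

section \<open>Compactness and the static minimiser\<close>

lemma tendsto_indicator_closed:
  fixes C :: "'a::metric_space set"
  assumes "closed C" "C \<noteq> {}"
  shows "(\<lambda>n. max 0 (1 - real n * infdist x C)) \<longlonglongrightarrow> indicator C x"
proof (cases "x \<in> C")
  case True
  then show ?thesis by simp
next
  case False
  then have d: "infdist x C > 0"
    using assms in_closed_iff_infdist_zero[of C x] infdist_nonneg[of x C] by (auto simp: less_le)
  obtain N where N: "1 / infdist x C < real N" using reals_Archimedean2 by blast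
  have "max 0 (1 - real n * infdist x C) = indicator C x" if "n \<ge> N" for n
  proof -
    have "1 / infdist x C \<le> real n" using N that by linarith
    then show ?thesis using d False by (simp add: field_simps)
  qed
  then have "\<forall>\<^sub>F n in sequentially. max 0 (1 - real n * infdist x C) = indicator C x"
    unfolding eventually_sequentially by blast
  then show ?thesis by (rule tendsto_eventually)
qed

text \<open>Integrals of \<open>max 0 (1 - n * infdist x C)\<close> determine the mass of every
  nonempty closed \<open>C\<close>, and the closed sets are a generator stable under
  intersection.\<close>

lemma prob_measures_eqI:
  fixes X :: "'a::metric_space set"
  assumes X: "closed X" and \<nu>1: "\<nu>1 \<in> prob_measures X" and \<nu>2: "\<nu>2 \<in> prob_measures X"
    and eq: "\<And>f::'a \<Rightarrow> real. continuous_on UNIV f \<Longrightarrow> (\<integral>x. f x \<partial>\<nu>1) = (\<integral>x. f x \<partial>\<nu>2)"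
  shows "\<nu>1 = \<nu>2"
proof -
  define E where "E \<nu> = distr \<nu> borel (\<lambda>x. x)" for \<nu> :: "'a measure"
  have id: "(\<lambda>x. x) \<in> measurable \<nu> borel" if "\<nu> \<in> prob_measures X" for \<nu>
    using prob_measures_measurable[OF that continuous_on_id] .
  have lim: "(\<lambda>n. \<integral>x. max 0 (1 - real n * infdist x C) \<partial>\<nu>) \<longlonglongrightarrow> measure (E \<nu>) C"
    if \<nu>: "\<nu> \<in> prob_measures X" and C: "closed C" "C \<noteq> {}" for \<nu> C
  proof -
    interpret prob_space \<nu> by (rule prob_measuresD[OF \<nu>])
    have "(\<lambda>n. \<integral>x. max 0 (1 - real n * infdist x C) \<partial>\<nu>) \<longlonglongrightarrow> (\<integral>x. indicator C x \<partial>\<nu>)"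
    proof (rule integral_dominated_convergence[where w="\<lambda>_. 1"])
      show "(\<lambda>x. indicator C x) \<in> borel_measurable \<nu>"
        by (rule measurable_compose[OF id[OF \<nu>] borel_measurable_indicator]) (use C in auto)
      show "(\<lambda>x. max 0 (1 - real n * infdist x C)) \<in> borel_measurable \<nu>" for n
        by (intro prob_measures_measurable[OF \<nu>] continuous_intros)
    qed (use tendsto_indicator_closed[OF C] in \<open>auto simp: infdist_nonneg intro!: AE_I2\<close>)
    also have "(\<integral>x. indicator C x \<partial>\<nu>) = measure (E \<nu>) C"
      using C id[OF \<nu>] by (simp add: E_def measure_distr Int_commute flip: vimage_def)
    finally show ?thesis .
  qed
  have "E \<nu>1 = E \<nu>2"
  proof (rule measure_eqI_generator_eq[where E="Collect closed" and \<Omega>=UNIV and A="\<lambda>_. UNIV"])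
    fix C :: "'a set" assume "C \<in> Collect closed"
    then have C: "closed C" by simp
    interpret E1: prob_space "E \<nu>1"
      unfolding E_def using prob_measuresD(1)[OF \<nu>1] id[OF \<nu>1] by (rule prob_space.prob_space_distr)
    interpret E2: prob_space "E \<nu>2"
      unfolding E_def using prob_measuresD(1)[OF \<nu>2] id[OF \<nu>2] by (rule prob_space.prob_space_distr)
    have "measure (E \<nu>1) C = measure (E \<nu>2) C"
    proof (cases "C = {}")
      case False
      have "(\<integral>x. max 0 (1 - real n * infdist x C) \<partial>\<nu>1) = (\<integral>x. max 0 (1 - real n * infdist x C) \<partial>\<nu>2)" for n
        by (intro eq continuous_intros)
      then show ?thesis
        using lim[OF \<nu>1 C False] lim[OF \<nu>2 C False] by (auto intro: LIMSEQ_unique)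
    qed simp
    then show "emeasure (E \<nu>1) C = emeasure (E \<nu>2) C"
      by (simp add: E1.emeasure_eq_measure E2.emeasure_eq_measure)
  next
    show "emeasure (E \<nu>1) UNIV \<noteq> \<infinity>"
      using prob_space.prob_space_distr[OF prob_measuresD(1)[OF \<nu>1] id[OF \<nu>1]]
      by (simp add: E_def finite_measure.emeasure_finite prob_space_def)
  qed (auto simp: E_def Int_stable_def borel_eq_closed sets_measure_of)
  show ?thesis
  proof (rule measure_eqI)
    show "sets \<nu>1 = sets \<nu>2" using prob_measuresD(2)[OF \<nu>1] prob_measuresD(2)[OF \<nu>2] by simp
    fix A assume "A \<in> sets \<nu>1"
    then have A: "A \<in> sets borel" "A \<subseteq> X"
      using X prob_measuresD(2)[OF \<nu>1] by (auto simp: sets_restrict_space)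
    have "emeasure \<nu> A = emeasure (E \<nu>) A" if "\<nu> \<in> prob_measures X" for \<nu>
      using A prob_measuresD(3)[OF that] id[OF that] by (simp add: E_def emeasure_distr Int_absorb2)
    then show "emeasure \<nu>1 A = emeasure \<nu>2 A" using \<nu>1 \<nu>2 \<open>E \<nu>1 = E \<nu>2\<close> by simp
  qed
qed



text \<open>At the first place \<open>l\<close> of disagreement the digits contribute
  \<open>(1/3)^l\<close>, and all later ones together at most half of that. In base 2 the tail could
  cancel the leading difference.\<close>

lemma ternary_digits_agree:
  fixes d d' :: "nat \<Rightarrow> bool"
  assumes "\<bar>(\<Sum>i. (1/3)^i * of_bool (d i)) - (\<Sum>i. (1/3)^i * of_bool (d' i))\<bar> < (1/3::real)^k / 2" and "j \<le> k"
  shows "d j = d' j"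
proof (rule ccontr)
  assume "d j \<noteq> d' j"
  define l where "l = (LEAST l. d l \<noteq> d' l)"
  have l: "d l \<noteq> d' l" unfolding l_def using \<open>d j \<noteq> d' j\<close> by (rule LeastI)
  have lj: "l \<le> j" unfolding l_def using \<open>d j \<noteq> d' j\<close> by (rule Least_le)
  have lmin: "d i = d' i" if "i < l" for i using not_less_Least that unfolding l_def by blast
  define c where "c i = (1/3::real)^i * (of_bool (d i) - of_bool (d' i))" for i
  have geo: "summable (\<lambda>i. (1/3::real)^i)" by (rule summable_geometric) simp
  have sm: "summable (\<lambda>i. (1/3::real)^i * of_bool (e i))" for e :: "nat \<Rightarrow> bool"
    by (rule summable_comparison_test'[OF geo, of 0]) simp
  have csum: "summable c" unfolding c_def right_diff_distrib using sm by (intro summable_diff)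
  have ceq: "(\<Sum>i. (1/3)^i * of_bool (d i)) - (\<Sum>i. (1/3)^i * of_bool (d' i)) = suminf c"
    unfolding c_def right_diff_distrib using sm by (intro suminf_diff)
  have split: "suminf c = (\<Sum>i. c (i + Suc l)) + c l"
  proof -
    have "(\<Sum>i<Suc l. c i) = c l" using lmin by (simp add: c_def)
    then show ?thesis using suminf_split_initial_segment[OF csum, of "Suc l"] by simp
  qed
  have "\<bar>\<Sum>i. c (i + Suc l)\<bar> \<le> (\<Sum>i. (1/3)^(i + Suc l))"
  proof -
    have g: "summable (\<lambda>i. (1/3::real)^(i + Suc l))" using geo summable_ignore_initial_segment by blast
    have "norm (c (i + Suc l)) \<le> (1/3)^(i + Suc l)" for i by (simp add: c_def abs_mult)
    then show ?thesis using norm_suminf_le[OF _ g, of "\<lambda>i. c (i + Suc l)"] by simp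
  qed
  also have "\<dots> = (\<Sum>i. (1/3)^i * (1/3)^(Suc l))" by (simp add: power_add)
  also have "\<dots> = (\<Sum>i. (1/3)^i) * (1/3::real)^(Suc l)" using geo by (rule suminf_mult2[symmetric])
  also have "\<dots> = (1/3)^l / 2" by (simp add: suminf_geometric)
  finally have "\<bar>\<Sum>i. c (i + Suc l)\<bar> \<le> (1/3)^l / 2" .
  moreover have "\<bar>c l\<bar> = (1/3)^l" using l by (auto simp: c_def abs_mult)
  ultimately have "\<bar>suminf c\<bar> \<ge> (1/3)^l / 2" using split by linarith
  moreover have "(1/3::real)^l \<ge> (1/3)^k" using lj \<open>j \<le> k\<close> by (intro power_decreasing) auto
  ultimately show False using assms(1) ceq by linarith
qed

text \<open>
  \<open>s x\<close> records in base \<open>3\<close>, with digits \<open>0\<close> and \<open>1\<close> only, which members of a countable base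
  contain \<open>x\<close>. Close codes share their leading digits, so the inverse of \<open>s\<close> is uniformly
  continuous and extends to \<open>\<phi>\<close>, although \<open>s\<close> itself is only Borel.
\<close>

lemma compact_coding:
  fixes X :: "'a::euclidean_space set"
  assumes X: "compact X" "convex X" "X \<noteq> {}"
  obtains s :: "'a \<Rightarrow> real" and \<phi> :: "real \<Rightarrow> 'a" where
    "s \<in> borel_measurable borel" "range s \<subseteq> {0..2}"
    "continuous_on UNIV \<phi>" "range \<phi> \<subseteq> X" "\<And>x. x \<in> X \<Longrightarrow> \<phi> (s x) = x"
proof -
  obtain B :: "'a set set" where B: "countable B" "topological_basis B" using ex_countable_basis by blast
  have Bne: "B \<noteq> {}" using B(2) topological_basisE[OF B(2) open_UNIV UNIV_I] by (metis empty_iff)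
  define U where "U = from_nat_into B"
  have U_open: "open (U i)" for i
    unfolding U_def using from_nat_into[OF Bne] topological_basis_open[OF B(2)] by blast
  define s :: "'a \<Rightarrow> real" where "s x = (\<Sum>i. (1/3)^i * of_bool (x \<in> U i))" for x
  have geo: "summable (\<lambda>i. (1/3::real)^i)" by (rule summable_geometric) simp
  have sm: "summable (\<lambda>i. (1/3::real)^i * of_bool (x \<in> U i))" for x
    by (rule summable_comparison_test'[OF geo, of 0]) simp
  have s_meas: "s \<in> borel_measurable borel"
    unfolding s_def
  proof (rule borel_measurable_suminf)
    show "(\<lambda>x. (1/3)^i * of_bool (x \<in> U i) :: real) \<in> borel_measurable borel" for i
    proof -
      have [measurable]: "U i \<in> sets borel" using U_open[of i] by simp
      show ?thesis by measurable
    qed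
  qed
  have s_range: "s x \<in> {0..2}" for x
  proof -
    have "s x \<le> (\<Sum>i. (1/3)^i)" unfolding s_def using sm geo by (intro suminf_le) auto
    then have "s x \<le> 2" by (simp add: suminf_geometric)
    moreover have "0 \<le> s x" unfolding s_def using sm by (intro suminf_nonneg) auto
    ultimately show ?thesis by simp
  qed
  have unif: "\<exists>d>0. \<forall>x\<in>X. \<forall>y\<in>X. \<bar>s x - s y\<bar> < d \<longrightarrow> dist x y < e" if e: "e > 0" for e
  proof -
    \<comment> \<open>Basic sets whose points are pairwise closer than \<open>e\<close>; by
      compactness finitely many of them cover \<open>X\<close>.\<close>
    define K where "K = {i. \<forall>y\<in>U i. \<forall>z\<in>U i. dist y z < e}"
    have cover: "X \<subseteq> (\<Union>i\<in>K. U i)"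
    proof
      fix x assume "x \<in> X"
      have "x \<in> ball x (e/2)" using e by simp
      then obtain W where W: "W \<in> B" "x \<in> W" "W \<subseteq> ball x (e/2)"
        using topological_basisE[OF B(2) open_ball] by metis
      then obtain i where i: "U i = W" unfolding U_def using from_nat_into_surj[OF B(1)] by metis
      have "dist y z < e" if "y \<in> W" "z \<in> W" for y z
        by (rule dist_triangle_half_r[of x]) (use W(3) that in auto)
      then have "i \<in> K" unfolding K_def using i by blast
      then show "x \<in> (\<Union>i\<in>K. U i)" using i W by blast
    qed
    obtain J where J: "J \<subseteq> K" "finite J" "X \<subseteq> (\<Union>i\<in>J. U i)"
      by (rule compactE_image[OF X(1) U_open cover])
    show ?thesis
    \<comment> \<open>Codes closer than this agree in all digits up to \<open>Max J\<close>, so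
      \<open>x\<close> and \<open>y\<close> lie in the same sets of the finite cover.\<close>
    proof (intro exI[of _ "(1/3)^(Max J) / 2"] conjI ballI impI)
      fix x y assume xy: "x \<in> X" "y \<in> X" "\<bar>s x - s y\<bar> < (1/3)^(Max J) / 2"
      obtain i where i: "i \<in> J" "x \<in> U i" using J(3) xy(1) by blast
      have "(x \<in> U i) = (y \<in> U i)"
        using xy(3) Max_ge[OF J(2) i(1)] unfolding s_def by (rule ternary_digits_agree)
      then show "dist x y < e" using i J(1) by (auto simp: K_def)
    qed simp
  qed
  have inj: "inj_on s X"
  proof (rule inj_onI, rule ccontr)
    fix x y assume xy: "x \<in> X" "y \<in> X" "s x = s y" "x \<noteq> y"
    then obtain d where "d > 0" and d: "\<forall>a\<in>X. \<forall>b\<in>X. \<bar>s a - s b\<bar> < d \<longrightarrow> dist a b < dist x y"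
      using unif[of "dist x y"] by auto
    then show False using d[rule_format, OF xy(1,2)] xy(3) by simp
  qed
  have "uniformly_continuous_on (s ` X) (inv_into X s)"
    unfolding uniformly_continuous_on_def
  proof (intro allI impI)
    fix e :: real assume "e > 0"
    then obtain d where "d > 0" "\<forall>x\<in>X. \<forall>y\<in>X. \<bar>s x - s y\<bar> < d \<longrightarrow> dist x y < e" using unif by blast
    then show "\<exists>d>0. \<forall>a\<in>s ` X. \<forall>b\<in>s ` X. dist b a < d \<longrightarrow> dist (inv_into X s b) (inv_into X s a) < e"
      using inj by (intro exI[of _ d]) (auto simp: dist_real_def)
  qed
  \<comment> \<open>The image of \<open>s\<close> need not be closed. Uniform continuity extends the
    inverse to its closure, and Dugundji's theorem then extends it to the line with values in the
    convex set \<open>X\<close>.\<close>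
  then obtain g where g: "uniformly_continuous_on (closure (s ` X)) g" "\<And>a. a \<in> s ` X \<Longrightarrow> inv_into X s a = g a"
    by (rule uniformly_continuous_on_extension_on_closure) (rule that)
  have gc: "continuous_on (closure (s ` X)) g" by (rule uniformly_continuous_imp_continuous[OF g(1)])
  have gs: "g (s x) = x" if "x \<in> X" for x using g(2)[of "s x"] inj that by simp
  have g_image: "g ` closure (s ` X) \<subseteq> X"
    using gs compact_imp_closed[OF X(1)] by (intro image_closure_subset[OF gc]) auto
  have cl: "closedin (top_of_set UNIV) (closure (s ` X))" by simp
  obtain \<phi> where \<phi>: "continuous_on UNIV \<phi>" "\<phi> ` UNIV \<subseteq> X" "\<And>a. a \<in> closure (s ` X) \<Longrightarrow> \<phi> a = g a"
    by (rule Dugundji[OF X(2,3) cl gc g_image]) (rule that)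
  have \<phi>s: "\<phi> (s x) = x" if "x \<in> X" for x
  proof -
    have "s x \<in> closure (s ` X)" using closure_subset[of "s ` X"] that by auto
    then show ?thesis using \<phi>(3) gs[OF that] by simp
  qed
  show thesis
    by (rule that[OF s_meas _ \<phi>(1,2) \<phi>s]) (use s_range in auto)
qed

text \<open>Helly's theorem is applied to the laws of \<open>s\<close>, and \<open>\<phi>\<close> transports the limit back.\<close>

lemma prob_measures_seq_compact:
  fixes X :: "'a::euclidean_space set" and \<gamma> :: "nat \<Rightarrow> 'a measure"
  assumes X: "compact X" "convex X" and \<gamma>: "\<And>n. \<gamma> n \<in> prob_measures X"
  obtains r :: "nat \<Rightarrow> nat" and \<nu> where "strict_mono r" "\<nu> \<in> prob_measures X"
    "\<And>f::'a \<Rightarrow> real. continuous_on X f \<Longrightarrow> (\<lambda>n. \<integral>x. f x \<partial>\<gamma> (r n)) \<longlonglongrightarrow> (\<integral>x. f x \<partial>\<nu>)"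
proof -
  have "X \<noteq> {}" using prob_space.not_empty[OF prob_measuresD(1)[OF \<gamma>]] prob_measuresD(3)[OF \<gamma>] by metis
  then obtain s :: "'a \<Rightarrow> real" and \<phi> where s: "s \<in> borel_measurable borel" "range s \<subseteq> {0..2}"
    and \<phi>: "continuous_on UNIV \<phi>" "range \<phi> \<subseteq> X" and inv: "\<And>x. x \<in> X \<Longrightarrow> \<phi> (s x) = x"
    using compact_coding[OF X] by metis
  have sm: "s \<in> borel_measurable (\<gamma> n)" for n
    using measurable_compose[OF prob_measures_measurable[OF \<gamma> continuous_on_id] s(1)] .
  define \<mu> where "\<mu> n = distr (\<gamma> n) borel s" for n
  have rd: "real_distribution (\<mu> n)" for n
    unfolding \<mu>_def using prob_measuresD(1)[OF \<gamma>] sm by (rule prob_space.real_distribution_distr)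
  have "tight \<mu>"
    unfolding tight_def
  proof (intro conjI allI impI rd)
    fix e :: real assume e: "0 < e"
    have "measure (\<mu> n) {-1<..2} = 1" for n
    proof -
      interpret prob_space "\<gamma> n" by (rule prob_measuresD[OF \<gamma>])
      have "0 \<le> s x \<and> s x \<le> 2" for x using s(2) by (auto simp: image_subset_iff)
      then have "s x \<in> {-1<..2}" for x by (smt (verit) greaterThanAtMost_iff)
      then have "s -` {-1<..2} \<inter> space (\<gamma> n) = space (\<gamma> n)" by blast
      then show ?thesis by (simp add: \<mu>_def measure_distr sm prob_space)
    qed
    then show "\<exists>a b. a < b \<and> (\<forall>n. 1 - e < measure (\<mu> n) {a<..b})"
      using e by (intro exI[of _ "-1"] exI[of _ 2]) auto
  qed
  then obtain r \<rho> where r: "strict_mono r" and \<rho>: "real_distribution \<rho>" and conv: "weak_conv_m (\<mu> \<circ> r) \<rho>"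
    using tight_imp_convergent_subsubsequence[of \<mu> id] by (auto simp: strict_mono_id)
  interpret \<rho>: real_distribution \<rho> by (rule \<rho>)
  have \<phi>m: "\<phi> \<in> measurable borel (borel_on X)"
    using \<phi> by (intro measurable_restrict_space2 borel_measurable_continuous_onI) auto
  then have \<phi>m': "\<phi> \<in> measurable \<rho> (borel_on X)" by simp
  define \<nu> where "\<nu> = distr \<rho> (borel_on X) \<phi>"
  have \<nu>: "\<nu> \<in> prob_measures X"
    using \<rho>.prob_space_distr[OF \<phi>m'] by (simp add: \<nu>_def prob_measures_def)
  have "(\<lambda>n. \<integral>x. f x \<partial>\<gamma> (r n)) \<longlonglongrightarrow> (\<integral>x. f x \<partial>\<nu>)" if f: "continuous_on X f" for f :: "'a \<Rightarrow> real"
  proof -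
    have fm: "f \<in> borel_measurable (borel_on X)" by (rule borel_measurable_continuous_on_restrict[OF f])
    have f\<phi>: "continuous_on UNIV (\<lambda>a. f (\<phi> a))" using \<phi> by (intro continuous_on_compose2[OF f]) auto
    obtain C where C: "\<And>x. x \<in> X \<Longrightarrow> norm (f x) \<le> C"
      using compact_imp_bounded[OF compact_continuous_image[OF f X(1)]] by (auto simp: bounded_iff)
    have "(\<lambda>n. \<integral>a. f (\<phi> a) \<partial>(\<mu> \<circ> r) n) \<longlonglongrightarrow> (\<integral>a. f (\<phi> a) \<partial>\<rho>)"
    proof (rule weak_conv_imp_integral_bdd_continuous_conv)
      show "real_distribution ((\<mu> \<circ> r) n)" for n using rd by simp
      show "isCont (\<lambda>a. f (\<phi> a)) a" for a using f\<phi> by (simp add: continuous_on_eq_continuous_at)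
      show "norm (f (\<phi> a)) \<le> C" for a using C \<phi>(2) by blast
    qed (use \<rho> conv in \<open>auto simp: comp_def\<close>)
    \<comment> \<open>As \<open>\<phi> (s x) = x\<close> on \<open>X\<close>, the integrals of
      \<open>f \<circ> \<phi>\<close> against the laws of \<open>s\<close> are the original ones;
      continuity is asked of \<open>\<phi>\<close> and not of \<open>s\<close>.\<close>
    moreover have "(\<integral>a. f (\<phi> a) \<partial>\<mu> n) = (\<integral>x. f x \<partial>\<gamma> n)" for n
    proof -
      have "(\<integral>a. f (\<phi> a) \<partial>\<mu> n) = (\<integral>x. f (\<phi> (s x)) \<partial>\<gamma> n)"
        unfolding \<mu>_def using sm f\<phi> by (intro integral_distr borel_measurable_continuous_onI) auto
      also have "\<dots> = (\<integral>x. f x \<partial>\<gamma> n)"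
        using inv prob_measuresD(3)[OF \<gamma>] by (intro Bochner_Integration.integral_cong) auto
      finally show ?thesis .
    qed
    moreover have "(\<integral>x. f x \<partial>\<nu>) = (\<integral>a. f (\<phi> a) \<partial>\<rho>)"
      unfolding \<nu>_def by (rule integral_distr[OF \<phi>m' fm])
    ultimately show ?thesis by simp
  qed
  then show thesis using that r \<nu> by blast
qed

section \<open>Powers of the base set, marginals and couplings\<close>

lemma convex_cpower: "convex \<Omega> \<Longrightarrow> convex (cpower \<Omega>)"
  by (auto simp: cpower_def convex_def)

lemma compact_cpower:
  fixes \<Omega> :: "(real^'d) set"
  assumes "compact \<Omega>"
  shows "compact (cpower \<Omega> :: (real^'d^'k::finite) set)"
proof -
  obtain B where B: "\<And>x. x \<in> \<Omega> \<Longrightarrow> norm x \<le> B"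
    using compact_imp_bounded[OF assms] by (auto simp: bounded_iff)
  have "norm x \<le> (\<Sum>l\<in>(UNIV::'k set). B)" if "x \<in> cpower \<Omega>" for x :: "real^'d^'k"
  proof -
    have "norm x \<le> (\<Sum>l\<in>UNIV. norm (x $ l))"
      unfolding norm_vec_def by (rule L2_set_le_sum) simp
    also have "\<dots> \<le> (\<Sum>l\<in>(UNIV::'k set). B)" using that B by (intro sum_mono) (auto simp: cpower_def)
    finally show ?thesis .
  qed
  then have "bounded (cpower \<Omega> :: (real^'d^'k) set)" by (rule boundedI)
  moreover have "closed (cpower \<Omega> :: (real^'d^'k) set)"
    unfolding cpower_def
    using compact_imp_closed[OF assms]
    by (intro closed_Collect_all continuous_closed_vimage[of \<Omega> "\<lambda>x. x $ _", unfolded vimage_def]) auto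
  ultimately show ?thesis by (simp add: compact_eq_bounded_closed)
qed

lemma marginal_prob_measures:
  fixes \<gamma> :: "(real^'d^'k::finite) measure"
  assumes \<gamma>: "\<gamma> \<in> prob_measures (cpower \<Omega>)"
  shows "(\<lambda>x. x $ l) \<in> measurable \<gamma> (borel_on \<Omega>)" "marginal \<Omega> l \<gamma> \<in> prob_measures \<Omega>"
proof -
  interpret prob_space \<gamma> by (rule prob_measuresD[OF \<gamma>])
  show m: "(\<lambda>x. x $ l) \<in> measurable \<gamma> (borel_on \<Omega>)"
  proof (rule measurable_restrict_space2)
    show "(\<lambda>x. x $ l) \<in> borel_measurable \<gamma>"
      by (rule prob_measures_measurable[OF \<gamma>]) (intro continuous_intros)
    show "(\<lambda>x. x $ l) \<in> space \<gamma> \<rightarrow> \<Omega>" using prob_measuresD(3)[OF \<gamma>] by (auto simp: cpower_def)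
  qed
  show "marginal \<Omega> l \<gamma> \<in> prob_measures \<Omega>"
    using prob_space_distr[OF m] by (simp add: marginal_def prob_measures_def)
qed

text \<open>The witness is the independent coupling: the product measure, moved from functions to
  vectors.\<close>

lemma couplings_nonempty:
  fixes \<mu> :: "'k::finite \<Rightarrow> (real^'d) measure"
  assumes \<mu>: "\<And>l. \<mu> l \<in> prob_measures \<Omega>"
  shows "couplings \<Omega> \<mu> \<noteq> {}"
proof -
  interpret product_prob_space \<mu> UNIV
    by (intro product_prob_spaceI prob_measuresD[OF \<mu>])
  let ?P = "PiM UNIV \<mu>"
  let ?h = "\<lambda>\<omega>. (\<chi> l. \<omega> l) :: real^'d^'k"
  have comp: "(\<lambda>\<omega>. \<omega> l) \<in> borel_measurable ?P" for l
    by (rule measurable_compose[of "\<lambda>\<omega>. \<omega> l" ?P "\<mu> l" "\<lambda>x. x"])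
       (auto intro: measurable_component_singleton prob_measures_measurable[OF \<mu> continuous_on_id])
  have h: "?h \<in> measurable ?P (borel_on (cpower \<Omega>))"
  proof (rule measurable_restrict_space2)
    \<comment> \<open>Writing the vector as a sum of axis vectors reduces measurability to single
      coordinates.\<close>
    have "?h = (\<lambda>\<omega>. \<Sum>l\<in>UNIV. axis l (\<omega> l))"
    proof
      fix \<omega> :: "'k \<Rightarrow> real^'d"
      show "?h \<omega> = (\<Sum>l\<in>UNIV. axis l (\<omega> l))"
        by (simp add: vec_eq_iff axis_def if_distrib[where f="\<lambda>f. f $ _"] sum.delta cong: if_cong)
    qed
    moreover have "(\<lambda>\<omega>. axis l (\<omega> l) :: real^'d^'k) \<in> borel_measurable ?P" for l
    proof (rule measurable_compose[OF comp])
      have "bounded_linear (axis l :: _ \<Rightarrow> real^'d^'k)"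
        by (rule linear_conv_bounded_linear[THEN iffD1], rule linearI) (auto simp: axis_def vec_eq_iff)
      then show "(axis l :: _ \<Rightarrow> real^'d^'k) \<in> borel_measurable borel"
        by (intro borel_measurable_continuous_onI linear_continuous_on)
    qed
    ultimately show "?h \<in> borel_measurable ?P" by (simp add: borel_measurable_sum)
    show "?h \<in> space ?P \<rightarrow> cpower \<Omega>"
      using prob_measuresD(3)[OF \<mu>] by (auto simp: cpower_def space_PiM PiE_iff)
  qed
  let ?\<gamma> = "distr ?P (borel_on (cpower \<Omega>)) ?h"
  have \<gamma>: "?\<gamma> \<in> prob_measures (cpower \<Omega>)"
    using prob_space_distr[OF h] by (simp add: prob_measures_def)
  have "marginal \<Omega> l ?\<gamma> = \<mu> l" for l
  proof -
    have "marginal \<Omega> l ?\<gamma> = distr ?P (borel_on \<Omega>) ((\<lambda>x. x $ l) \<circ> ?h)"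
      unfolding marginal_def
      using marginal_prob_measures(1)[OF \<gamma>, of l] h by (intro distr_distr) auto
    also have "\<dots> = distr ?P (\<mu> l) (\<lambda>\<omega>. \<omega> l)"
      using prob_measuresD(2)[OF \<mu>] by (intro distr_cong) auto
    also have "\<dots> = \<mu> l" by (rule PiM_component) simp
    finally show ?thesis .
  qed
  then show ?thesis using \<gamma> by (auto simp: couplings_def)
qed

text \<open>The direct method: a minimising sequence has a weakly convergent subsequence. The
  marginals survive in the limit because continuous functions of one coordinate are test functions,
  and the cost converges because \<open>L\<close> is one as well.\<close>

lemma static_minimizer:
  fixes \<Omega> :: "(real^'d) set" and \<mu> :: "'k::finite \<Rightarrow> (real^'d) measure"
  assumes \<Omega>: "compact \<Omega>" "convex \<Omega>" and \<mu>: "\<And>l. \<mu> l \<in> prob_measures \<Omega>"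
    and L: "continuous_on (cpower \<Omega>) L"
  obtains \<gamma> where "is_arg_min (static_cost L) (\<lambda>\<gamma>. \<gamma> \<in> couplings \<Omega> \<mu>) \<gamma>"
proof -
  let ?X = "cpower \<Omega> :: (real^'d^'k) set"
  have X: "compact ?X" "convex ?X" using \<Omega> compact_cpower convex_cpower by auto
  obtain B where B: "\<And>x. x \<in> ?X \<Longrightarrow> \<bar>L x\<bar> \<le> B"
    using compact_imp_bounded[OF compact_continuous_image[OF L X(1)]] by (auto simp: bounded_iff)
  let ?S = "static_cost L ` couplings \<Omega> \<mu>"
  have ne: "?S \<noteq> {}" using couplings_nonempty[OF \<mu>] by simp
  have bdd: "bdd_below ?S"
  proof (rule bdd_belowI2)
    fix \<gamma> assume "\<gamma> \<in> couplings \<Omega> \<mu>"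
    then have \<gamma>: "\<gamma> \<in> prob_measures ?X" by (simp add: couplings_def)
    interpret prob_space \<gamma> by (rule prob_measuresD[OF \<gamma>])
    show "- B \<le> static_cost L \<gamma>"
      unfolding static_cost_def
      using prob_measures_integrable[OF \<gamma> X(1) L] B prob_measuresD(3)[OF \<gamma>]
      by (intro integral_ge_const AE_I2) (auto simp: abs_le_iff minus_le_iff)
  qed
  have "\<exists>\<gamma>\<in>couplings \<Omega> \<mu>. static_cost L \<gamma> < Inf ?S + inverse (real (Suc n))" for n
    using cInf_lessD[OF ne, of "Inf ?S + inverse (real (Suc n))"] by auto
  then obtain \<gamma> where \<gamma>c: "\<And>n. \<gamma> n \<in> couplings \<Omega> \<mu>"
    and \<gamma>i: "\<And>n. static_cost L (\<gamma> n) < Inf ?S + inverse (real (Suc n))" by metis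
  have \<gamma>p: "\<gamma> n \<in> prob_measures ?X" for n using \<gamma>c by (simp add: couplings_def)
  obtain r \<nu> where r: "strict_mono r" and \<nu>: "\<nu> \<in> prob_measures ?X"
    and lim: "\<And>f::real^'d^'k \<Rightarrow> real. continuous_on ?X f \<Longrightarrow> (\<lambda>n. \<integral>x. f x \<partial>\<gamma> (r n)) \<longlonglongrightarrow> (\<integral>x. f x \<partial>\<nu>)"
    by (rule prob_measures_seq_compact[OF X \<gamma>p]) (rule that)
  have "marginal \<Omega> l \<nu> = \<mu> l" for l
  proof (rule prob_measures_eqI[OF compact_imp_closed[OF \<Omega>(1)] marginal_prob_measures(2)[OF \<nu>] \<mu>])
    fix f :: "real^'d \<Rightarrow> real" assume f: "continuous_on UNIV f"
    have fm: "f \<in> borel_measurable (borel_on \<Omega>)"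
      by (rule borel_measurable_continuous_on_restrict[OF continuous_on_subset[OF f]]) simp
    have e: "(\<integral>x. f x \<partial>marginal \<Omega> l \<rho>) = (\<integral>x. f (x $ l) \<partial>\<rho>)" if "\<rho> \<in> prob_measures ?X" for \<rho>
      unfolding marginal_def by (rule integral_distr[OF marginal_prob_measures(1)[OF that] fm])
    have "(\<lambda>n. \<integral>x. f (x $ l) \<partial>\<gamma> (r n)) \<longlonglongrightarrow> (\<integral>x. f (x $ l) \<partial>\<nu>)"
      by (intro lim continuous_on_compose2[OF f] continuous_intros) auto
    moreover have "(\<integral>x. f (x $ l) \<partial>\<gamma> (r n)) = (\<integral>x. f x \<partial>\<mu> l)" for n
      using \<gamma>c[of "r n"] e[OF \<gamma>p, of "r n"] by (simp add: couplings_def)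
    ultimately show "(\<integral>x. f x \<partial>marginal \<Omega> l \<nu>) = (\<integral>x. f x \<partial>\<mu> l)"
      using e[OF \<nu>] by (simp add: LIMSEQ_const_iff)
  qed
  then have \<nu>c: "\<nu> \<in> couplings \<Omega> \<mu>" using \<nu> by (simp add: couplings_def)
  have "(\<lambda>n. static_cost L (\<gamma> (r n))) \<longlonglongrightarrow> static_cost L \<nu>"
    unfolding static_cost_def by (rule lim[OF L])
  moreover have "(\<lambda>n. Inf ?S + inverse (real (Suc (r n)))) \<longlonglongrightarrow> Inf ?S + 0"
    using LIMSEQ_subseq_LIMSEQ[OF LIMSEQ_inverse_real_of_nat r] by (intro tendsto_intros) (simp add: comp_def)
  ultimately have "static_cost L \<nu> \<le> Inf ?S + 0"
    using \<gamma>i by (intro LIMSEQ_le) (auto intro: less_imp_le)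
  then have "static_cost L \<nu> \<le> static_cost L \<rho>" if "\<rho> \<in> couplings \<Omega> \<mu>" for \<rho>
    using cInf_lower[OF _ bdd, of "static_cost L \<rho>"] that by force
  then show thesis using \<nu>c by (intro that[of \<nu>]) (auto simp: is_arg_min_def not_less)
qed

section \<open>Equality of the two minima\<close>

text \<open>After Fubini the inner integral over \<open>z\<close> equals \<open>L x\<close> for each
  fixed \<open>x\<close>, so the null set in \<open>inv\<close> may depend on \<open>x\<close>. This
  turns the Jensen bound for the interpolating flow into the static cost.\<close>

lemma (in invariant_cost) integral_L_difference:
  assumes \<gamma>: "\<gamma> \<in> prob_measures X"
  shows "(\<integral>\<omega>. L (snd \<omega> - fst \<omega>) \<partial>(p \<Otimes>\<^sub>M \<gamma>)) = static_cost L \<gamma>"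
proof -
  interpret I: interpolation X p \<gamma> using X p \<gamma> by unfold_locales
  have "continuous_on ((\<lambda>(x, z). x - z) ` (X \<times> X)) L" by (rule L_cont)
  moreover have "compact ((\<lambda>(x, z). x - z) ` (X \<times> X))"
    using X(1) by (intro compact_continuous_image compact_Times) (auto simp: case_prod_beta' intro!: continuous_intros)
  ultimately have "compact (L ` (\<lambda>(x, z). x - z) ` (X \<times> X))" by (rule compact_continuous_image)
  then obtain B where B: "\<And>x z. x \<in> X \<Longrightarrow> z \<in> X \<Longrightarrow> \<bar>L (x - z)\<bar> \<le> B"
    using compact_imp_bounded[of "L ` (\<lambda>(x, z). x - z) ` (X \<times> X)"] by (auto simp: bounded_iff)
  have i: "integrable (p \<Otimes>\<^sub>M \<gamma>) (\<lambda>(z, x). L (x - z))"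
  proof (rule I.P.integrable_const_bound[of _ B])
    show "AE \<omega> in p \<Otimes>\<^sub>M \<gamma>. norm (case \<omega> of (z, x) \<Rightarrow> L (x - z)) \<le> B"
      using B by (intro AE_I2) (auto simp: I.space_M)
    have "L \<in> borel_measurable borel" using L_cont by (rule borel_measurable_continuous_onI)
    moreover have "(\<lambda>\<omega>. snd \<omega> - fst \<omega>) \<in> borel_measurable (p \<Otimes>\<^sub>M \<gamma>)"
      using I.V_measurable unfolding I.V_def .
    ultimately show "(\<lambda>(z, x). L (x - z)) \<in> borel_measurable (p \<Otimes>\<^sub>M \<gamma>)"
      unfolding case_prod_beta' by (rule measurable_compose[rotated])
  qed
  have "(\<integral>\<omega>. L (snd \<omega> - fst \<omega>) \<partial>(p \<Otimes>\<^sub>M \<gamma>)) = (\<integral>x. (\<integral>z. L (x - z) \<partial>p) \<partial>\<gamma>)"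
    using I.integral_snd[OF i] by (simp add: case_prod_beta')
  also have "\<dots> = (\<integral>x. L x \<partial>\<gamma>)"
  proof (rule Bochner_Integration.integral_cong[OF refl])
    fix x assume "x \<in> space \<gamma>"
    then have "x \<in> X" using prob_measuresD(3)[OF \<gamma>] by simp
    then have "(\<integral>z. L (x - z) \<partial>p) = (\<integral>z. L x \<partial>p)"
      using inv L_diff_integral(1) by (intro integral_cong_AE) auto
    then show "(\<integral>z. L (x - z) \<partial>p) = L x" by (simp add: prob_space)
  qed
  finally show ?thesis by (simp add: static_cost_def)
qed

theorem theorem2p3:
  fixes \<Omega> :: "(real^'d) set"
    and \<mu> :: "'k::finite \<Rightarrow> (real^'d) measure"
    and p :: "(real^'d^'k) measure"
    and L :: "real^'d^'k \<Rightarrow> real"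
  assumes "compact \<Omega>" and "convex \<Omega>"
    and "\<And>l. \<mu> l \<in> prob_measures \<Omega>"
    and "p \<in> prob_measures (cpower \<Omega>)"
    and "convex_on UNIV L"
    and "\<And>x. x \<in> cpower \<Omega> \<Longrightarrow> AE z in p. L (x - z) = L x"
  shows
    "(\<exists>\<gamma> \<pi> m.
        is_arg_min (static_cost L) (\<lambda>\<gamma>. \<gamma> \<in> couplings \<Omega> \<mu>) \<gamma> \<and>
        is_arg_min (dynamic_cost L) (\<lambda>f. f \<in> flows \<Omega> p \<mu>) (\<pi>, m) \<and>
        ereal (static_cost L \<gamma>) = dynamic_cost L (\<pi>, m)) \<and>
     (\<forall>\<gamma>. is_arg_min (static_cost L) (\<lambda>\<gamma>. \<gamma> \<in> couplings \<Omega> \<mu>) \<gamma> \<longrightarrow>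
        (\<exists>\<pi> m. is_arg_min (dynamic_cost L) (\<lambda>f. f \<in> flows \<Omega> p \<mu>) (\<pi>, m) \<and> \<pi> 1 = \<gamma>)) \<and>
     (\<forall>\<pi> m. is_arg_min (dynamic_cost L) (\<lambda>f. f \<in> flows \<Omega> p \<mu>) (\<pi>, m) \<longrightarrow>
        is_arg_min (static_cost L) (\<lambda>\<gamma>. \<gamma> \<in> couplings \<Omega> \<mu>) (\<pi> 1))"
proof -
  let ?X = "cpower \<Omega> :: (real^'d^'k) set"
  have X: "compact ?X" "convex ?X"
    using assms(1,2) compact_cpower convex_cpower by auto
  interpret invariant_cost ?X p L
    using X assms(4-6) by unfold_locales
  have lower: "\<pi> 1 \<in> couplings \<Omega> \<mu> \<and> ereal (static_cost L (\<pi> 1)) \<le> dynamic_cost L (\<pi>, m)"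
    if f: "(\<pi>, m) \<in> flows \<Omega> p \<mu>" for \<pi> m
  proof -
    obtain r where "flow ?X \<pi> m r"
      using f X unfolding flows_def flow_def by auto
    moreover have "continuity_equation ?X \<pi> m" "\<pi> 0 = p" using f by (auto simp: flows_def)
    ultimately have "ereal (static_cost L (\<pi> 1)) \<le> dynamic_cost L (\<pi>, m)"
      by (rule static_cost_le_dynamic_cost)
    moreover have "\<pi> 1 \<in> couplings \<Omega> \<mu>"
      using f weak_path_prob_measures[of ?X \<pi> 1] by (auto simp: flows_def couplings_def)
    ultimately show ?thesis by blast
  qed
  have upper: "\<exists>\<pi> m. (\<pi>, m) \<in> flows \<Omega> p \<mu> \<and> \<pi> 1 = \<gamma> \<and> dynamic_cost L (\<pi>, m) \<le> ereal (static_cost L \<gamma>)"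
    if c: "\<gamma> \<in> couplings \<Omega> \<mu>" for \<gamma>
  proof -
    have \<gamma>: "\<gamma> \<in> prob_measures ?X" using c by (simp add: couplings_def)
    interpret I: interpolation ?X p \<gamma> using X assms(4) \<gamma> by unfold_locales
    have "(I.path, I.momentum) \<in> flows \<Omega> p \<mu>"
      using I.path_continuous I.spacetime_momentum I.momentum_abs_continuous I.velocity_moment
        I.continuity_equation I.path_0 I.path_1 c
      by (auto simp: flows_def couplings_def intro!: exI[of _ 2])
    moreover have "dynamic_cost L (I.path, I.momentum) \<le> ereal (static_cost L \<gamma>)"
      using I.dynamic_cost_le[OF assms(5)] integral_L_difference[OF \<gamma>] by (simp add: I.V_def)
    ultimately show ?thesis using I.path_1 by blast
  qed
  let ?static = "is_arg_min (static_cost L) (\<lambda>\<gamma>. \<gamma> \<in> couplings \<Omega> \<mu>)"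
  let ?dynamic = "is_arg_min (dynamic_cost L) (\<lambda>f. f \<in> flows \<Omega> p \<mu>)"
  have forward: "\<exists>\<pi> m. ?dynamic (\<pi>, m) \<and> \<pi> 1 = \<gamma> \<and> ereal (static_cost L \<gamma>) = dynamic_cost L (\<pi>, m)"
    if \<gamma>: "?static \<gamma>" for \<gamma>
  proof -
    obtain \<pi> m where f: "(\<pi>, m) \<in> flows \<Omega> p \<mu>" "\<pi> 1 = \<gamma>" "dynamic_cost L (\<pi>, m) \<le> ereal (static_cost L \<gamma>)"
      using upper[of \<gamma>] \<gamma> unfolding is_arg_min_def by blast
    \<comment> \<open>Every competing flow ends in a coupling, so its cost is at least the static
      cost of that coupling, hence at least that of \<open>\<gamma>\<close>.\<close>
    have le: "ereal (static_cost L \<gamma>) \<le> dynamic_cost L (\<pi>', m')" if "(\<pi>', m') \<in> flows \<Omega> p \<mu>" for \<pi>' m'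
    proof -
      have "static_cost L \<gamma> \<le> static_cost L (\<pi>' 1)"
        using \<gamma> lower[OF that] by (auto simp: is_arg_min_def not_less)
      then show ?thesis using lower[OF that] by (meson ereal_less_eq(3) order_trans)
    qed
    have "?dynamic (\<pi>, m)"
      using f(1) order_trans[OF f(3) le] by (auto simp: is_arg_min_def not_less[symmetric])
    moreover have "ereal (static_cost L \<gamma>) = dynamic_cost L (\<pi>, m)"
      using f(3) le[OF f(1)] by (rule antisym[rotated])
    ultimately show ?thesis using f(2) by blast
  qed
  have backward: "?static (\<pi> 1)" if d: "?dynamic (\<pi>, m)" for \<pi> m
  proof -
    have l: "\<pi> 1 \<in> couplings \<Omega> \<mu>" "ereal (static_cost L (\<pi> 1)) \<le> dynamic_cost L (\<pi>, m)"
      using d lower by (auto simp: is_arg_min_def)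
    \<comment> \<open>The chain is: static cost of \<open>\<pi> 1\<close>, cost of the given flow,
      cost of the flow induced by \<open>\<gamma>\<close>, static cost of \<open>\<gamma>\<close>,
      each at most the next.\<close>
    have "static_cost L (\<pi> 1) \<le> static_cost L \<gamma>" if c: "\<gamma> \<in> couplings \<Omega> \<mu>" for \<gamma>
    proof -
      obtain \<pi>' m' where u: "(\<pi>', m') \<in> flows \<Omega> p \<mu>" "dynamic_cost L (\<pi>', m') \<le> ereal (static_cost L \<gamma>)"
        using upper[OF c] by blast
      have "dynamic_cost L (\<pi>, m) \<le> dynamic_cost L (\<pi>', m')"
        using d u(1) by (auto simp: is_arg_min_def not_less)
      then show ?thesis using l(2) u(2) by (meson ereal_less_eq(3) order_trans)
    qed
    then show ?thesis using l(1) by (auto simp: is_arg_min_def not_less)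
  qed
  obtain \<gamma> where \<gamma>: "?static \<gamma>"
    by (rule static_minimizer[OF assms(1-3) L_cont])
  show ?thesis
  proof (intro conjI allI impI)
    show "\<exists>\<gamma> \<pi> m. ?static \<gamma> \<and> ?dynamic (\<pi>, m) \<and> ereal (static_cost L \<gamma>) = dynamic_cost L (\<pi>, m)"
      using \<gamma> forward[OF \<gamma>] by blast
  next
    fix \<gamma> assume "?static \<gamma>"
    then show "\<exists>\<pi> m. ?dynamic (\<pi>, m) \<and> \<pi> 1 = \<gamma>" using forward by blast
  next
    fix \<pi> m assume "?dynamic (\<pi>, m)"
    then show "?static (\<pi> 1)" by (rule backward)
  qed
qed

end
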